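(* Let $V$ be a simple vertex operator algebra and $G$ a finite group of automorphisms of $V$. For $i=1,2,3$ let $\mathcal S_i$ be a finite $G$-stable set of pairwise inequivalent irreducible $V$-modules, and let $\mathcal L_i=\bigoplus_{L\in\mathcal S_i}L=\bigoplus_{(j_i,\lambda_i)\in\Gamma_i}W^i_{(j_i,\lambda_i)}\otimes M^i_{(j_i,\lambda_i)}$ be the decomposition of $\mathcal L_i$ as an $\mathcal A_{\alpha_i}(G,\mathcal S_i)\otimes V^G$-module described in the context. Let $((j_1,\lambda_1),(j_2,\lambda_2),(j_3,\lambda_3))\in\Gamma_1\times\Gamma_2\times\Gamma_3$, and fix a nonzero $v^{10}\in M^1_{(j_1,\lambda_1)}$ and a nonzero $v^{20}\in M^2_{(j_2,\lambda_2)}$. Then there exists an injective linear map from $$\mathrm{Hom}_{\mathcal A_{\alpha_3}(G,\mathcal S_3)}\big(W^3_{(j_3,\lambda_3)},\ \mathcal I_{(j_1,\lambda_1),(j_2,\lambda_2)}(v^{10},v^{20})\big)$$ to $I_{V^G}\binom{M^3_{(j_3,\lambda_3)}}{M^1_{(j_1,\lambda_1)}\ M^2_{(j_2,\lambda_2)}}$. In particular, $$\dim_{\mathbb C}I_{V^G}\binom{M^3_{(j_3,\lambda_3)}}{M^1_{(j_1,\lambda_1)}\ M^2_{(j_2,\lambda_2)}}\ \geq\ \dim_{\mathbb C}\mathrm{Hom}_{\mathcal A_{\alpha_3}(G,\mathcal S_3)}\big(W^3_{(j_3,\lambda_3)},\ \mathcal I_{(j_1,\lambda_1),(j_2,\l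ambda_2)}(v^{10},v^{20})\big).$$
   Context: Vertex operator algebras and their (ordinary) modules are over $\mathbb C$, in the sense of Frenkel–Huang–Lepowsky. $V^G$ is the vertex operator subalgebra of $G$-fixed points of $V$. Intertwining operators. For modules $L^1,L^2,L^3$ over a vertex operator algebra $V$, an intertwining operator of type $\binom{L^3}{L^1\ L^2}$ is a linear map $I(\cdot,z):L^1\to \mathrm{Hom}_{\mathbb C}(L^2,L^3)\{z\}$, $v\mapsto I(v,z)=\sum_{\gamma\in\mathbb C}v_\gamma z^{-\gamma-1}$, such that for $u\in V$, $v\in L^1$, $w\in L^2$: (1) for each fixed $\gamma\in\mathbb C$, $v_{\gamma+n}w=0$ for $n\in\mathbb Z$ sufficiently large; (2) $I(L(-1)v,z)=\frac{d}{dz}I(v,z)$; (3) $z_0^{-1}\delta(\frac{z_1-z_2}{z_0})Y_{L^3}(u,z_1)I(v,z_2)w-z_0^{-1}\delta(\frac{-z_2+z_1}{z_0})I(v,z_2)Y_{L^2}(u,z_1)w=z_2^{-1}\delta(\frac{z_1-z_0}{z_2})I(Y_{L^1}(u,z_0)v,z_2)w$. Here $X\{z\}$ denotes formal series in arbitrary complex powers of $z$ with coefficients in $X$. The space of all such operators is $I_V\binom{L^3}{L^1\ L^2}$; the same definition applies with $V^G$ in place of $V$. Action of $G$ on modules. For an irreducible $V$-module $(L,Y_L)$ and $a\in G$, $L\circ a$ is the irreducible $V$-module with underlying space $L$ and $Y_{L\circ a}(u,z)=Y_L(au,z)$. A set $\mathcal S$ of irreducible $V$-modules is $G$-stable if for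 all $L\in\mathcal S$, $a\in G$ there is $M\in\mathcal S$ with $L\circ a\simeq M$. For a finite $G$-stable set $\mathcal S$ of pairwise inequivalent irreducible $V$-modules, $L\cdot a$ denotes the unique $M\in\mathcal S$ with $L\circ a\simeq M$. The algebra $\mathcal A_\alpha(G,\mathcal S)$. For $L\in\mathcal S$, $a\in G$ fix a linear isomorphism $\phi(a,L):L\to L\cdot a^{-1}$ with $\phi(a,L)Y_L(v,z)=Y_{L\cdot a^{-1}}(av,z)\phi(a,L)$ for all $v\in V$. There are scalars $\alpha_L(b,a)\in\mathbb C^\times$ with $\phi(b,L\cdot a^{-1})\phi(a,L)=\alpha_L(b,a)\phi(ba,L)$. Let $\mathbb C\mathcal S=\bigoplus_{L\in\mathcal S}\mathbb Ce(L)$ with $e(L)e(M)=\delta_{L,M}e(L)$. Then $\mathcal A_\alpha(G,\mathcal S)=\mathbb C[G]\otimes\mathbb C\mathcal S$ with product $(a\otimes e(L))\cdot(b\otimes e(M))=\alpha_M(a,b)\,ab\otimes e(L\cdot b)e(M)$ is a finite-dimensional semisimple associative algebra with identity $\sum_{L}1\otimes e(L)$. It acts on $\mathcal L=\bigoplus_{L\in\mathcal S}L$ by $(a\otimes e(L))\cdot w=\delta_{L,M}\phi(a,L)w$ for $w\in M\in\mathcal S$; this action commutes with that of $V^G$. Decomposition. Let $\mathcal S=\bigsqcup_{j\in J}\mathcal O_j$ be the $G$-orbit decomposition, with a representative $L^{(j)}\in\mathcal O_j$. For $L\in \mathcal S$ put $G_L=\{a\in G: L\circ a\simeq L\}$,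 $S(L)=\mathrm{Span}\{a\otimes e(L): a\in G_L\}$ (a subalgebra isomorphic to the twisted group algebra $\mathbb C^{\alpha_L}[G_L]$), and $D(L)=\mathrm{Span}\{a\otimes e(L):a\in G\}$. Let $\Lambda_j$ be the set of irreducible characters of $\mathbb C^{\alpha_{L^{(j)}}}[G_{L^{(j)}}]$, let $U_{(j,\lambda)}$ be the simple module with character $\lambda\in\Lambda_j$, and $\Gamma=\{(j,\lambda): j\in J,\lambda\in\Lambda_j\}$. Put $W_{(j,\lambda)}=D(L^{(j)})\otimes_{S(L^{(j)})}U_{(j,\lambda)}$; these form a complete list of simple $\mathcal A_\alpha(G,\mathcal S)$-modules. Let $M_{(j,\lambda)}=\mathrm{Hom}_{S(L^{(j)})}(U_{(j,\lambda)},L^{(j)})$, a $V^G$-module through the action of $V^G$ on $L^{(j)}$. By Dong–Yamskulna, $\mathcal L=\bigoplus_{(j,\lambda)\in\Gamma}W_{(j,\lambda)}\otimes M_{(j,\lambda)}$ as an $\mathcal A_\alpha(G,\mathcal S)\otimes V^G$-module, the element $(x\otimes u)\otimes h$ ($x\in D(L^{(j)})$, $u\in U_{(j,\lambda)}$, $h\in M_{(j,\lambda)}$) being identified with $x\cdot h(u)\in\mathcal L$; the $M_{(j,\lambda)}$ are nonzero irreducible pairwise inequivalent $V^G$-modules. For $i=1,2,3$ these objects for $\mathcal S=\mathcal S_i$ are denoted $\mathcal L_i,\phi_i,\alpha_i,\Gamma_i,W^i_{(j_i,\lambda_i)},M^i_{(j_i,\lambda_i)}$. The module $\mathcal I$.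 Let $\mathcal I=\bigoplus_{(L^1,L^2,L^3)\in\mathcal S_1\times\mathcal S_2\times\mathcal S_3}I_V\binom{L^3}{L^1\ L^2}\otimes_{\mathbb C}L^1\otimes_{\mathbb C}L^2$. For $f\in I_V\binom{L^3}{L^1\ L^2}$ and $a\in G$ define ${}_af\in I_V\binom{L^3\cdot a^{-1}}{L^1\cdot a^{-1}\ L^2\cdot a^{-1}}$ by ${}_af(v,z)=\phi_3(a,L^3)f(\phi_1(a,L^1)^{-1}v,z)\phi_2(a,L^2)^{-1}$ for $v\in L^1\cdot a^{-1}$. Then $\mathcal A_{\alpha_3}(G,\mathcal S_3)$ acts on $\mathcal I$ by $(a\otimes e(M))\cdot(f\otimes v\otimes w)=\delta_{M,L^3}\;{}_af\otimes\phi_1(a,L^1)v\otimes\phi_2(a,L^2)w$ for $M\in\mathcal S_3$, $v\in L^1$, $w\in L^2$, $f\in I_V\binom{L^3}{L^1\ L^2}$. For $v^{i0}\in M^i_{(j_i,\lambda_i)}$ ($i=1,2$), $\mathcal I_{(j_1,\lambda_1),(j_2,\lambda_2)}(v^{10},v^{20})$ is the linear span of all elements $f\otimes(w^1\otimes v^{10})\otimes(w^2\otimes v^{20})\in\mathcal I$ with $w^1\in W^1_{(j_1,\lambda_1)}$, $w^2\in W^2_{(j_2,\lambda_2)}$, that is, with $w^1\otimes v^{10}\in L^1$, $w^2\otimes v^{20}\in L^2$ and $f\in I_V\binom{L^3}{L^1\ L^2}$ for some $L^i\in\mathcal S_i$. It is an $\mathcal A_{\alpha_3}(G,\mathcal S_3)$-submodule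 of $\mathcal I$. *)

theory Defs
  imports Complex_Main "HOL-Library.Function_Algebras" "HOL-Library.Groups_Big_Fun"
    "HOL-Algebra.Bij"
begin

section \<open>Complex vector spaces\<close>

class complex_vector = ab_group_add +
  fixes scaleC :: "complex \<Rightarrow> 'a \<Rightarrow> 'a"  (infixr \<open>*\<^sub>C\<close> 75)
  assumes scaleC_add_right: "a *\<^sub>C (x + y) = a *\<^sub>C x + a *\<^sub>C y"
    and scaleC_add_left: "(a + b) *\<^sub>C x = a *\<^sub>C x + b *\<^sub>C x"
    and scaleC_scaleC: "a *\<^sub>C (b *\<^sub>C x) = (a * b) *\<^sub>C x"
    and scaleC_one: "1 *\<^sub>C x = x"

global_interpretation cvec: vector_space "scaleC :: complex \<Rightarrow> 'a \<Rightarrow> 'a::complex_vector"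
  by unfold_locales (simp_all add: scaleC_add_right scaleC_add_left scaleC_scaleC scaleC_one)

global_interpretation cvec_pair: vector_space_pair
  "scaleC :: complex \<Rightarrow> 'a \<Rightarrow> 'a::complex_vector" "scaleC :: complex \<Rightarrow> 'b \<Rightarrow> 'b::complex_vector"
  by unfold_locales

instantiation complex :: complex_vector
begin
definition scaleC_complex :: "complex \<Rightarrow> complex \<Rightarrow> complex"
  where "scaleC_complex a x = a * x"
instance by standard (simp_all add: scaleC_complex_def algebra_simps)
end

instantiation "fun" :: (type, complex_vector) complex_vector
begin
definition scaleC_fun :: "complex \<Rightarrow> ('a \<Rightarrow> 'b) \<Rightarrow> 'a \<Rightarrow> 'b"
  where "scaleC_fun c f = (\<lambda>x. c *\<^sub>C f x)"
instance
  by standard (auto simp: scaleC_fun_def fun_eq_iff scaleC_add_right scaleC_add_left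
      scaleC_scaleC scaleC_one)
end

text \<open>Vector spaces are subspaces of an ambient type of class \<^class>\<open>complex_vector\<close>. A space of
  linear or multilinear maps between subspaces consists of the maps that vanish off their domain,
  so that it is itself a subspace of a function type.\<close>

definition linear_on :: "'a::complex_vector set \<Rightarrow> ('a \<Rightarrow> 'b::complex_vector) \<Rightarrow> bool" where
  "linear_on X f \<longleftrightarrow> (\<forall>x\<in>X. \<forall>y\<in>X. f (x + y) = f x + f y) \<and> (\<forall>c. \<forall>x\<in>X. f (c *\<^sub>C x) = c *\<^sub>C f x)"

definition bilinear_on ::
  "'a::complex_vector set \<Rightarrow> 'b::complex_vector set \<Rightarrow> ('a \<Rightarrow> 'b \<Rightarrow> 'c::complex_vector) \<Rightarrow> bool" where
  "bilinear_on X Y f \<longleftrightarrow> (\<forall>x\<in>X. linear_on Y (f x)) \<and> (\<forall>y\<in>Y. linear_on X (\<lambda>x. f x y))"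

definition finite_dim :: "'a::complex_vector set \<Rightarrow> bool" where
  "finite_dim X \<longleftrightarrow> (\<exists>B. finite B \<and> X \<subseteq> cvec.span B)"

text \<open>The dimension as a cardinal, since the library's natural-number-valued \<open>dim\<close> is 0 for
  infinite-dimensional spaces.\<close>

definition cdim :: "'a::complex_vector set \<Rightarrow> 'a rel" where
  "cdim X = card_of (SOME B. cvec.independent B \<and> cvec.span B = X)"

definition trace_on :: "'a::complex_vector set \<Rightarrow> ('a \<Rightarrow> 'a) \<Rightarrow> complex" where
  "trace_on X f = (let B = SOME B. cvec.independent B \<and> cvec.span B = X
     in \<Sum>b\<in>B. cvec.representation B (f b) b)"

text \<open>The canonical injection of the summand with index \<open>i\<close> into a direct sum.\<close>

definition dsum_in :: "'i \<Rightarrow> 'a::complex_vector \<Rightarrow> 'i \<Rightarrow> 'a" where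
  "dsum_in i x = (\<lambda>k. if k = i then x else 0)"

definition dsum :: "'i set \<Rightarrow> ('i \<Rightarrow> 'a::complex_vector set) \<Rightarrow> ('i \<Rightarrow> 'a) set" where
  "dsum I X = {f. (\<forall>i\<in>I. f i \<in> X i) \<and> (\<forall>i. i \<notin> I \<longrightarrow> f i = 0) \<and> finite {i. f i \<noteq> 0}}"


section \<open>Tensor products\<close>

text \<open>The tensor product of a right \<open>S\<close>-module \<open>X\<close> (action \<open>r\<close>) and a left \<open>S\<close>-module \<open>Y\<close>
  (action \<open>l\<close>), realised inside the dual of the space of balanced bilinear forms. The universal
  property, for balanced maps into arbitrary vector spaces, is proved below.\<close>

definition balanced_maps ::
  "'s set \<Rightarrow> ('a::complex_vector \<Rightarrow> 's \<Rightarrow> 'a) \<Rightarrow> ('s \<Rightarrow> 'b::complex_vector \<Rightarrow> 'b) \<Rightarrow>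
   'a set \<Rightarrow> 'b set \<Rightarrow> ('a \<Rightarrow> 'b \<Rightarrow> 'c::complex_vector) set" where
  "balanced_maps S r l X Y =
     {f. bilinear_on X Y f \<and> (\<forall>x\<in>X. \<forall>s\<in>S. \<forall>y\<in>Y. f (r x s) y = f x (l s y))}"

type_synonym ('a, 'b) tensor = "('a \<Rightarrow> 'b \<Rightarrow> complex) \<Rightarrow> complex"

definition tens ::
  "'s set \<Rightarrow> ('a::complex_vector \<Rightarrow> 's \<Rightarrow> 'a) \<Rightarrow> ('s \<Rightarrow> 'b::complex_vector \<Rightarrow> 'b) \<Rightarrow>
   'a set \<Rightarrow> 'b set \<Rightarrow> 'a \<Rightarrow> 'b \<Rightarrow> ('a, 'b) tensor" where
  "tens S r l X Y x y = (\<lambda>\<beta>. if \<beta> \<in> balanced_maps S r l X Y then \<beta> x y else 0)"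

definition tensor_space ::
  "'s set \<Rightarrow> ('a::complex_vector \<Rightarrow> 's \<Rightarrow> 'a) \<Rightarrow> ('s \<Rightarrow> 'b::complex_vector \<Rightarrow> 'b) \<Rightarrow>
   'a set \<Rightarrow> 'b set \<Rightarrow> ('a, 'b) tensor set" where
  "tensor_space S r l X Y = cvec.span {tens S r l X Y x y |x y. x \<in> X \<and> y \<in> Y}"

text \<open>The linear map on the tensor product induced by a balanced map.\<close>

definition tensor_lift ::
  "'s set \<Rightarrow> ('a::complex_vector \<Rightarrow> 's \<Rightarrow> 'a) \<Rightarrow> ('s \<Rightarrow> 'b::complex_vector \<Rightarrow> 'b) \<Rightarrow>
   'a set \<Rightarrow> 'b set \<Rightarrow> ('a \<Rightarrow> 'b \<Rightarrow> 'c::complex_vector) \<Rightarrow> ('a, 'b) tensor \<Rightarrow> 'c" where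
  "tensor_lift S r l X Y f = (SOME T. linear_on (tensor_space S r l X Y) T \<and>
     (\<forall>x\<in>X. \<forall>y\<in>Y. T (tens S r l X Y x y) = f x y))"

abbreviation ctens :: "'a::complex_vector set \<Rightarrow> 'b::complex_vector set \<Rightarrow> 'a \<Rightarrow> 'b \<Rightarrow> ('a, 'b) tensor" where
  "ctens \<equiv> tens UNIV (\<lambda>x c. c *\<^sub>C x) (*\<^sub>C)"

abbreviation ctensor_space ::
  "'a::complex_vector set \<Rightarrow> 'b::complex_vector set \<Rightarrow> ('a, 'b) tensor set" where
  "ctensor_space \<equiv> tensor_space UNIV (\<lambda>x c. c *\<^sub>C x) (*\<^sub>C)"

abbreviation ctensor_lift ::
  "'a::complex_vector set \<Rightarrow> 'b::complex_vector set \<Rightarrow> ('a \<Rightarrow> 'b \<Rightarrow> 'c::complex_vector) \<Rightarrow>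
   ('a, 'b) tensor \<Rightarrow> 'c" where
  "ctensor_lift \<equiv> tensor_lift UNIV (\<lambda>x c. c *\<^sub>C x) (*\<^sub>C)"

lemma ex_functional:
  fixes z :: "'a::complex_vector"
  assumes "z \<noteq> 0"
  shows "\<exists>\<xi> :: 'a \<Rightarrow> complex. Vector_Spaces.linear (*\<^sub>C) (*\<^sub>C) \<xi> \<and> \<xi> z \<noteq> 0"
proof -
  have "cvec.independent {z}" using assms by simp
  then obtain \<xi> :: "'a \<Rightarrow> complex"
    where "Vector_Spaces.linear (*\<^sub>C) (*\<^sub>C) \<xi>" "\<forall>x\<in>{z}. \<xi> x = 1"
    using cvec_pair.linear_independent_extend[of "{z}" "\<lambda>_. 1::complex"] by auto
  then show ?thesis by auto
qed

lemma linear_on_zero: "linear_on X f \<Longrightarrow> 0 \<in> X \<Longrightarrow> f 0 = 0"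
  unfolding linear_on_def by (metis add_cancel_right_right)

theorem tensor_lift:
  fixes f :: "'a::complex_vector \<Rightarrow> 'b::complex_vector \<Rightarrow> 'c::complex_vector"
  assumes f: "f \<in> balanced_maps S r l X Y"
  shows "linear_on (tensor_space S r l X Y) (tensor_lift S r l X Y f)"
    and "\<And>x y. x \<in> X \<Longrightarrow> y \<in> Y \<Longrightarrow> tensor_lift S r l X Y f (tens S r l X Y x y) = f x y"
proof -
  let ?t = "tens S r l X Y"
  let ?gens = "{?t x y |x y. x \<in> X \<and> y \<in> Y}"
  obtain B where B: "B \<subseteq> ?gens" "cvec.independent B" "?gens \<subseteq> cvec.span B"
    using cvec.maximal_independent_subset by blast
  have "\<forall>b\<in>B. \<exists>p. fst p \<in> X \<and> snd p \<in> Y \<and> b = ?t (fst p) (snd p)"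
  proof
    fix b assume "b \<in> B"
    then obtain x y where "x \<in> X" "y \<in> Y" "b = ?t x y" using B(1) by auto
    then show "\<exists>p. fst p \<in> X \<and> snd p \<in> Y \<and> b = ?t (fst p) (snd p)"
      by (intro exI[of _ "(x, y)"]) simp
  qed
  from bchoice[OF this]
  obtain p where p: "\<forall>b\<in>B. fst (p b) \<in> X \<and> snd (p b) \<in> Y \<and> b = ?t (fst (p b)) (snd (p b))" ..
  obtain T where T: "Vector_Spaces.linear (*\<^sub>C) (*\<^sub>C) T" "\<forall>b\<in>B. T b = f (fst (p b)) (snd (p b))"
    using cvec_pair.linear_independent_extend[OF B(2), of "\<lambda>b. f (fst (p b)) (snd (p b))"] by (elim exE conjE)
  have eq: "T (?t x y) = f x y" if xy: "x \<in> X" "y \<in> Y" for x y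
  proof (rule ccontr)
    assume "T (?t x y) \<noteq> f x y"
    then have "T (?t x y) - f x y \<noteq> 0" by simp
    then obtain \<xi> :: "'c \<Rightarrow> complex"
      where \<xi>: "Vector_Spaces.linear (*\<^sub>C) (*\<^sub>C) \<xi>" "\<xi> (T (?t x y) - f x y) \<noteq> 0"
      using ex_functional by blast
    interpret \<xi>: Vector_Spaces.linear "(*\<^sub>C)" "(*\<^sub>C)" \<xi> by (rule \<xi>(1))
    let ?\<beta> = "\<lambda>x y. \<xi> (f x y)"
    have \<beta>: "?\<beta> \<in> balanced_maps S r l X Y"
      using f by (auto simp: balanced_maps_def bilinear_on_def linear_on_def \<xi>.add \<xi>.scale)
    have lev: "Vector_Spaces.linear (*\<^sub>C) (*\<^sub>C) (\<lambda>t :: ('a, 'b) tensor. t ?\<beta>)"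
      by unfold_locales (simp_all add: scaleC_fun_def scaleC_add_right scaleC_add_left
          scaleC_scaleC scaleC_one)
    have lT: "Vector_Spaces.linear (*\<^sub>C) (*\<^sub>C) (\<lambda>t. \<xi> (T t))"
      using Vector_Spaces.linear_compose[OF T(1) \<xi>(1)] by (simp add: o_def)
    have "?t x y \<in> cvec.span B" using B(3) xy by blast
    then have "?t x y ?\<beta> = \<xi> (T (?t x y))"
    proof (rule cvec_pair.linear_eq_on[OF lev lT])
      fix b assume b: "b \<in> B"
      have "b ?\<beta> = ?t (fst (p b)) (snd (p b)) ?\<beta>" using p b by auto
      also have "\<dots> = \<xi> (T b)" using \<beta> T(2) b by (simp add: tens_def)
      finally show "b ?\<beta> = \<xi> (T b)" .
    qed
    moreover have "?t x y ?\<beta> = \<xi> (f x y)" using \<beta> by (simp add: tens_def)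
    ultimately show False using \<xi>(2) by (simp add: \<xi>.diff)
  qed
  interpret T: Vector_Spaces.linear "(*\<^sub>C)" "(*\<^sub>C)" T by (rule T(1))
  have "linear_on (tensor_space S r l X Y) T"
    by (simp add: linear_on_def T.add T.scale)
  with eq have "\<exists>T. linear_on (tensor_space S r l X Y) T \<and> (\<forall>x\<in>X. \<forall>y\<in>Y. T (?t x y) = f x y)"
    by blast
  from someI_ex[OF this, folded tensor_lift_def]
  show "linear_on (tensor_space S r l X Y) (tensor_lift S r l X Y f)"
    "\<And>x y. x \<in> X \<Longrightarrow> y \<in> Y \<Longrightarrow> tensor_lift S r l X Y f (?t x y) = f x y"
    by blast+
qed

theorem tensor_lift_unique:
  fixes f :: "'a::complex_vector \<Rightarrow> 'b::complex_vector \<Rightarrow> 'c::complex_vector"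
  assumes f: "f \<in> balanced_maps S r l X Y"
    and T: "linear_on (tensor_space S r l X Y) T"
      "\<And>x y. x \<in> X \<Longrightarrow> y \<in> Y \<Longrightarrow> T (tens S r l X Y x y) = f x y"
    and t: "t \<in> tensor_space S r l X Y"
  shows "T t = tensor_lift S r l X Y f t"
proof -
  let ?W = "tensor_space S r l X Y" and ?g = "tensor_lift S r l X Y f"
  let ?E = "{t \<in> ?W. T t = ?g t}"
  have W: "cvec.subspace ?W" by (simp add: tensor_space_def)
  have g: "linear_on ?W ?g" by (rule tensor_lift(1)[OF f])
  have "cvec.subspace ?E"
  proof (rule cvec.subspaceI)
    show "0 \<in> ?E"
      using cvec.subspace_0[OF W] linear_on_zero[OF T(1)] linear_on_zero[OF g] by simp
    show "x + y \<in> ?E" if "x \<in> ?E" "y \<in> ?E" for x y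
      using that cvec.subspace_add[OF W, of x y] T(1) g by (simp add: linear_on_def)
    show "c *\<^sub>C x \<in> ?E" if "x \<in> ?E" for c x
      using that cvec.subspace_scale[OF W, of x c] T(1) g by (simp add: linear_on_def)
  qed
  moreover have "{tens S r l X Y x y |x y. x \<in> X \<and> y \<in> Y} \<subseteq> ?E"
    using T(2) tensor_lift(2)[OF f] by (auto simp: tensor_space_def intro: cvec.span_base)
  ultimately have "?W \<subseteq> ?E"
    unfolding tensor_space_def by (intro cvec.span_minimal)
  then show ?thesis using t by blast
qed


section \<open>Vertex operator algebras and modules\<close>

text \<open>\<open>vop V u n v\<close> is $u_n v$, where $Y(u,z) = \sum_n u_n z^{-n-1}$; similarly for modules.\<close>

record 'v voa =
  vspace :: "'v set"
  vop :: "'v \<Rightarrow> int \<Rightarrow> 'v \<Rightarrow> 'v"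
  vac :: 'v
  cnf :: 'v

record ('v, 'm) vmod =
  mspace :: "'m set"
  mop :: "'v \<Rightarrow> int \<Rightarrow> 'm \<Rightarrow> 'm"

text \<open>The coefficient of $z_0^{-l-1} z_1^{-m-1} z_2^{-k-1}$ in
  $z_0^{-1}\delta(\frac{z_1-z_2}{z_0})Y_3(u,z_1)I(v,z_2)w - z_0^{-1}\delta(\frac{-z_2+z_1}{z_0})I(v,z_2)Y_2(u,z_1)w
   = z_2^{-1}\delta(\frac{z_1-z_0}{z_2})I(Y_1(u,z_0)v,z_2)w$, for all $l$, $m$, $k$. On the right
  $(-1)^i\binom{i-m-1}{i} = \binom{m}{i}$ has been used. The exponents of $z_2$ range over \<open>'k\<close>,
  the integers for modules and the complex numbers for intertwining operators. The sums are
  finite because of the truncation conditions.\<close>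

definition jacobi ::
  "('v \<Rightarrow> int \<Rightarrow> 'c \<Rightarrow> 'c) \<Rightarrow> ('a \<Rightarrow> 'k::ring_1 \<Rightarrow> 'b \<Rightarrow> 'c::complex_vector) \<Rightarrow>
   ('v \<Rightarrow> int \<Rightarrow> 'b \<Rightarrow> 'b) \<Rightarrow> ('v \<Rightarrow> int \<Rightarrow> 'a \<Rightarrow> 'a) \<Rightarrow> 'v \<Rightarrow> 'a \<Rightarrow> 'b \<Rightarrow> bool" where
  "jacobi Y3 I Y2 Y1 u v w \<longleftrightarrow> (\<forall>(l::int) (m::int) (k::'k).
     Sum_any (\<lambda>i::nat. ((-1) ^ i * (of_int l gchoose i)) *\<^sub>C
                Y3 u (m + l - int i) (I v (k + of_nat i) w))
   - Sum_any (\<lambda>i::nat. ((-1) powi (l - int i) * (of_int l gchoose i)) *\<^sub>C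
                I v (k + of_int l - of_nat i) (Y2 u (m + int i) w))
   = Sum_any (\<lambda>i::nat. (of_int m gchoose i) *\<^sub>C
                I (Y1 u (l + int i) v) (k + of_int m - of_nat i) w))"

definition Lop :: "'v voa \<Rightarrow> ('v, 'm) vmod \<Rightarrow> int \<Rightarrow> 'm \<Rightarrow> 'm" where
  "Lop V M n = mop M (cnf V) (n + 1)"

definition virasoro ::
  "'v voa \<Rightarrow> ('v, 'm::complex_vector) vmod \<Rightarrow> complex \<Rightarrow> bool" where
  "virasoro V M c \<longleftrightarrow> (\<forall>m n. \<forall>w\<in>mspace M.
     Lop V M m (Lop V M n w) - Lop V M n (Lop V M m w) =
       of_int (m - n) *\<^sub>C Lop V M (m + n) w
       + (if m + n = 0 then (of_int (m ^ 3 - m) / 12 * c) *\<^sub>C w else 0))"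

definition weight_space :: "'v voa \<Rightarrow> ('v, 'm::complex_vector) vmod \<Rightarrow> complex \<Rightarrow> 'm set" where
  "weight_space V M h = {w \<in> mspace M. Lop V M 0 w = h *\<^sub>C w}"

definition adjoint :: "'v voa \<Rightarrow> ('v, 'v) vmod" where
  "adjoint V = \<lparr>mspace = vspace V, mop = vop V\<rparr>"

text \<open>The module axioms apart from the grading. Stating the Virasoro relations for \<open>V\<close>
  and \<open>M\<close> together forces the same central charge.\<close>

definition ungraded_module ::
  "'v::complex_vector voa \<Rightarrow> ('v, 'm::complex_vector) vmod \<Rightarrow> bool" where
  "ungraded_module V M \<longleftrightarrow>
     cvec.subspace (mspace M) \<and>
     (\<forall>n. bilinear_on (vspace V) (mspace M) (\<lambda>u. mop M u n)) \<and>
     (\<forall>u\<in>vspace V. \<forall>n. \<forall>w\<in>mspace M. mop M u n w \<in> mspace M) \<and>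
     (\<forall>u\<in>vspace V. \<forall>w\<in>mspace M. \<exists>N. \<forall>n\<ge>N. mop M u n w = 0) \<and>
     (\<forall>n. \<forall>w\<in>mspace M. mop M (vac V) n w = (if n = -1 then w else 0)) \<and>
     (\<forall>u\<in>vspace V. \<forall>v\<in>vspace V. \<forall>w\<in>mspace M.
        jacobi (mop M) (mop M) (mop M) (vop V) u v w) \<and>
     (\<exists>c. virasoro V (adjoint V) c \<and> virasoro V M c) \<and>
     (\<forall>u\<in>vspace V. \<forall>n. \<forall>w\<in>mspace M.
        mop M (Lop V (adjoint V) (-1) u) n w = - of_int n *\<^sub>C mop M u (n - 1) w)"

text \<open>The grading by weight is not separate data: its homogeneous subspaces are the eigenspaces
  of $L(0)$, which are always independent.\<close>

definition voa :: "'v::complex_vector voa \<Rightarrow> bool" where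
  "voa V \<longleftrightarrow>
     cvec.subspace (vspace V) \<and>
     vac V \<in> weight_space V (adjoint V) 0 \<and>
     cnf V \<in> weight_space V (adjoint V) 2 \<and>
     ungraded_module V (adjoint V) \<and>
     (\<forall>v\<in>vspace V. vop V v (-1) (vac V) = v \<and> (\<forall>n\<ge>0. vop V v n (vac V) = 0)) \<and>
     vspace V = cvec.span (\<Union>n::int. weight_space V (adjoint V) (of_int n)) \<and>
     (\<forall>n::int. finite_dim (weight_space V (adjoint V) (of_int n))) \<and>
     (\<exists>N::int. \<forall>n<N. weight_space V (adjoint V) (of_int n) = {0})"

definition voa_module :: "'v::complex_vector voa \<Rightarrow> ('v, 'm::complex_vector) vmod \<Rightarrow> bool" where
  "voa_module V M \<longleftrightarrow>
     ungraded_module V M \<and>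
     mspace M = cvec.span (\<Union>h. weight_space V M h) \<and>
     (\<forall>h. finite_dim (weight_space V M h)) \<and>
     (\<forall>h. \<exists>N::int. \<forall>n<N. weight_space V M (h + of_int n) = {0})"

definition irreducible_module ::
  "'v::complex_vector voa \<Rightarrow> ('v, 'm::complex_vector) vmod \<Rightarrow> bool" where
  "irreducible_module V M \<longleftrightarrow>
     voa_module V M \<and> mspace M \<noteq> {0} \<and>
     (\<forall>X. cvec.subspace X \<and> X \<subseteq> mspace M \<and> (\<forall>u\<in>vspace V. \<forall>n. \<forall>w\<in>X. mop M u n w \<in> X)
        \<longrightarrow> X = {0} \<or> X = mspace M)"

definition simple_voa :: "'v::complex_vector voa \<Rightarrow> bool" where
  "simple_voa V \<longleftrightarrow> voa V \<and> irreducible_module V (adjoint V)"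

definition module_iso ::
  "'v voa \<Rightarrow> ('v, 'm::complex_vector) vmod \<Rightarrow> ('v, 'n::complex_vector) vmod \<Rightarrow> bool" where
  "module_iso V M N \<longleftrightarrow> (\<exists>\<psi>. linear_on (mspace M) \<psi> \<and> bij_betw \<psi> (mspace M) (mspace N) \<and>
     (\<forall>u\<in>vspace V. \<forall>n. \<forall>w\<in>mspace M. \<psi> (mop M u n w) = mop N u n (\<psi> w)))"

text \<open>\<open>f v k w\<close> is the coefficient $v_k w$ of $z^{-k-1}$ in $I(v,z)w$, for complex \<open>k\<close>.\<close>

definition intertwining_ops ::
  "'v::complex_vector voa \<Rightarrow> ('v, 'm1::complex_vector) vmod \<Rightarrow> ('v, 'm2::complex_vector) vmod \<Rightarrow>
   ('v, 'm3::complex_vector) vmod \<Rightarrow> ('m1 \<Rightarrow> complex \<Rightarrow> 'm2 \<Rightarrow> 'm3) set" where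
  "intertwining_ops V L1 L2 L3 = {f.
     (\<forall>k. bilinear_on (mspace L1) (mspace L2) (\<lambda>v. f v k)) \<and>
     (\<forall>v\<in>mspace L1. \<forall>k. \<forall>w\<in>mspace L2. f v k w \<in> mspace L3) \<and>
     (\<forall>v k w. v \<notin> mspace L1 \<or> w \<notin> mspace L2 \<longrightarrow> f v k w = 0) \<and>
     (\<forall>v\<in>mspace L1. \<forall>w\<in>mspace L2. \<forall>k. \<exists>N::int. \<forall>n\<ge>N. f v (k + of_int n) w = 0) \<and>
     (\<forall>v\<in>mspace L1. \<forall>k. \<forall>w\<in>mspace L2. f (Lop V L1 (-1) v) k w = - k *\<^sub>C f v (k - 1) w) \<and>
     (\<forall>u\<in>vspace V. \<forall>v\<in>mspace L1. \<forall>w\<in>mspace L2.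
        jacobi (mop L3) f (mop L2) (mop L1) u v w)}"


section \<open>Automorphisms\<close>

abbreviation gmul :: "'v voa \<Rightarrow> ('v \<Rightarrow> 'v) \<Rightarrow> ('v \<Rightarrow> 'v) \<Rightarrow> 'v \<Rightarrow> 'v" where
  "gmul V a b \<equiv> a \<otimes>\<^bsub>BijGroup (vspace V)\<^esub> b"

abbreviation ginv :: "'v voa \<Rightarrow> ('v \<Rightarrow> 'v) \<Rightarrow> 'v \<Rightarrow> 'v" where
  "ginv V a \<equiv> inv\<^bsub>BijGroup (vspace V)\<^esub> a"

definition voa_aut :: "'v::complex_vector voa \<Rightarrow> ('v \<Rightarrow> 'v) set" where
  "voa_aut V = {g \<in> Bij (vspace V). linear_on (vspace V) g \<and>
     (\<forall>u\<in>vspace V. \<forall>n. \<forall>v\<in>vspace V. g (vop V u n v) = vop V (g u) n (g v)) \<and>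
     g (vac V) = vac V \<and> g (cnf V) = cnf V}"

definition fixed_voa :: "'v voa \<Rightarrow> ('v \<Rightarrow> 'v) set \<Rightarrow> 'v voa" where
  "fixed_voa V G = V\<lparr>vspace := {v \<in> vspace V. \<forall>g\<in>G. g v = v}\<rparr>"

definition mcirc :: "('v, 'm) vmod \<Rightarrow> ('v \<Rightarrow> 'v) \<Rightarrow> ('v, 'm) vmod" where
  "mcirc L a = L\<lparr>mop := \<lambda>u. mop L (a u)\<rparr>"

definition g_stable ::
  "'v voa \<Rightarrow> ('v \<Rightarrow> 'v) set \<Rightarrow> ('v, 'm::complex_vector) vmod set \<Rightarrow> bool" where
  "g_stable V G S \<longleftrightarrow> (\<forall>L\<in>S. \<forall>a\<in>G. \<exists>M\<in>S. module_iso V (mcirc L a) M)"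

definition mdot ::
  "'v voa \<Rightarrow> ('v, 'm::complex_vector) vmod set \<Rightarrow> ('v, 'm) vmod \<Rightarrow> ('v \<Rightarrow> 'v) \<Rightarrow> ('v, 'm) vmod" where
  "mdot V S L a = (THE M. M \<in> S \<and> module_iso V (mcirc L a) M)"

definition stabilizer ::
  "'v voa \<Rightarrow> ('v \<Rightarrow> 'v) set \<Rightarrow> ('v, 'm::complex_vector) vmod \<Rightarrow> ('v \<Rightarrow> 'v) set" where
  "stabilizer V G L = {a \<in> G. module_iso V (mcirc L a) L}"


section \<open>Modules over associative algebras\<close>

record ('s, 'u) amod =
  aspace :: "'u set"
  aact :: "'s \<Rightarrow> 'u \<Rightarrow> 'u"

definition unital_module ::
  "'s::complex_vector set \<Rightarrow> ('s \<Rightarrow> 's \<Rightarrow> 's) \<Rightarrow> ('s, 'u::complex_vector) amod \<Rightarrow> bool" where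
  "unital_module A mul U \<longleftrightarrow>
     cvec.subspace (aspace U) \<and>
     bilinear_on A (aspace U) (aact U) \<and>
     (\<forall>s\<in>A. \<forall>u\<in>aspace U. aact U s u \<in> aspace U) \<and>
     (\<forall>s\<in>A. \<forall>t\<in>A. \<forall>u\<in>aspace U. aact U (mul s t) u = aact U s (aact U t u)) \<and>
     (\<forall>e\<in>A. (\<forall>s\<in>A. mul e s = s \<and> mul s e = s) \<longrightarrow> (\<forall>u\<in>aspace U. aact U e u = u))"

definition simple_module ::
  "'s::complex_vector set \<Rightarrow> ('s \<Rightarrow> 's \<Rightarrow> 's) \<Rightarrow> ('s, 'u::complex_vector) amod \<Rightarrow> bool" where
  "simple_module A mul U \<longleftrightarrow>
     unital_module A mul U \<and> aspace U \<noteq> {0} \<and>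
     (\<forall>X. cvec.subspace X \<and> X \<subseteq> aspace U \<and> (\<forall>s\<in>A. \<forall>u\<in>X. aact U s u \<in> X)
        \<longrightarrow> X = {0} \<or> X = aspace U)"

definition character :: "'s set \<Rightarrow> ('s, 'u::complex_vector) amod \<Rightarrow> 's \<Rightarrow> complex" where
  "character A U = (\<lambda>s. if s \<in> A then trace_on (aspace U) (aact U s) else 0)"

text \<open>Simple modules of the finite-dimensional algebras considered here are
  finite-dimensional, so up to isomorphism they live on subspaces of \<open>nat \<Rightarrow> complex\<close>.\<close>

definition irr_chars :: "'s::complex_vector set \<Rightarrow> ('s \<Rightarrow> 's \<Rightarrow> 's) \<Rightarrow> ('s \<Rightarrow> complex) set" where
  "irr_chars A mul =
     {character A U |U :: ('s, nat \<Rightarrow> complex) amod. simple_module A mul U}"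

definition hom_space ::
  "'s set \<Rightarrow> 'w::complex_vector set \<Rightarrow> ('s \<Rightarrow> 'w \<Rightarrow> 'w) \<Rightarrow> 'x::complex_vector set \<Rightarrow> ('s \<Rightarrow> 'x \<Rightarrow> 'x)
     \<Rightarrow> ('w \<Rightarrow> 'x) set" where
  "hom_space A W actW X actX = {F. linear_on W F \<and> F ` W \<subseteq> X \<and> (\<forall>w. w \<notin> W \<longrightarrow> F w = 0) \<and>
     (\<forall>s\<in>A. \<forall>w\<in>W. F (actW s w) = actX s (F w))}"


section \<open>The algebra attached to a stable set of modules\<close>

text \<open>An element of $\mathbb{C}[G] \otimes \mathbb{C}\mathcal{S}$ is given by its coefficients at
  $a \otimes e(L)$, and vanishes off \<open>G \<times> S\<close>.\<close>

type_synonym ('v, 'm) galg = "('v \<Rightarrow> 'v) \<times> ('v, 'm) vmod \<Rightarrow> complex"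

text \<open>A set \<open>fmods\<close> of modules, the isomorphisms $\phi(a,L)$, an index set \<open>fidx\<close> for
  the orbits, a representative \<open>frep j\<close> of each orbit, and a simple module \<open>fsimp (j, \<chi>)\<close> for
  each irreducible character.\<close>

record ('v, 'm, 'j, 'u) gfamily =
  fmods :: "('v, 'm) vmod set"
  fphi :: "('v \<Rightarrow> 'v) \<Rightarrow> ('v, 'm) vmod \<Rightarrow> 'm \<Rightarrow> 'm"
  fidx :: "'j set"
  frep :: "'j \<Rightarrow> ('v, 'm) vmod"
  fsimp :: "'j \<times> (('v, 'm) galg \<Rightarrow> complex) \<Rightarrow> (('v, 'm) galg, 'u) amod"

definition alpha ::
  "'v voa \<Rightarrow> ('v, 'm::complex_vector, 'j, 'u) gfamily \<Rightarrow> ('v, 'm) vmod \<Rightarrow>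
   ('v \<Rightarrow> 'v) \<Rightarrow> ('v \<Rightarrow> 'v) \<Rightarrow> complex" where
  "alpha V F L b a = (THE c. \<forall>w\<in>mspace L.
     fphi F b (mdot V (fmods F) L (ginv V a)) (fphi F a L w) = c *\<^sub>C fphi F (gmul V b a) L w)"

definition gbasis :: "('v \<Rightarrow> 'v) \<Rightarrow> ('v, 'm) vmod \<Rightarrow> ('v, 'm) galg" where
  "gbasis a L = (\<lambda>p. if p = (a, L) then 1 else 0)"

definition alg_space ::
  "('v \<Rightarrow> 'v) set \<Rightarrow> ('v, 'm, 'j, 'u) gfamily \<Rightarrow> ('v, 'm) galg set" where
  "alg_space G F = cvec.span {gbasis a L |a L. a \<in> G \<and> L \<in> fmods F}"

definition alg_mult ::
  "'v voa \<Rightarrow> ('v \<Rightarrow> 'v) set \<Rightarrow> ('v, 'm::complex_vector, 'j, 'u) gfamily \<Rightarrow>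
   ('v, 'm) galg \<Rightarrow> ('v, 'm) galg \<Rightarrow> ('v, 'm) galg" where
  "alg_mult V G F x y = (\<Sum>(a, L)\<in>G \<times> fmods F. \<Sum>(b, M)\<in>G \<times> fmods F. (x (a, L) * y (b, M)) *\<^sub>C
     (if mdot V (fmods F) L b = M then alpha V F M a b *\<^sub>C gbasis (gmul V a b) M else 0))"

definition S_alg ::
  "'v voa \<Rightarrow> ('v \<Rightarrow> 'v) set \<Rightarrow> ('v, 'm::complex_vector) vmod \<Rightarrow> ('v, 'm) galg set" where
  "S_alg V G L = cvec.span {gbasis a L |a. a \<in> stabilizer V G L}"

definition D_space :: "('v \<Rightarrow> 'v) set \<Rightarrow> ('v, 'm) vmod \<Rightarrow> ('v, 'm) galg set" where
  "D_space G L = cvec.span {gbasis a L |a. a \<in> G}"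

definition Gamma ::
  "'v voa \<Rightarrow> ('v \<Rightarrow> 'v) set \<Rightarrow> ('v, 'm::complex_vector, 'j, 'u) gfamily \<Rightarrow>
   ('j \<times> (('v, 'm) galg \<Rightarrow> complex)) set" where
  "Gamma V G F = {(j, \<chi>). j \<in> fidx F \<and> \<chi> \<in> irr_chars (S_alg V G (frep F j)) (alg_mult V G F)}"

definition gfamily ::
  "'v::complex_vector voa \<Rightarrow> ('v \<Rightarrow> 'v) set \<Rightarrow>
   ('v, 'm::complex_vector, 'j, 'u::complex_vector) gfamily \<Rightarrow> bool" where
  "gfamily V G F \<longleftrightarrow>
     finite (fmods F) \<and>
     (\<forall>L\<in>fmods F. irreducible_module V L) \<and>
     (\<forall>L\<in>fmods F. \<forall>M\<in>fmods F. module_iso V L M \<longrightarrow> L = M) \<and>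
     g_stable V G (fmods F) \<and>
     (\<forall>a\<in>G. \<forall>L\<in>fmods F.
        linear_on (mspace L) (fphi F a L) \<and>
        bij_betw (fphi F a L) (mspace L) (mspace (mdot V (fmods F) L (ginv V a))) \<and>
        (\<forall>v\<in>vspace V. \<forall>n. \<forall>w\<in>mspace L. fphi F a L (mop L v n w) =
           mop (mdot V (fmods F) L (ginv V a)) (a v) n (fphi F a L w))) \<and>
     (\<forall>j\<in>fidx F. frep F j \<in> fmods F) \<and>
     (\<forall>L\<in>fmods F. \<exists>!j. j \<in> fidx F \<and> (\<exists>a\<in>G. L = mdot V (fmods F) (frep F j) a)) \<and>
     (\<forall>(j, \<chi>)\<in>Gamma V G F.
        simple_module (S_alg V G (frep F j)) (alg_mult V G F) (fsimp F (j, \<chi>)) \<and>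
        character (S_alg V G (frep F j)) (fsimp F (j, \<chi>)) = \<chi>)"

text \<open>The action of the algebra on $\mathcal{L} = \bigoplus_{L \in \mathcal{S}} L$.\<close>

definition L_act ::
  "'v voa \<Rightarrow> ('v \<Rightarrow> 'v) set \<Rightarrow> ('v, 'm::complex_vector, 'j, 'u) gfamily \<Rightarrow>
   ('v, 'm) galg \<Rightarrow> (('v, 'm) vmod \<Rightarrow> 'm) \<Rightarrow> ('v, 'm) vmod \<Rightarrow> 'm" where
  "L_act V G F x w = (\<Sum>(a, L)\<in>G \<times> fmods F.
     x (a, L) *\<^sub>C dsum_in (mdot V (fmods F) L (ginv V a)) (fphi F a L (w L)))"

text \<open>$W_{(j,\lambda)} = D(L^{(j)}) \otimes_{S(L^{(j)})} U_{(j,\lambda)}$.\<close>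

definition W_tens ::
  "'v voa \<Rightarrow> ('v \<Rightarrow> 'v) set \<Rightarrow> ('v, 'm::complex_vector, 'j, 'u::complex_vector) gfamily \<Rightarrow>
   'j \<times> (('v, 'm) galg \<Rightarrow> complex) \<Rightarrow> ('v, 'm) galg \<Rightarrow> 'u \<Rightarrow> (('v, 'm) galg, 'u) tensor" where
  "W_tens V G F \<gamma> = tens (S_alg V G (frep F (fst \<gamma>))) (alg_mult V G F) (aact (fsimp F \<gamma>))
     (D_space G (frep F (fst \<gamma>))) (aspace (fsimp F \<gamma>))"

definition W_space ::
  "'v voa \<Rightarrow> ('v \<Rightarrow> 'v) set \<Rightarrow> ('v, 'm::complex_vector, 'j, 'u::complex_vector) gfamily \<Rightarrow>
   'j \<times> (('v, 'm) galg \<Rightarrow> complex) \<Rightarrow> (('v, 'm) galg, 'u) tensor set" where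
  "W_space V G F \<gamma> = tensor_space (S_alg V G (frep F (fst \<gamma>))) (alg_mult V G F)
     (aact (fsimp F \<gamma>)) (D_space G (frep F (fst \<gamma>))) (aspace (fsimp F \<gamma>))"

definition W_lift ::
  "'v voa \<Rightarrow> ('v \<Rightarrow> 'v) set \<Rightarrow> ('v, 'm::complex_vector, 'j, 'u::complex_vector) gfamily \<Rightarrow>
   'j \<times> (('v, 'm) galg \<Rightarrow> complex) \<Rightarrow> (('v, 'm) galg \<Rightarrow> 'u \<Rightarrow> 'c::complex_vector) \<Rightarrow>
   (('v, 'm) galg, 'u) tensor \<Rightarrow> 'c" where
  "W_lift V G F \<gamma> = tensor_lift (S_alg V G (frep F (fst \<gamma>))) (alg_mult V G F)
     (aact (fsimp F \<gamma>)) (D_space G (frep F (fst \<gamma>))) (aspace (fsimp F \<gamma>))"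

definition W_act ::
  "'v voa \<Rightarrow> ('v \<Rightarrow> 'v) set \<Rightarrow> ('v, 'm::complex_vector, 'j, 'u::complex_vector) gfamily \<Rightarrow>
   'j \<times> (('v, 'm) galg \<Rightarrow> complex) \<Rightarrow> ('v, 'm) galg \<Rightarrow>
   (('v, 'm) galg, 'u) tensor \<Rightarrow> (('v, 'm) galg, 'u) tensor" where
  "W_act V G F \<gamma> x = W_lift V G F \<gamma> (\<lambda>y u. W_tens V G F \<gamma> (alg_mult V G F x y) u)"

text \<open>$M_{(j,\lambda)} = \mathrm{Hom}_{S(L^{(j)})}(U_{(j,\lambda)}, L^{(j)})$ with the pointwise vertex
  operators, to be used as a module for the fixed point subalgebra. The algebra $S(L)$ acts on
  \<open>L\<close> as a summand of $\mathcal{L}$.\<close>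

definition M_module ::
  "'v voa \<Rightarrow> ('v \<Rightarrow> 'v) set \<Rightarrow> ('v, 'm::complex_vector, 'j, 'u::complex_vector) gfamily \<Rightarrow>
   'j \<times> (('v, 'm) galg \<Rightarrow> complex) \<Rightarrow> ('v, 'u \<Rightarrow> 'm) vmod" where
  "M_module V G F \<gamma> = (let L = frep F (fst \<gamma>) in
     \<lparr>mspace = hom_space (S_alg V G L) (aspace (fsimp F \<gamma>)) (aact (fsimp F \<gamma>))
        (mspace L) (\<lambda>s w. L_act V G F s (dsum_in L w) L),
      mop = \<lambda>v n h u. mop L v n (h u)\<rparr>)"

text \<open>The image of $w \otimes h$ under
  $W_{(j,\lambda)} \otimes M_{(j,\lambda)} \to \mathcal{L}$, $(x \otimes u) \otimes h \mapsto x \cdot h(u)$.\<close>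

definition decomp ::
  "'v voa \<Rightarrow> ('v \<Rightarrow> 'v) set \<Rightarrow> ('v, 'm::complex_vector, 'j, 'u::complex_vector) gfamily \<Rightarrow>
   'j \<times> (('v, 'm) galg \<Rightarrow> complex) \<Rightarrow> (('v, 'm) galg, 'u) tensor \<Rightarrow> ('u \<Rightarrow> 'm) \<Rightarrow>
   ('v, 'm) vmod \<Rightarrow> 'm" where
  "decomp V G F \<gamma> w h =
     W_lift V G F \<gamma> (\<lambda>x u. L_act V G F x (dsum_in (frep F (fst \<gamma>)) (h u))) w"


section \<open>The module of intertwining operators and vectors\<close>

type_synonym ('v, 'm1, 'm2, 'm3) fus =
  "('v, 'm1) vmod \<times> ('v, 'm2) vmod \<times> ('v, 'm3) vmod \<Rightarrow>
   (('m1 \<Rightarrow> complex \<Rightarrow> 'm2 \<Rightarrow> 'm3, 'm1) tensor, 'm2) tensor"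

text \<open>$I_V \otimes L^1 \otimes L^2$ is bracketed as $(I_V \otimes L^1) \otimes L^2$.\<close>

definition fus_tens ::
  "'v::complex_vector voa \<Rightarrow> ('v, 'm1::complex_vector) vmod \<times> ('v, 'm2::complex_vector) vmod \<times>
   ('v, 'm3::complex_vector) vmod \<Rightarrow> ('m1 \<Rightarrow> complex \<Rightarrow> 'm2 \<Rightarrow> 'm3) \<Rightarrow> 'm1 \<Rightarrow> 'm2 \<Rightarrow>
   (('m1 \<Rightarrow> complex \<Rightarrow> 'm2 \<Rightarrow> 'm3, 'm1) tensor, 'm2) tensor" where
  "fus_tens V = (\<lambda>(L1, L2, L3) f v w.
     ctens (ctensor_space (intertwining_ops V L1 L2 L3) (mspace L1)) (mspace L2)
       (ctens (intertwining_ops V L1 L2 L3) (mspace L1) f v) w)"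

definition fus_lift ::
  "'v::complex_vector voa \<Rightarrow> ('v, 'm1::complex_vector) vmod \<times> ('v, 'm2::complex_vector) vmod \<times>
   ('v, 'm3::complex_vector) vmod \<Rightarrow>
   (('m1 \<Rightarrow> complex \<Rightarrow> 'm2 \<Rightarrow> 'm3) \<Rightarrow> 'm1 \<Rightarrow> 'm2 \<Rightarrow> 'c::complex_vector) \<Rightarrow>
   (('m1 \<Rightarrow> complex \<Rightarrow> 'm2 \<Rightarrow> 'm3, 'm1) tensor, 'm2) tensor \<Rightarrow> 'c" where
  "fus_lift V = (\<lambda>(L1, L2, L3) g.
     ctensor_lift (ctensor_space (intertwining_ops V L1 L2 L3) (mspace L1)) (mspace L2)
       (\<lambda>t w. ctensor_lift (intertwining_ops V L1 L2 L3) (mspace L1) (\<lambda>f v. g f v w) t))"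

definition fus_gen ::
  "'v::complex_vector voa \<Rightarrow> ('v, 'm1::complex_vector) vmod \<times> ('v, 'm2::complex_vector) vmod \<times>
   ('v, 'm3::complex_vector) vmod \<Rightarrow> ('m1 \<Rightarrow> complex \<Rightarrow> 'm2 \<Rightarrow> 'm3) \<Rightarrow> 'm1 \<Rightarrow> 'm2 \<Rightarrow>
   ('v, 'm1, 'm2, 'm3) fus" where
  "fus_gen V t f v w = dsum_in t (fus_tens V t f v w)"

definition fus_space ::
  "'v::complex_vector voa \<Rightarrow> ('v, 'm1::complex_vector, 'j1, 'u1) gfamily \<Rightarrow>
   ('v, 'm2::complex_vector, 'j2, 'u2) gfamily \<Rightarrow> ('v, 'm3::complex_vector, 'j3, 'u3) gfamily \<Rightarrow>
   ('v, 'm1, 'm2, 'm3) fus set" where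
  "fus_space V F1 F2 F3 = dsum (fmods F1 \<times> fmods F2 \<times> fmods F3) (\<lambda>(L1, L2, L3).
     ctensor_space (ctensor_space (intertwining_ops V L1 L2 L3) (mspace L1)) (mspace L2))"

text \<open>${}_a f(v,z) = \phi_3(a,L^3) f(\phi_1(a,L^1)^{-1} v, z) \phi_2(a,L^2)^{-1}$.\<close>

definition twist_op ::
  "'v voa \<Rightarrow> ('v, 'm1::complex_vector, 'j1, 'u1) gfamily \<Rightarrow>
   ('v, 'm2::complex_vector, 'j2, 'u2) gfamily \<Rightarrow> ('v, 'm3::complex_vector, 'j3, 'u3) gfamily \<Rightarrow>
   ('v \<Rightarrow> 'v) \<Rightarrow> ('v, 'm1) vmod \<times> ('v, 'm2) vmod \<times> ('v, 'm3) vmod \<Rightarrow>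
   ('m1 \<Rightarrow> complex \<Rightarrow> 'm2 \<Rightarrow> 'm3) \<Rightarrow> 'm1 \<Rightarrow> complex \<Rightarrow> 'm2 \<Rightarrow> 'm3" where
  "twist_op V F1 F2 F3 a = (\<lambda>(L1, L2, L3) f v k w.
     if v \<in> mspace (mdot V (fmods F1) L1 (ginv V a)) \<and> w \<in> mspace (mdot V (fmods F2) L2 (ginv V a))
     then fphi F3 a L3 (f (inv_into (mspace L1) (fphi F1 a L1) v) k
            (inv_into (mspace L2) (fphi F2 a L2) w))
     else 0)"

definition fus_act ::
  "'v::complex_vector voa \<Rightarrow> ('v \<Rightarrow> 'v) set \<Rightarrow> ('v, 'm1::complex_vector, 'j1, 'u1) gfamily \<Rightarrow>
   ('v, 'm2::complex_vector, 'j2, 'u2) gfamily \<Rightarrow> ('v, 'm3::complex_vector, 'j3, 'u3) gfamily \<Rightarrow>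
   ('v, 'm3) galg \<Rightarrow> ('v, 'm1, 'm2, 'm3) fus \<Rightarrow> ('v, 'm1, 'm2, 'm3) fus" where
  "fus_act V G F1 F2 F3 x X = (\<Sum>(a, M)\<in>G \<times> fmods F3. x (a, M) *\<^sub>C
     (\<Sum>(L1, L2, L3)\<in>fmods F1 \<times> fmods F2 \<times> fmods F3.
        if L3 = M
        then fus_lift V (L1, L2, L3)
          (\<lambda>f v w. fus_gen V
             (mdot V (fmods F1) L1 (ginv V a), mdot V (fmods F2) L2 (ginv V a),
              mdot V (fmods F3) L3 (ginv V a))
             (twist_op V F1 F2 F3 a (L1, L2, L3) f) (fphi F1 a L1 v) (fphi F2 a L2 w))
          (X (L1, L2, L3))
        else 0))"

text \<open>$\mathcal{I}_{\gamma_1,\gamma_2}(v^{10},v^{20})$: the conditions on \<open>x1\<close> and \<open>x2\<close> say that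
  they are of the form $w^1 \otimes v^{10} \in L^1$ and $w^2 \otimes v^{20} \in L^2$.\<close>

definition fus_sub ::
  "'v::complex_vector voa \<Rightarrow> ('v \<Rightarrow> 'v) set \<Rightarrow>
   ('v, 'm1::complex_vector, 'j1, 'u1::complex_vector) gfamily \<Rightarrow>
   ('v, 'm2::complex_vector, 'j2, 'u2::complex_vector) gfamily \<Rightarrow>
   ('v, 'm3::complex_vector, 'j3, 'u3) gfamily \<Rightarrow>
   'j1 \<times> (('v, 'm1) galg \<Rightarrow> complex) \<Rightarrow> 'j2 \<times> (('v, 'm2) galg \<Rightarrow> complex) \<Rightarrow>
   ('u1 \<Rightarrow> 'm1) \<Rightarrow> ('u2 \<Rightarrow> 'm2) \<Rightarrow> ('v, 'm1, 'm2, 'm3) fus set" where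
  "fus_sub V G F1 F2 F3 \<gamma>1 \<gamma>2 v10 v20 = cvec.span
     {fus_gen V (L1, L2, L3) f x1 x2 |L1 L2 L3 f x1 x2.
        L1 \<in> fmods F1 \<and> L2 \<in> fmods F2 \<and> L3 \<in> fmods F3 \<and> f \<in> intertwining_ops V L1 L2 L3 \<and>
        x1 \<in> mspace L1 \<and> (\<exists>w1\<in>W_space V G F1 \<gamma>1. decomp V G F1 \<gamma>1 w1 v10 = dsum_in L1 x1) \<and>
        x2 \<in> mspace L2 \<and> (\<exists>w2\<in>W_space V G F2 \<gamma>2. decomp V G F2 \<gamma>2 w2 v20 = dsum_in L2 x2)}"

end

theory Submission
  imports Defs "HOL-Computational_Algebra.Fundamental_Theorem_Algebra"
begin

text \<open>The evaluation $f \otimes v \otimes w \mapsto f(v,z)w$ is injective on $\mathcal{I}$: by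
  commutativity its kernel is stable under the action of \<open>V\<close> on the factor $L^2$, by the Jacobi
  identity also under the action on $L^1$, and a nonzero submodule of a sum of irreducible modules
  contains a diagonal copy of one of them.

  Since $U_{(j,\lambda)}$ is simple, $w \otimes v^{i0} \mapsto w \otimes h$ is well defined on
  $W^i \otimes v^{i0}$ for every $h \in M^i$. A homomorphism \<open>T\<close> from $W^3$ to
  $\mathcal{I}(v^{10},v^{20})$ is sent to the operator which at $(h_1,h_2)$ replaces $v^{10}$,
  $v^{20}$ by $h_1$, $h_2$ in the values of \<open>T\<close> and then evaluates. The result is a homomorphism
  from $W^3$ to the coefficients of $\mathcal{L}_3\{z\}$, that is, a series in $M^3$. At
  $(v^{10},v^{20})$ it is the evaluation of the values of \<open>T\<close>, so that \<open>T\<close> is recovered from it.\<close>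

subsection \<open>Linear maps on subspaces\<close>

text \<open>The replacement of v10 by h happens inside a tensor factor, so it is needed as a linear
  map on a whole module L, although it is meaningful only on the part of L met by W \<otimes> v10.
  That part is zero or one copy of U, embedded by u \<mapsto> \<phi>(b)(v10(u)) for a fixed b; a
  linear left inverse of the embedding extends the replacement to L. The extension is a choice, so
  compatibility with the maps \<phi>(a,L) is available on the copies of U only, and evaluation is
  studied on the span of generators built from such vectors. A homomorphism on W, induced from U, is
  controlled by the copy 1 \<otimes> U, as in Frobenius reciprocity; one component of its values
  there gives a map on U, which is what an element of M3 is. The maps \<phi>(1,L) are scalars but
  not necessarily identities, which brings in the nonzero factors alpha(a,1). Elements of M are
  functions on U, so truncation bounds must be uniform in u; simplicity of U spreads the bound of
  one vector. Schur's lemma for infinite-dimensional modules rests on eigenvectors in the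
  finite-dimensional weight spaces.\<close>

lemma linear_on_add: "linear_on X f \<Longrightarrow> x \<in> X \<Longrightarrow> y \<in> X \<Longrightarrow> f (x + y) = f x + f y"
  by (simp add: linear_on_def)

lemma linear_on_scale: "linear_on X f \<Longrightarrow> x \<in> X \<Longrightarrow> f (c *\<^sub>C x) = c *\<^sub>C f x"
  by (simp add: linear_on_def)

lemma linear_on_0: "cvec.subspace X \<Longrightarrow> linear_on X f \<Longrightarrow> f 0 = 0"
  by (simp add: cvec.subspace_0 linear_on_zero)

lemma linear_on_diff:
  "cvec.subspace X \<Longrightarrow> linear_on X f \<Longrightarrow> x \<in> X \<Longrightarrow> y \<in> X \<Longrightarrow> f (x - y) = f x - f y"
  using linear_on_add[of X f "x - y" y] cvec.subspace_diff[of X x y] by simp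

lemma linear_on_sum:
  assumes X: "cvec.subspace X" and f: "linear_on X f" and "\<And>i. i \<in> I \<Longrightarrow> x i \<in> X"
  shows "f (\<Sum>i\<in>I. x i) = (\<Sum>i\<in>I. f (x i))"
  using assms(3)
proof (induction I rule: infinite_finite_induct)
  case (infinite I)
  then show ?case using linear_on_0[OF X f] by simp
next
  case empty
  show ?case using linear_on_0[OF X f] by simp
next
  case (insert i I)
  have "(\<Sum>i\<in>I. x i) \<in> X" using insert.prems by (intro cvec.subspace_sum[OF X]) simp
  with insert show ?case by (simp add: linear_on_add[OF f])
qed

lemma linear_on_subset: "linear_on X f \<Longrightarrow> Y \<subseteq> X \<Longrightarrow> linear_on Y f"
  unfolding linear_on_def by blast

lemma linear_imp_linear_on: "Vector_Spaces.linear (*\<^sub>C) (*\<^sub>C) f \<Longrightarrow> linear_on X f"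
  by (simp add: linear_on_def Vector_Spaces.linear_iff)

lemma linear_on_cong:
  assumes "cvec.subspace X" "\<And>x. x \<in> X \<Longrightarrow> f x = g x" "linear_on X g"
  shows "linear_on X f"
  using assms by (simp add: linear_on_def cvec.subspace_add cvec.subspace_scale)

lemma linear_on_compose:
  "linear_on X f \<Longrightarrow> f ` X \<subseteq> Y \<Longrightarrow> linear_on Y g \<Longrightarrow> linear_on X (\<lambda>x. g (f x))"
  by (simp add: linear_on_def image_subset_iff)

lemma linear_on_sum_fun:
  "(\<And>i. i \<in> I \<Longrightarrow> linear_on X (f i)) \<Longrightarrow> linear_on X (\<lambda>x. \<Sum>i\<in>I. f i x)"
  by (simp add: linear_on_def sum.distrib cvec.scale_sum_right)

lemma linear_on_scale_fun:
  "linear_on X f \<Longrightarrow> linear_on X (\<lambda>x. c *\<^sub>C f x)"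
  by (simp add: linear_on_def scaleC_add_right scaleC_scaleC mult.commute)

lemma linear_on_add_fun:
  "linear_on X f \<Longrightarrow> linear_on X g \<Longrightarrow> linear_on X (\<lambda>x. f x + g x)"
  by (simp add: linear_on_def scaleC_add_right)

lemma linear_on_zero_fun: "linear_on X (\<lambda>x. 0)"
  by (simp add: linear_on_def)

lemma linear_on_id: "linear_on X (\<lambda>x. x)"
  by (simp add: linear_on_def)

lemma linear_on_eval: "linear_on X f \<Longrightarrow> linear_on X (\<lambda>x. f x k)"
  by (simp add: linear_on_def scaleC_fun_def)

lemma subspace_kernel_on:
  assumes "cvec.subspace X" "linear_on X f"
  shows "cvec.subspace {x \<in> X. f x = 0}"
  using assms by (auto simp: cvec.subspace_def linear_on_def linear_on_zero)

lemma subspace_equalizer_on: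
  assumes X: "cvec.subspace X" and f: "linear_on X f" and g: "linear_on X g"
  shows "cvec.subspace {x \<in> X. f x = g x}"
  using X f g linear_on_0[OF X f] linear_on_0[OF X g]
  by (auto simp: cvec.subspace_def linear_on_def)

lemma linear_on_span_eq:
  assumes "linear_on (cvec.span B) f" "linear_on (cvec.span B) g"
    and "\<And>b. b \<in> B \<Longrightarrow> f b = g b" and "x \<in> cvec.span B"
  shows "f x = g x"
proof -
  have "cvec.span B \<subseteq> {x \<in> cvec.span B. f x = g x}"
    by (rule cvec.span_minimal)
      (use assms(1-3) in \<open>auto intro: subspace_equalizer_on cvec.span_base\<close>)
  with assms(4) show ?thesis by blast
qed

lemma subspace_image_on:
  assumes X: "cvec.subspace X" and f: "linear_on X f"
  shows "cvec.subspace (f ` X)"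
proof (rule cvec.subspaceI)
  show "0 \<in> f ` X" using linear_on_0[OF X f] cvec.subspace_0[OF X] by force
  show "a + b \<in> f ` X" if "a \<in> f ` X" "b \<in> f ` X" for a b
    using that cvec.subspace_add[OF X] by (auto simp: linear_on_add[OF f, symmetric])
  show "c *\<^sub>C a \<in> f ` X" if "a \<in> f ` X" for c a
    using that cvec.subspace_scale[OF X] by (auto simp: linear_on_scale[OF f, symmetric])
qed

lemma subspace_basis:
  assumes "cvec.subspace X"
  obtains B where "cvec.independent B" "cvec.span B = X" "B \<subseteq> X"
  using cvec.maximal_independent_subset[of X] cvec.span_minimal[OF _ assms] by (metis subset_antisym)

lemma linear_on_extend:
  fixes f :: "'a::complex_vector \<Rightarrow> 'b::complex_vector"
  assumes X: "cvec.subspace X" and Y: "cvec.subspace Y" and f: "linear_on X f" "f ` X \<subseteq> Y"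
  obtains g where "Vector_Spaces.linear (*\<^sub>C) (*\<^sub>C) g" "range g \<subseteq> Y" "\<And>x. x \<in> X \<Longrightarrow> g x = f x"
proof -
  obtain B where B: "cvec.independent B" "cvec.span B = X" "B \<subseteq> X" by (rule subspace_basis[OF X])
  obtain g where g: "Vector_Spaces.linear (*\<^sub>C) (*\<^sub>C) g" "\<forall>x\<in>B. g x = f x" "range g = cvec.span (f ` B)"
    using cvec_pair.linear_independent_extend_subspace[OF B(1), of f] by auto
  have "range g \<subseteq> Y"
    unfolding g(3) using B(3) f(2) by (intro cvec.span_minimal Y) auto
  moreover have "g x = f x" if "x \<in> X" for x
    using linear_on_span_eq[of B g f x] g f(1) B(2) that linear_imp_linear_on by blast
  ultimately show ?thesis using that g(1) by blast
qed

text \<open>Supplies coordinates on a whole module for a copy of U embedded in it; see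
  \<open>coord\<close>.\<close>

lemma linear_on_left_inverse:
  fixes f :: "'a::complex_vector \<Rightarrow> 'b::complex_vector"
  assumes X: "cvec.subspace X" and f: "linear_on X f" "inj_on f X"
  obtains g where "Vector_Spaces.linear (*\<^sub>C) (*\<^sub>C) g" "range g \<subseteq> X" "\<And>x. x \<in> X \<Longrightarrow> g (f x) = x"
proof -
  have sub: "cvec.subspace (f ` X)" by (rule subspace_image_on[OF X f(1)])
  have inv: "the_inv_into X f (f x) = x" if "x \<in> X" for x
    using that f(2) by (rule the_inv_into_f_f[rotated])
  have add: "x + y \<in> X" and scale: "c *\<^sub>C x \<in> X" if "x \<in> X" "y \<in> X" for x y c
    using that X by (simp_all add: cvec.subspace_add cvec.subspace_scale)
  have "linear_on (f ` X) (the_inv_into X f)"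
    unfolding linear_on_def
    using inv add scale by (simp add: linear_on_add[OF f(1), symmetric] linear_on_scale[OF f(1), symmetric])
  moreover have "the_inv_into X f ` f ` X \<subseteq> X" using inv by auto
  ultimately obtain g where "Vector_Spaces.linear (*\<^sub>C) (*\<^sub>C) g" "range g \<subseteq> X"
    "\<And>y. y \<in> f ` X \<Longrightarrow> g y = the_inv_into X f y"
    using linear_on_extend[OF sub X] by metis
  with inv show ?thesis by (intro that) auto
qed

lemma linear_on_inj_on:
  assumes X: "cvec.subspace X" and f: "linear_on X f" and "\<And>x. x \<in> X \<Longrightarrow> f x = 0 \<Longrightarrow> x = 0"
  shows "inj_on f X"
proof (rule inj_onI)
  fix x y assume xy: "x \<in> X" "y \<in> X" "f x = f y"
  then have "f (x - y) = 0" by (simp add: linear_on_diff[OF X f])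
  then show "x = y" using assms(3)[of "x - y"] xy X by (simp add: cvec.subspace_diff)
qed

lemma linear_on_inv_into:
  assumes X: "cvec.subspace X" and f: "linear_on X f" "bij_betw f X Y"
  shows "linear_on Y (inv_into X f)"
proof -
  have Y: "Y = f ` X" and inj: "inj_on f X" using f(2) by (auto simp: bij_betw_def)
  have add: "x + y \<in> X" and scale: "c *\<^sub>C x \<in> X" if "x \<in> X" "y \<in> X" for x y c
    using that X by (simp_all add: cvec.subspace_add cvec.subspace_scale)
  show ?thesis
    unfolding linear_on_def Y
    using inj add scale by (simp add: linear_on_add[OF f(1), symmetric] linear_on_scale[OF f(1), symmetric])
qed

text \<open>A basis of \<open>X\<close> is carried to an independent subset of \<open>Y\<close>,
  which extends to a basis \<open>D\<close> of \<open>Y\<close>; \<open>D\<close> is equipotent with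
  whichever basis \<open>cdim\<close> selects for \<open>Y\<close>.\<close>

lemma cdim_mono:
  fixes \<Phi> :: "'a::complex_vector \<Rightarrow> 'b::complex_vector"
  assumes X: "cvec.subspace X" and Y: "cvec.subspace Y"
    and \<Phi>: "linear_on X \<Phi>" "\<Phi> ` X \<subseteq> Y" "inj_on \<Phi> X"
  shows "(cdim X, cdim Y) \<in> ordLeq"
proof -
  define A where "A = (SOME B. cvec.independent B \<and> cvec.span B = X)"
  define C where "C = (SOME B. cvec.independent B \<and> cvec.span B = Y)"
  have A: "cvec.independent A" "cvec.span A = X"
    using someI_ex[of "\<lambda>B. cvec.independent B \<and> cvec.span B = X"] subspace_basis[OF X]
    unfolding A_def by metis+
  have C: "cvec.independent C" "cvec.span C = Y"
    using someI_ex[of "\<lambda>B. cvec.independent B \<and> cvec.span B = Y"] subspace_basis[OF Y]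
    unfolding C_def by metis+
  obtain g where g: "Vector_Spaces.linear (*\<^sub>C) (*\<^sub>C) g" "\<And>x. x \<in> X \<Longrightarrow> g x = \<Phi> x"
    using linear_on_extend[OF X Y \<Phi>(1,2)] by metis
  interpret g: Vector_Spaces.linear "(*\<^sub>C)" "(*\<^sub>C)" g by (rule g(1))
  have AX: "A \<subseteq> X" using A(2) cvec.span_superset by blast
  have inj: "inj_on g (cvec.span A)" unfolding A(2) using \<Phi>(3) g(2) by (metis inj_on_cong)
  have ind: "cvec.independent (g ` A)" by (rule g.independent_inj_on_image[OF A(1) inj])
  have sub: "g ` A \<subseteq> Y" using AX g(2) \<Phi>(2) by auto
  obtain D where D: "g ` A \<subseteq> D" "D \<subseteq> Y" "cvec.independent D" "Y \<subseteq> cvec.span D"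
    using cvec.maximal_independent_subset_extend[OF sub ind] by blast
  have "cvec.span D = cvec.span C"
    using D C(2) cvec.span_minimal[OF D(2) Y] by auto
  then obtain h where h: "bij_betw h D C"
    using cvec.bij_if_span_eq_span_bases[OF D(3) C(1)] by blast
  have "inj_on (h \<circ> g) A"
    using inj h D(1) cvec.span_superset[of A]
    by (intro comp_inj_on) (auto simp: bij_betw_def intro: inj_on_subset)
  moreover have "(h \<circ> g) ` A \<subseteq> C" using h D(1) by (auto simp: bij_betw_def)
  ultimately have "(card_of A, card_of C) \<in> ordLeq" using card_of_ordLeq by blast
  then show ?thesis by (simp add: cdim_def A_def C_def)
qed

section \<open>Polynomials in an operator and existence of eigenvectors\<close>

definition poly_op :: "('a::complex_vector \<Rightarrow> 'a) \<Rightarrow> complex poly \<Rightarrow> 'a \<Rightarrow> 'a" where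
  "poly_op T p = fold_coeffs (\<lambda>a f w. a *\<^sub>C w + f (T w)) p (\<lambda>_. 0)"

lemma poly_op_0 [simp]: "poly_op T 0 w = 0"
  by (simp add: poly_op_def)

text \<open>Since \<open>T\<close> is applied to the vector before the remaining polynomial, this
  recursion holds for every function \<open>T\<close>; linearity on a subspace enters only in
  \<open>poly_op_linear\<close>.\<close>

lemma poly_op_pCons [simp]: "poly_op T (pCons a p) w = a *\<^sub>C w + poly_op T p (T w)"
  by (cases "a = 0 \<and> p = 0") (auto simp: poly_op_def)

lemma poly_op_add: "poly_op T (p + q) w = poly_op T p w + poly_op T q w"
  by (induction p q arbitrary: w rule: poly_induct2) (simp_all add: scaleC_add_left algebra_simps)

lemma poly_op_smult: "poly_op T (smult c p) w = c *\<^sub>C poly_op T p w"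
  by (induction p arbitrary: w rule: pCons_induct) (simp_all add: scaleC_add_right scaleC_scaleC)

lemma poly_op_sum: "poly_op T (\<Sum>i\<in>I. p i) w = (\<Sum>i\<in>I. poly_op T (p i) w)"
  by (induction I rule: infinite_finite_induct) (simp_all add: poly_op_add)

lemma poly_op_monom: "poly_op T (monom c n) w = c *\<^sub>C (T ^^ n) w"
  by (induction n arbitrary: w) (simp_all add: monom_0 monom_Suc funpow_swap1)

lemma poly_op_linear:
  assumes X: "cvec.subspace X" and T: "linear_on X T" "T ` X \<subseteq> X"
  shows "linear_on X (poly_op T p)"
proof (induction p rule: pCons_induct)
  case 0
  then show ?case by (simp add: linear_on_def)
next
  case (pCons a p)
  have "linear_on X (\<lambda>w. a *\<^sub>C w + poly_op T p (T w))"
    by (intro linear_on_add_fun linear_on_scale_fun linear_on_id linear_on_compose[OF T] pCons.IH)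
  then show ?case by (simp add: linear_on_def)
qed

text \<open>Over the complex numbers a nonconstant \<open>p\<close> has a factor X - c. Either T w =
  c w, or T w - c w is a nonzero vector annihilated by the quotient, whose degree is
  smaller.\<close>

lemma poly_op_annihilator_eigenvector:
  assumes X: "cvec.subspace X" and T: "linear_on X T" "T ` X \<subseteq> X"
    and "p \<noteq> 0" "w \<in> X" "w \<noteq> 0" "poly_op T p w = 0"
  shows "\<exists>c. \<exists>x\<in>X. x \<noteq> 0 \<and> T x = c *\<^sub>C x"
  using assms(4-)
proof (induction "degree p" arbitrary: p w rule: less_induct)
  case less
  show ?case
  proof (cases "degree p = 0")
    case True
    then obtain a where "p = [:a:]" by (rule degree_eq_zeroE)
    with less.prems show ?thesis by simp
  next
    case False
    then have "\<not> constant (poly p)" by (simp add: constant_degree)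
    then obtain c where "poly p c = 0" using fundamental_theorem_of_algebra by blast
    then obtain q where pq: "p = [:- c, 1:] * q" by (auto simp: poly_eq_0_iff_dvd elim: dvdE)
    have q: "q \<noteq> 0" using pq less.prems(1) by auto
    let ?y = "T w - c *\<^sub>C w"
    have TwX: "T w \<in> X" "c *\<^sub>C w \<in> X" using less.prems(2) T(2) X by (auto simp: cvec.subspace_scale)
    have "p = smult (- c) q + pCons 0 q" using pq by simp
    then have "poly_op T p w = - c *\<^sub>C poly_op T q w + poly_op T q (T w)"
      by (simp only: poly_op_add poly_op_smult poly_op_pCons) simp
    also have "\<dots> = poly_op T q ?y"
      using poly_op_linear[OF X T, of q] TwX less.prems(2)
      by (simp add: linear_on_diff[OF X] linear_on_scale)
    finally have y: "poly_op T q ?y = 0" using less.prems(4) by simp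
    show ?thesis
    proof (cases "?y = 0")
      case True
      then show ?thesis using less.prems by (intro exI[of _ c] bexI[of _ w]) auto
    next
      case False
      have "degree q < degree p" unfolding pq using q by (simp add: degree_mult_eq del: mult_pCons_left)
      then show ?thesis
        using less.hyps[OF _ q _ False y] cvec.subspace_diff[OF X TwX] by blast
    qed
  qed
qed

lemma ex_eigenvector:
  assumes X: "cvec.subspace X" and fin: "finite_dim X" and T: "linear_on X T" "T ` X \<subseteq> X"
    and w: "w \<in> X" "w \<noteq> 0"
  shows "\<exists>c. \<exists>x\<in>X. x \<noteq> 0 \<and> T x = c *\<^sub>C x"
proof -
  obtain B where B: "finite B" "X \<subseteq> cvec.span B" using fin by (auto simp: finite_dim_def)
  let ?v = "\<lambda>i. (T ^^ i) w" and ?n = "card B"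
  have vX: "?v i \<in> X" for i using w(1) T(2) by (induction i) auto
  have "\<exists>p. p \<noteq> 0 \<and> poly_op T p w = 0"
  \<comment> \<open>Dependence is a property of the set of iterates, so coinciding iterates are
    handled apart, by the polynomial x^i - x^j; otherwise \<open>card B + 1\<close> distinct vectors
    in a span of \<open>card B\<close> vectors satisfy a relation.\<close>
  proof (cases "inj_on ?v {..?n}")
    case False
    then obtain i j where ij: "i \<noteq> j" "?v i = ?v j" by (auto simp: inj_on_def)
    then have "coeff (monom 1 i + monom (-1) j :: complex poly) i \<noteq> coeff 0 i" by simp
    moreover have "poly_op T (monom 1 i + monom (-1) j) w = 0"
      using ij(2) by (simp add: poly_op_add poly_op_monom)
    ultimately show ?thesis by metis
  next
    case True
    have dep: "cvec.dependent (?v ` {..?n})"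
    proof (rule ccontr)
      assume "cvec.independent (?v ` {..?n})"
      moreover have "?v ` {..?n} \<subseteq> cvec.span B" using vX B(2) by blast
      ultimately have "card (?v ` {..?n}) \<le> card B" using cvec.independent_span_bound[OF B(1)] by blast
      then show False using True by (simp add: card_image)
    qed
    have "finite (?v ` {..?n})" by simp
    from dep[unfolded cvec.dependent_finite[OF this]] obtain u i where u: "i \<le> ?n" "u (?v i) \<noteq> 0" "(\<Sum>x\<in>?v ` {..?n}. u x *\<^sub>C x) = 0"
      by blast
    let ?p = "\<Sum>i\<le>?n. monom (u (?v i)) i"
    have "coeff ?p i = (\<Sum>j\<le>?n. if j = i then u (?v i) else 0)"
      by (simp add: coeff_sum)
    also have "\<dots> = u (?v i)" using u(1) by simp
    finally have "?p \<noteq> 0" using u(2) by (metis coeff_0)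
    moreover have "poly_op T ?p w = 0"
      using u(3) True by (simp add: poly_op_sum poly_op_monom sum.reindex)
    ultimately show ?thesis by blast
  qed
  then show ?thesis using poly_op_annihilator_eigenvector[OF X T _ w] by blast
qed

subsection \<open>The Jacobi identity with finite supports\<close>

text \<open>Finiteness of the supports is recorded since \<^const>\<open>Sum_any\<close> is 0 on families of
  infinite support.\<close>

definition jac3 :: "(nat \<Rightarrow> 'c::complex_vector) \<Rightarrow> (nat \<Rightarrow> 'c) \<Rightarrow> (nat \<Rightarrow> 'c) \<Rightarrow> bool" where
  "jac3 A B C \<longleftrightarrow> finite {i. A i \<noteq> 0} \<and> finite {i. B i \<noteq> 0} \<and> finite {i. C i \<noteq> 0} \<and>
     Sum_any A - Sum_any B = Sum_any C"

definition jacA ::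
  "('v \<Rightarrow> int \<Rightarrow> 'c \<Rightarrow> 'c) \<Rightarrow> ('a \<Rightarrow> complex \<Rightarrow> 'b \<Rightarrow> 'c::complex_vector) \<Rightarrow>
   'v \<Rightarrow> 'a \<Rightarrow> 'b \<Rightarrow> int \<Rightarrow> int \<Rightarrow> complex \<Rightarrow> nat \<Rightarrow> 'c" where
  "jacA Y3 I u v w l m k i = ((-1) ^ i * (of_int l gchoose i)) *\<^sub>C
     Y3 u (m + l - int i) (I v (k + of_nat i) w)"

definition jacB ::
  "('a \<Rightarrow> complex \<Rightarrow> 'b \<Rightarrow> 'c::complex_vector) \<Rightarrow> ('v \<Rightarrow> int \<Rightarrow> 'b \<Rightarrow> 'b) \<Rightarrow>
   'v \<Rightarrow> 'a \<Rightarrow> 'b \<Rightarrow> int \<Rightarrow> int \<Rightarrow> complex \<Rightarrow> nat \<Rightarrow> 'c" where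
  "jacB I Y2 u v w l m k i = ((-1) powi (l - int i) * (of_int l gchoose i)) *\<^sub>C
     I v (k + of_int l - of_nat i) (Y2 u (m + int i) w)"

definition jacC ::
  "('a \<Rightarrow> complex \<Rightarrow> 'b \<Rightarrow> 'c::complex_vector) \<Rightarrow> ('v \<Rightarrow> int \<Rightarrow> 'a \<Rightarrow> 'a) \<Rightarrow>
   'v \<Rightarrow> 'a \<Rightarrow> 'b \<Rightarrow> int \<Rightarrow> int \<Rightarrow> complex \<Rightarrow> nat \<Rightarrow> 'c" where
  "jacC I Y1 u v w l m k i = (of_int m gchoose i) *\<^sub>C
     I (Y1 u (l + int i) v) (k + of_int m - of_nat i) w"

lemma jacobi_iff:
  fixes I :: "'a \<Rightarrow> complex \<Rightarrow> 'b \<Rightarrow> 'c::complex_vector"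
  shows "jacobi Y3 I Y2 Y1 u v w \<longleftrightarrow> (\<forall>l m k.
     Sum_any (jacA Y3 I u v w l m k) - Sum_any (jacB I Y2 u v w l m k) = Sum_any (jacC I Y1 u v w l m k))"
  by (simp add: jacobi_def jacA_def[abs_def] jacB_def[abs_def] jacC_def[abs_def])

lemma jac3_imp_jacobi:
  fixes I :: "'a \<Rightarrow> complex \<Rightarrow> 'b \<Rightarrow> 'c::complex_vector"
  assumes "\<And>l m k. jac3 (jacA Y3 I u v w l m k) (jacB I Y2 u v w l m k) (jacC I Y1 u v w l m k)"
  shows "jacobi Y3 I Y2 Y1 u v w"
  using assms by (simp add: jacobi_iff jac3_def)

lemma linear_on_coordinate: "linear_on X (\<lambda>y. y i)"
  by (simp add: linear_on_def scaleC_fun_def)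

lemma Sum_any_linear:
  fixes A :: "'i \<Rightarrow> 'a::complex_vector"
  assumes X: "cvec.subspace X" and g: "linear_on X g" and A: "\<And>i. A i \<in> X" "finite {i. A i \<noteq> 0}"
  shows "Sum_any (\<lambda>i. g (A i)) = g (Sum_any A)" "finite {i. g (A i) \<noteq> 0}"
proof -
  have g0: "g 0 = 0" by (rule linear_on_0[OF X g])
  have sub: "{i. g (A i) \<noteq> 0} \<subseteq> {i. A i \<noteq> 0}" using g0 by auto
  show "finite {i. g (A i) \<noteq> 0}" using sub A(2) by (rule finite_subset)
  show "Sum_any (\<lambda>i. g (A i)) = g (Sum_any A)"
    using Sum_any.expand_superset[OF A(2) sub] linear_on_sum[OF X g, of "{i. A i \<noteq> 0}" A] A(1)
    by (simp add: Sum_any.expand_set)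
qed

lemma jac3_linear:
  assumes X: "cvec.subspace X" and g: "linear_on X g"
    and "\<And>i. A i \<in> X" "\<And>i. B i \<in> X" "\<And>i. C i \<in> X" and "jac3 A B C"
  shows "jac3 (\<lambda>i. g (A i)) (\<lambda>i. g (B i)) (\<lambda>i. g (C i))"
proof -
  have *: "Sum_any A \<in> X" "Sum_any B \<in> X"
    using assms(3,4) by (auto simp: Sum_any.expand_set intro: cvec.subspace_sum[OF X])
  show ?thesis
    using assms(3-6) Sum_any_linear[OF X g, of A] Sum_any_linear[OF X g, of B]
      Sum_any_linear[OF X g, of C] linear_on_diff[OF X g *]
    by (simp add: jac3_def)
qed

lemma jac3_zero: "jac3 (\<lambda>i. 0) (\<lambda>i. 0) (\<lambda>i. 0)"
  by (simp add: jac3_def)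

lemma jac3_add:
  assumes "jac3 A B C" "jac3 A' B' C'"
  shows "jac3 (\<lambda>i. A i + A' i) (\<lambda>i. B i + B' i) (\<lambda>i. C i + C' i)"
proof -
  have fin: "finite {i. D i + D' i \<noteq> 0}" if "finite {i. D i \<noteq> 0}" "finite {i. D' i \<noteq> 0}"
    for D D' :: "nat \<Rightarrow> 'a"
    by (rule finite_subset[OF _ finite_UnI[OF that]]) auto
  show ?thesis
    using assms by (auto simp: jac3_def fin Sum_any.distrib algebra_simps)
qed

lemma jac3_scale: "jac3 A B C \<Longrightarrow> jac3 (\<lambda>i. c *\<^sub>C A i) (\<lambda>i. c *\<^sub>C B i) (\<lambda>i. c *\<^sub>C C i)"
  by (rule jac3_linear[OF cvec.subspace_UNIV]) (simp_all add: linear_on_scale_fun linear_on_id)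

lemma jac3_sum:
  "(\<And>j. j \<in> J \<Longrightarrow> jac3 (A j) (B j) (C j)) \<Longrightarrow>
   jac3 (\<lambda>i. \<Sum>j\<in>J. A j i) (\<lambda>i. \<Sum>j\<in>J. B j i) (\<lambda>i. \<Sum>j\<in>J. C j i)"
  by (induction J rule: infinite_finite_induct) (simp_all add: jac3_zero jac3_add)

text \<open>Sums of functions are evaluated pointwise only when the supports are uniformly finite.\<close>

lemma jac3_pointwise:
  fixes A B C :: "nat \<Rightarrow> 'u \<Rightarrow> 'c::complex_vector"
  assumes "finite {i. A i \<noteq> 0}" "finite {i. B i \<noteq> 0}" "finite {i. C i \<noteq> 0}"
    and "\<And>u. jac3 (\<lambda>i. A i u) (\<lambda>i. B i u) (\<lambda>i. C i u)"
  shows "jac3 A B C"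
proof -
  have "Sum_any (\<lambda>i. D i u) = Sum_any D u" if "finite {i. D i \<noteq> 0}" for D :: "nat \<Rightarrow> 'u \<Rightarrow> 'c" and u
    using that Sum_any_linear(1)[OF cvec.subspace_UNIV linear_on_coordinate[of UNIV u], of D] by simp
  then show ?thesis using assms by (simp add: jac3_def fun_eq_iff)
qed

subsection \<open>Modules\<close>

text \<open>The common ground of the irreducible modules over \<open>V\<close> and of M over the
  fixed point subalgebra: linearity, closure and truncation, so that the linear algebra of
  intertwining operators serves both.\<close>

definition lmod :: "'v::complex_vector voa \<Rightarrow> ('v, 'm::complex_vector) vmod \<Rightarrow> bool" where
  "lmod V M \<longleftrightarrow> cvec.subspace (mspace M) \<and>
     (\<forall>u\<in>vspace V. \<forall>n. linear_on (mspace M) (mop M u n)) \<and>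
     (\<forall>u\<in>vspace V. \<forall>n. \<forall>w\<in>mspace M. mop M u n w \<in> mspace M) \<and>
     (\<forall>u\<in>vspace V. \<forall>w\<in>mspace M. \<exists>N. \<forall>n\<ge>N. mop M u n w = 0)"

lemma lmodD:
  assumes "lmod V M"
  shows "cvec.subspace (mspace M)"
    and "u \<in> vspace V \<Longrightarrow> linear_on (mspace M) (mop M u n)"
    and "u \<in> vspace V \<Longrightarrow> w \<in> mspace M \<Longrightarrow> mop M u n w \<in> mspace M"
    and "u \<in> vspace V \<Longrightarrow> w \<in> mspace M \<Longrightarrow> \<exists>N. \<forall>n\<ge>N. mop M u n w = 0"
    and "u \<in> vspace V \<Longrightarrow> mop M u n 0 = 0"
  using assms by (auto simp: lmod_def intro: linear_on_0)

lemma irreducible_lmod: "irreducible_module V L \<Longrightarrow> lmod V L"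
  by (auto simp: irreducible_module_def voa_module_def ungraded_module_def lmod_def bilinear_on_def)

lemma irreducibleD:
  assumes "irreducible_module V L" "cvec.subspace X" "X \<subseteq> mspace L" "w \<in> X" "w \<noteq> 0"
    and "\<And>u n w. u \<in> vspace V \<Longrightarrow> w \<in> X \<Longrightarrow> mop L u n w \<in> X"
  shows "X = mspace L"
  using assms unfolding irreducible_module_def by blast

lemma irreducible_nonzero:
  assumes "irreducible_module V L"
  obtains w where "w \<in> mspace L" "w \<noteq> 0"
proof -
  have "0 \<in> mspace L" "mspace L \<noteq> {0}"
    using assms cvec.subspace_0[OF lmodD(1)[OF irreducible_lmod[OF assms]]]
    by (simp_all add: irreducible_module_def)
  then show ?thesis using that by blast
qed

lemma cnf_in_vspace: "voa V \<Longrightarrow> cnf V \<in> vspace V"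
  by (simp add: voa_def weight_space_def adjoint_def)

text \<open>The map commutes with L(0), hence preserves its eigenspaces. One of these is nonzero
  because they span \<open>L\<close>, and it is finite-dimensional, so it contains an eigenvector of
  \<psi>; the eigenspace of \<psi> in \<open>L\<close> is a nonzero submodule.\<close>

lemma Schur_scalar:
  assumes V: "voa V" and L: "irreducible_module V L"
    and \<psi>: "linear_on (mspace L) \<psi>" "\<psi> ` mspace L \<subseteq> mspace L"
      "\<And>u n w. u \<in> vspace V \<Longrightarrow> w \<in> mspace L \<Longrightarrow> \<psi> (mop L u n w) = mop L u n (\<psi> w)"
  obtains c where "\<And>w. w \<in> mspace L \<Longrightarrow> \<psi> w = c *\<^sub>C w"
proof -
  note lm = irreducible_lmod[OF L]
  have lin0: "linear_on (mspace L) (Lop V L 0)"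
    using lmodD(2)[OF lm cnf_in_vspace[OF V], of 1] by (simp add: linear_on_def Lop_def)
  have span: "mspace L = cvec.span (\<Union>h. weight_space V L h)" "\<And>h. finite_dim (weight_space V L h)"
    using L by (auto simp: irreducible_module_def voa_module_def)
  have "\<exists>h x. x \<in> weight_space V L h \<and> x \<noteq> 0"
  proof (rule ccontr)
    assume "\<nexists>h x. x \<in> weight_space V L h \<and> x \<noteq> 0"
    then have "(\<Union>h. weight_space V L h) \<subseteq> {0}" by auto
    then have "mspace L \<subseteq> {0}" unfolding span(1) by (intro cvec.span_minimal) simp_all
    then show False using irreducible_nonzero[OF L] by blast
  qed
  then obtain h x where x: "x \<in> weight_space V L h" "x \<noteq> 0" by blast
  have sub: "cvec.subspace (weight_space V L h)"
    unfolding weight_space_def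
    by (intro subspace_equalizer_on lmodD(1)[OF lm] lin0 linear_on_scale_fun linear_on_id)
  have pres: "\<psi> ` weight_space V L h \<subseteq> weight_space V L h"
    using \<psi>(2,3) cnf_in_vspace[OF V] linear_on_scale[OF \<psi>(1)]
    by (auto simp: weight_space_def Lop_def) metis
  have lin: "linear_on (weight_space V L h) \<psi>"
    by (rule linear_on_subset[OF \<psi>(1)]) (auto simp: weight_space_def)
  obtain c y where y: "y \<in> weight_space V L h" "y \<noteq> 0" "\<psi> y = c *\<^sub>C y"
    using ex_eigenvector[OF sub span(2) lin pres x] by blast
  let ?E = "{w \<in> mspace L. \<psi> w = c *\<^sub>C w}"
  have "?E = mspace L"
  proof (rule irreducibleD[OF L])
    show "cvec.subspace ?E"
      by (intro subspace_equalizer_on lmodD(1)[OF lm] \<psi>(1) linear_on_scale_fun linear_on_id)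
    show "y \<in> ?E" using y by (simp add: weight_space_def)
    show "mop L u n w \<in> ?E" if "u \<in> vspace V" "w \<in> ?E" for u n w
      using that \<psi>(3) by (simp add: lmodD(3)[OF lm] linear_on_scale[OF lmodD(2)[OF lm]])
  qed (use y in auto)
  then show ?thesis using that by blast
qed

lemma subspace_coordinate:
  assumes "cvec.subspace N"
  shows "cvec.subspace ((\<lambda>y. y i) ` N)"
  by (rule subspace_image_on[OF assms linear_on_coordinate])

text \<open>By minimality, the coordinate projections of the submodule generated by an element of
  minimal support are isomorphisms onto the summands involved, and Schur's lemma makes them
  proportional.\<close>

lemma diagonal_submodule:
  fixes Ls :: "'i \<Rightarrow> ('v::complex_vector, 'm::complex_vector) vmod"
  assumes V: "voa V" and fin: "finite I" and irr: "\<And>i. i \<in> I \<Longrightarrow> irreducible_module V (Ls i)"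
    and ineq: "\<And>i j. i \<in> I \<Longrightarrow> j \<in> I \<Longrightarrow> module_iso V (Ls i) (Ls j) \<Longrightarrow> Ls i = Ls j"
    and N: "cvec.subspace N"
    and sub: "N \<subseteq> {x. (\<forall>i\<in>I. x i \<in> mspace (Ls i)) \<and> (\<forall>i. i \<notin> I \<longrightarrow> x i = 0)}"
    and stab: "\<forall>u\<in>vspace V. \<forall>n. \<forall>x\<in>N. (\<lambda>i. if i \<in> I then mop (Ls i) u n (x i) else 0) \<in> N"
    and nonzero: "x0 \<in> N" "x0 \<noteq> 0"
  obtains j c where "j \<in> I" "c j = 1" "\<And>i. c i \<noteq> 0 \<Longrightarrow> i \<in> I \<and> Ls i = Ls j"
    "\<And>w. w \<in> mspace (Ls j) \<Longrightarrow> (\<lambda>i. c i *\<^sub>C w) \<in> N"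
proof -
  let ?s = "\<lambda>x :: 'i \<Rightarrow> 'm. {i. x i \<noteq> 0}"
  let ?D = "\<lambda>u n x i. if i \<in> I then mop (Ls i) u n (x i) else 0"
  have Nin: "x i \<in> mspace (Ls i)" if "x \<in> N" "i \<in> I" for x i using that sub by blast
  have Nout: "x i = 0" if "x \<in> N" "i \<notin> I" for x i using that sub by blast
  have stable: "?D u n x \<in> N" if "u \<in> vspace V" "x \<in> N" for u n x using that stab by blast
  have sI: "?s x \<subseteq> I" if "x \<in> N" for x using Nout[OF that] by blast
  have "\<exists>x. x \<in> N \<and> x \<noteq> 0" using nonzero by blast
  then obtain x where x: "x \<in> N" "x \<noteq> 0"
    and min: "\<And>y. y \<in> N \<Longrightarrow> y \<noteq> 0 \<Longrightarrow> card (?s x) \<le> card (?s y)"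
    using ex_has_least_nat[of "\<lambda>x. x \<in> N \<and> x \<noteq> 0" _ "\<lambda>x. card (?s x)"] by blast
  define T where "T = ?s x"
  have TI: "T \<subseteq> I" unfolding T_def by (rule sI[OF x(1)])
  have finT: "finite T" using TI fin by (rule finite_subset)
  obtain j where j: "j \<in> T" using x(2) by (auto simp: T_def fun_eq_iff)
  have jI: "j \<in> I" using j TI by blast
  \<comment> \<open>All elements of \<open>N\<close> supported in \<open>T\<close> are taken, which
    makes stability immediate. An element of \<open>N'\<close> that vanishes somewhere in
    \<open>T\<close> has support smaller than the minimal one and is therefore 0.\<close>
  define N' where "N' = {y \<in> N. \<forall>i. i \<notin> T \<longrightarrow> y i = 0}"
  have N'N: "N' \<subseteq> N" by (auto simp: N'_def)
  have xN': "x \<in> N'" using x(1) by (simp add: N'_def T_def)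
  have N': "cvec.subspace N'"
    using N by (auto simp: cvec.subspace_def N'_def scaleC_fun_def)
  have N'stable: "?D u n y \<in> N'" if "u \<in> vspace V" "y \<in> N'" for u n y
    using that stable[of u y n] lmodD(5)[OF irreducible_lmod[OF irr]] by (auto simp: N'_def)
  have N'0: "y = 0" if y: "y \<in> N'" and i: "i \<in> T" "y i = 0" for y i
  proof (rule ccontr)
    assume "y \<noteq> 0"
    then have "card T \<le> card (?s y)" using y min by (simp add: N'_def T_def)
    moreover have "?s y \<subset> T" using y i by (auto simp: N'_def)
    ultimately show False using psubset_card_mono[OF finT] by (meson leD)
  qed
  have lin: "linear_on N' (\<lambda>y. y i)" for i by (rule linear_on_coordinate)
  have bij: "bij_betw (\<lambda>y. y i) N' (mspace (Ls i))" if i: "i \<in> T" for i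
    unfolding bij_betw_def
  proof
    show "inj_on (\<lambda>y. y i) N'" using N'0[OF _ i] by (intro linear_on_inj_on N' lin)
    show "(\<lambda>y. y i) ` N' = mspace (Ls i)"
    proof (rule irreducibleD[OF irr])
      show "cvec.subspace ((\<lambda>y. y i) ` N')" by (rule subspace_coordinate[OF N'])
      show "x i \<in> (\<lambda>y. y i) ` N'" using xN' by blast
      show "x i \<noteq> 0" using i by (simp add: T_def)
      show "mop (Ls i) u n w \<in> (\<lambda>y. y i) ` N'" if u: "u \<in> vspace V" and w: "w \<in> (\<lambda>y. y i) ` N'" for u n w
      proof -
        obtain y where "y \<in> N'" "w = y i" using w by blast
        then show ?thesis using N'stable[OF u, of y n] i TI by (intro image_eqI[of _ _ "?D u n y"]) auto
      qed
    qed (use i TI Nin N'N in auto)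
  qed
  define \<rho> where "\<rho> = inv_into N' (\<lambda>y. y j)"
  have \<rho>N': "\<rho> w \<in> N'" and \<rho>j: "\<rho> w j = w" if "w \<in> mspace (Ls j)" for w
    using bij[OF j] that unfolding \<rho>_def bij_betw_def
    by (auto intro!: inv_into_into f_inv_into_f[of _ "\<lambda>y. y j"])
  have \<rho>I: "\<rho> (y j) = y" if "y \<in> N'" for y
    using bij[OF j] inv_into_f_f[of "\<lambda>y. y j" N' y] that by (simp add: \<rho>_def bij_betw_def)
  have \<rho>lin: "linear_on (mspace (Ls j)) \<rho>"
    unfolding \<rho>_def by (rule linear_on_inv_into[OF N' lin bij[OF j]])
  have \<rho>hom: "\<rho> (mop (Ls j) u n w) = ?D u n (\<rho> w)" if "u \<in> vspace V" "w \<in> mspace (Ls j)" for u n w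
    using \<rho>I[OF N'stable[OF that(1) \<rho>N'[OF that(2)]], of n] jI \<rho>j[OF that(2)] by simp
  have \<psi>lin: "linear_on (mspace (Ls j)) (\<lambda>w. \<rho> w i)" for i by (rule linear_on_eval[OF \<rho>lin])
  have iso: "module_iso V (Ls j) (Ls i)" if i: "i \<in> T" for i
    unfolding module_iso_def
  proof (intro exI conjI ballI allI)
    show "linear_on (mspace (Ls j)) (\<lambda>w. \<rho> w i)" by (rule \<psi>lin)
    have "bij_betw \<rho> (mspace (Ls j)) N'"
      unfolding \<rho>_def by (rule bij_betw_inv_into[OF bij[OF j]])
    from bij_betw_trans[OF this bij[OF i]]
    show "bij_betw (\<lambda>w. \<rho> w i) (mspace (Ls j)) (mspace (Ls i))" by (simp add: o_def)
    show "\<rho> (mop (Ls j) u n w) i = mop (Ls i) u n (\<rho> w i)"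
      if "u \<in> vspace V" "w \<in> mspace (Ls j)" for u n w
      using \<rho>hom[OF that] i TI by auto
  qed
  have eq: "Ls i = Ls j" if "i \<in> T" for i
    using ineq[OF jI _ iso[OF that]] that TI by auto
  have "\<exists>c. \<forall>w\<in>mspace (Ls j). \<rho> w i = c *\<^sub>C w" if i: "i \<in> T" for i
  proof (rule Schur_scalar[OF V irr[OF jI] \<psi>lin[of i]])
    show "(\<lambda>w. \<rho> w i) ` mspace (Ls j) \<subseteq> mspace (Ls j)"
      using Nin \<rho>N' N'N eq[OF i] i TI by fastforce
    show "\<rho> (mop (Ls j) u n w) i = mop (Ls j) u n (\<rho> w i)"
      if "u \<in> vspace V" "w \<in> mspace (Ls j)" for u n w
      using \<rho>hom[OF that] eq[OF i] i TI by auto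
  qed blast
  then obtain c where c: "\<And>i w. i \<in> T \<Longrightarrow> w \<in> mspace (Ls j) \<Longrightarrow> \<rho> w i = c i *\<^sub>C w" by metis
  define c' where "c' i = (if i = j then 1 else if i \<in> T then c i else 0)" for i
  have "\<rho> w = (\<lambda>i. c' i *\<^sub>C w)" if "w \<in> mspace (Ls j)" for w
    using c[OF _ that] \<rho>j[OF that] \<rho>N'[OF that] by (auto simp: c'_def fun_eq_iff N'_def)
  then have copy: "(\<lambda>i. c' i *\<^sub>C w) \<in> N" if "w \<in> mspace (Ls j)" for w
    using \<rho>N'[OF that] that N'N by auto
  have supp: "i \<in> I \<and> Ls i = Ls j" if "c' i \<noteq> 0" for i
    using that eq jI TI by (auto simp: c'_def split: if_splits)
  have "c' j = 1" by (simp add: c'_def)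
  from that[OF jI this supp copy] show ?thesis .
qed

subsection \<open>Intertwining operators\<close>

lemma intertwiningD:
  assumes "f \<in> intertwining_ops V L1 L2 L3"
  shows "w \<in> mspace L2 \<Longrightarrow> linear_on (mspace L1) (\<lambda>v. f v k w)"
    and "v \<in> mspace L1 \<Longrightarrow> linear_on (mspace L2) (f v k)"
    and "v \<in> mspace L1 \<Longrightarrow> w \<in> mspace L2 \<Longrightarrow> f v k w \<in> mspace L3"
    and "v \<notin> mspace L1 \<or> w \<notin> mspace L2 \<Longrightarrow> f v k w = 0"
    and "v \<in> mspace L1 \<Longrightarrow> w \<in> mspace L2 \<Longrightarrow> \<exists>N::int. \<forall>n\<ge>N. f v (k + of_int n) w = 0"
    and "v \<in> mspace L1 \<Longrightarrow> w \<in> mspace L2 \<Longrightarrow> f (Lop V L1 (-1) v) k w = - k *\<^sub>C f v (k - 1) w"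
    and "u \<in> vspace V \<Longrightarrow> v \<in> mspace L1 \<Longrightarrow> w \<in> mspace L2 \<Longrightarrow> jacobi (mop L3) f (mop L2) (mop L1) u v w"
  using assms by (auto simp: intertwining_ops_def bilinear_on_def)

lemma finite_eventually_zero:
  fixes A :: "nat \<Rightarrow> 'a::zero"
  assumes "\<And>i. int i \<ge> N \<Longrightarrow> A i = 0"
  shows "finite {i. A i \<noteq> 0}"
proof (rule finite_subset)
  show "{i. A i \<noteq> 0} \<subseteq> {..nat N}" using assms by (force simp: not_less)
qed simp

text \<open>The three sums stop for three different reasons: truncation of \<open>I\<close> on
  \<open>w\<close>, of \<open>Y2\<close> on \<open>w\<close>, and of \<open>Y1\<close> on
  \<open>v\<close>.\<close>

lemma jac_finite:
  assumes Y3: "\<And>n. Y3 u n 0 = 0" and I2: "\<And>k. I v k 0 = 0" and I1: "\<And>k. I 0 k w = 0"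
    and I: "\<And>k. \<exists>N::int. \<forall>n\<ge>N. I v (k + of_int n) w = 0"
    and Y2: "\<exists>N. \<forall>n\<ge>N. Y2 u n w = 0" and Y1: "\<exists>N. \<forall>n\<ge>N. Y1 u n v = 0"
  shows "finite {i. jacA Y3 I u v w l m k i \<noteq> 0}"
    and "finite {i. jacB I Y2 u v w l m k i \<noteq> 0}"
    and "finite {i. jacC I Y1 u v w l m k i \<noteq> 0}"
proof -
  obtain N where "\<forall>n\<ge>N. I v (k + of_int n) w = 0" using I by blast
  then have "I v (k + of_nat i) w = 0" if "int i \<ge> N" for i
    using that by (metis of_int_of_nat_eq)
  then show "finite {i. jacA Y3 I u v w l m k i \<noteq> 0}"
    using Y3 by (intro finite_eventually_zero[of N]) (simp add: jacA_def)
  obtain N where "\<forall>n\<ge>N. Y2 u n w = 0" using Y2 by blast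
  then show "finite {i. jacB I Y2 u v w l m k i \<noteq> 0}"
    using I2 by (intro finite_eventually_zero[of "N - m"]) (simp add: jacB_def)
  obtain N where "\<forall>n\<ge>N. Y1 u n v = 0" using Y1 by blast
  then show "finite {i. jacC I Y1 u v w l m k i \<noteq> 0}"
    using I1 by (intro finite_eventually_zero[of "N - l"]) (simp add: jacC_def)
qed

lemma intertwining_jac3:
  assumes L: "lmod V L1" "lmod V L2" "lmod V L3"
    and f: "f \<in> intertwining_ops V L1 L2 L3"
    and u: "u \<in> vspace V" and v: "v \<in> mspace L1" and w: "w \<in> mspace L2"
  shows "jac3 (jacA (mop L3) f u v w l m k) (jacB f (mop L2) u v w l m k) (jacC f (mop L1) u v w l m k)"
proof -
  note d = intertwiningD[OF f]
  have "jacobi (mop L3) f (mop L2) (mop L1) u v w" using d(7) u v w by blast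
  then show ?thesis
    unfolding jac3_def jacobi_iff
    using jac_finite[of "mop L3" u f v w "mop L2" "mop L1"] lmodD(5)[OF L(3) u]
      linear_on_0[OF lmodD(1)[OF L(2)] d(2)[OF v]] linear_on_0[OF lmodD(1)[OF L(1)] d(1)[OF w]]
      d(5)[OF v w] lmodD(4)[OF L(2) u w] lmodD(4)[OF L(1) u v]
    by blast
qed

lemma jac_mem:
  assumes L3: "lmod V L3" and u: "u \<in> vspace V" and I: "\<And>v k w. I v k w \<in> mspace L3"
  shows "jacA (mop L3) I u v w l m k i \<in> mspace L3" "jacB I Y2 u v w l m k i \<in> mspace L3"
    "jacC I Y1 u v w l m k i \<in> mspace L3"
  using I lmodD(3)[OF L3 u] lmodD(1)[OF L3]
  by (simp_all add: jacA_def jacB_def jacC_def cvec.subspace_scale)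

lemma intertwining_total_mem:
  assumes "lmod V L3" "f \<in> intertwining_ops V L1 L2 L3"
  shows "f v k w \<in> mspace L3"
  using intertwiningD(3,4)[OF assms(2)] cvec.subspace_0[OF lmodD(1)[OF assms(1)]] by metis

lemma linear_on_plus: "linear_on X (f + g)" if "linear_on X f" "linear_on X g"
  using linear_on_add_fun[OF that] by (simp add: linear_on_def)

text \<open>The Jacobi identity passes to sums because \<open>Sum_any\<close> is additive on
  families of finite support, and \<open>jac3\<close> carries this finiteness along.\<close>

lemma subspace_intertwining_ops:
  assumes L: "lmod V L1" "lmod V L2" "lmod V L3"
  shows "cvec.subspace (intertwining_ops V L1 L2 L3)"
proof (rule cvec.subspaceI)
  note L3 = lmodD(1)[OF L(3)]
  have "0 \<in> intertwining_ops V L1 L2 L3"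
    unfolding intertwining_ops_def
    using cvec.subspace_0[OF L3] lmodD(5)[OF L(3)]
    by (auto simp: bilinear_on_def linear_on_def jacobi_iff jacA_def[abs_def] jacB_def[abs_def] jacC_def[abs_def])
  then show "0 \<in> intertwining_ops V L1 L2 L3" .
  show "f + g \<in> intertwining_ops V L1 L2 L3"
    if f: "f \<in> intertwining_ops V L1 L2 L3" and g: "g \<in> intertwining_ops V L1 L2 L3" for f g
  proof -
    note df = intertwiningD[OF f] and dg = intertwiningD[OF g]
    have 1: "bilinear_on (mspace L1) (mspace L2) (\<lambda>v. (f + g) v k)" for k
      using df(1,2) dg(1,2) by (auto simp: bilinear_on_def intro!: linear_on_add_fun linear_on_plus)
    have 2: "(f + g) v k w \<in> mspace L3" if "v \<in> mspace L1" "w \<in> mspace L2" for v k w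
      using df(3) dg(3) that by (simp add: cvec.subspace_add[OF L3])
    have 3: "(f + g) v k w = 0" if "v \<notin> mspace L1 \<or> w \<notin> mspace L2" for v k w
      using df(4) dg(4) that by simp
    have 4: "\<exists>N::int. \<forall>n\<ge>N. (f + g) v (k + of_int n) w = 0"
      if vw: "v \<in> mspace L1" "w \<in> mspace L2" for v k w
    proof -
      obtain N N' :: int where "\<forall>n\<ge>N. f v (k + of_int n) w = 0" "\<forall>n\<ge>N'. g v (k + of_int n) w = 0"
        using df(5)[OF vw] dg(5)[OF vw] by meson
      then show ?thesis by (intro exI[of _ "max N N'"]) simp
    qed
    have 5: "(f + g) (Lop V L1 (-1) v) k w = - k *\<^sub>C (f + g) v (k - 1) w"
      if "v \<in> mspace L1" "w \<in> mspace L2" for v k w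
      using df(6)[OF that] dg(6)[OF that] by (simp add: scaleC_add_right)
    have 6: "jacobi (mop L3) (f + g) (mop L2) (mop L1) u v w"
      if "u \<in> vspace V" "v \<in> mspace L1" "w \<in> mspace L2" for u v w
    proof (rule jac3_imp_jacobi)
      fix l m k
      have "jacA (mop L3) (f + g) u v w l m k =
          (\<lambda>i. jacA (mop L3) f u v w l m k i + jacA (mop L3) g u v w l m k i)"
        using df(3) dg(3) that
        by (simp add: jacA_def fun_eq_iff linear_on_add[OF lmodD(2)[OF L(3)]] scaleC_add_right)
      moreover have "jacB (f + g) (mop L2) u v w l m k =
          (\<lambda>i. jacB f (mop L2) u v w l m k i + jacB g (mop L2) u v w l m k i)"
        "jacC (f + g) (mop L1) u v w l m k =
          (\<lambda>i. jacC f (mop L1) u v w l m k i + jacC g (mop L1) u v w l m k i)"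
        by (simp_all add: jacB_def jacC_def fun_eq_iff scaleC_add_right)
      ultimately show "jac3 (jacA (mop L3) (f + g) u v w l m k) (jacB (f + g) (mop L2) u v w l m k)
          (jacC (f + g) (mop L1) u v w l m k)"
        using jac3_add[OF intertwining_jac3[OF L f that] intertwining_jac3[OF L g that]] by simp
    qed
    show ?thesis unfolding intertwining_ops_def using 1 2 3 4 5 6 by blast
  qed
  show "c *\<^sub>C f \<in> intertwining_ops V L1 L2 L3" if f: "f \<in> intertwining_ops V L1 L2 L3" for c f
  proof -
    note df = intertwiningD[OF f]
    have eval: "(c *\<^sub>C f) v k w = c *\<^sub>C f v k w" for v k w by (simp add: scaleC_fun_def)
    have 1: "bilinear_on (mspace L1) (mspace L2) (\<lambda>v. (c *\<^sub>C f) v k)" for k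
    proof -
      have "(c *\<^sub>C f) v k = (\<lambda>w. c *\<^sub>C f v k w)" for v by (simp add: scaleC_fun_def)
      then show ?thesis using df(1,2) by (auto simp: bilinear_on_def intro!: linear_on_scale_fun)
    qed
    have 4: "\<exists>N::int. \<forall>n\<ge>N. (c *\<^sub>C f) v (k + of_int n) w = 0" if "v \<in> mspace L1" "w \<in> mspace L2" for v k w
      using df(5)[OF that] unfolding eval by (metis cvec.scale_zero_right)
    have 6: "jacobi (mop L3) (c *\<^sub>C f) (mop L2) (mop L1) u v w"
      if "u \<in> vspace V" "v \<in> mspace L1" "w \<in> mspace L2" for u v w
    proof (rule jac3_imp_jacobi)
      fix l m k
      have "jacA (mop L3) (c *\<^sub>C f) u v w l m k = (\<lambda>i. c *\<^sub>C jacA (mop L3) f u v w l m k i)"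
        using df(3) that
        by (simp add: jacA_def fun_eq_iff eval linear_on_scale[OF lmodD(2)[OF L(3)]] scaleC_scaleC mult.commute)
      moreover have "jacB (c *\<^sub>C f) (mop L2) u v w l m k = (\<lambda>i. c *\<^sub>C jacB f (mop L2) u v w l m k i)"
        "jacC (c *\<^sub>C f) (mop L1) u v w l m k = (\<lambda>i. c *\<^sub>C jacC f (mop L1) u v w l m k i)"
        by (simp_all add: jacB_def jacC_def fun_eq_iff eval scaleC_scaleC mult.commute)
      ultimately show "jac3 (jacA (mop L3) (c *\<^sub>C f) u v w l m k) (jacB (c *\<^sub>C f) (mop L2) u v w l m k)
          (jacC (c *\<^sub>C f) (mop L1) u v w l m k)"
        using jac3_scale[OF intertwining_jac3[OF L f that], of c] by simp
    qed
    have 2: "(c *\<^sub>C f) v k w \<in> mspace L3" if "v \<in> mspace L1" "w \<in> mspace L2" for v k w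
      using df(3)[OF that] cvec.subspace_scale[OF L3] by (simp add: eval)
    have 3: "(c *\<^sub>C f) v k w = 0" if "v \<notin> mspace L1 \<or> w \<notin> mspace L2" for v k w
      using df(4)[OF that] by (simp add: eval)
    have 5: "(c *\<^sub>C f) (Lop V L1 (-1) v) k w = - k *\<^sub>C (c *\<^sub>C f) v (k - 1) w"
      if "v \<in> mspace L1" "w \<in> mspace L2" for v k w
      using df(6)[OF that, of k] by (simp add: eval scaleC_scaleC mult.commute)
    show ?thesis unfolding intertwining_ops_def using 1 2 3 4 5 6 by blast
  qed
qed

text \<open>In the first term of the Jacobi identity \<open>u\<close> acts on the common target
  \<open>L3\<close>, hence on the sums over \<open>j\<close>, which vanish; after summation only the
  other two terms survive.\<close>

lemma intertwining_sum_jac3: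
  assumes L: "\<And>j. j \<in> J \<Longrightarrow> lmod V (L1 j)" "\<And>j. j \<in> J \<Longrightarrow> lmod V (L2 j)" "lmod V L3"
    and f: "\<And>j. j \<in> J \<Longrightarrow> f j \<in> intertwining_ops V (L1 j) (L2 j) L3"
    and v: "\<And>j. j \<in> J \<Longrightarrow> v j \<in> mspace (L1 j)" and w: "\<And>j. j \<in> J \<Longrightarrow> w j \<in> mspace (L2 j)"
    and u: "u \<in> vspace V"
    and zero: "\<And>k. (\<Sum>j\<in>J. f j (v j) k (w j)) = 0"
  shows "jac3 (\<lambda>i. 0)
    (\<lambda>i. \<Sum>j\<in>J. jacB (f j) (mop (L2 j)) u (v j) (w j) l m k i)
    (\<lambda>i. \<Sum>j\<in>J. jacC (f j) (mop (L1 j)) u (v j) (w j) l m k i)"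
proof -
  have "(\<Sum>j\<in>J. jacA (mop L3) (f j) u (v j) (w j) l m k i) = 0" for i
    using zero[of "k + of_nat i"]
      linear_on_sum[OF lmodD(1)[OF L(3)] lmodD(2)[OF L(3) u, of "m + l - int i"],
        of J "\<lambda>j. f j (v j) (k + of_nat i) (w j)"] intertwiningD(3)[OF f v w]
    by (simp add: jacA_def cvec.scale_sum_right[symmetric] lmodD(5)[OF L(3) u])
  moreover have "jac3 (\<lambda>i. \<Sum>j\<in>J. jacA (mop L3) (f j) u (v j) (w j) l m k i)
    (\<lambda>i. \<Sum>j\<in>J. jacB (f j) (mop (L2 j)) u (v j) (w j) l m k i)
    (\<lambda>i. \<Sum>j\<in>J. jacC (f j) (mop (L1 j)) u (v j) (w j) l m k i)"
    by (intro jac3_sum intertwining_jac3[OF L(1,2,3) f u v w])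
  ultimately show ?thesis by simp
qed

lemma uniform_truncation:
  fixes A :: "'j \<Rightarrow> int \<Rightarrow> 'a::zero"
  assumes "finite J" "\<And>j. j \<in> J \<Longrightarrow> \<exists>N. \<forall>n\<ge>N. A j n = 0"
  obtains N where "\<And>j n. j \<in> J \<Longrightarrow> n \<ge> N \<Longrightarrow> A j n = 0"
proof -
  obtain g where g: "\<And>j. j \<in> J \<Longrightarrow> \<forall>n\<ge>g j. A j n = 0" using assms(2) by metis
  have "A j n = 0" if "j \<in> J" "n \<ge> (\<Sum>j\<in>J. \<bar>g j\<bar>)" for j n
  proof -
    have "\<bar>g j\<bar> \<le> (\<Sum>j\<in>J. \<bar>g j\<bar>)" using that(1) assms(1) by (intro member_le_sum) auto
    then show ?thesis using that g by force
  qed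
  then show ?thesis by (rule that)
qed

text \<open>Commutativity: for large \<open>l\<close> the Jacobi identity becomes a recursion in \<open>n\<close>, which can be
  solved downwards from the truncation bound.\<close>

lemma intertwining_sum_stable2:
  assumes L: "\<And>j. j \<in> J \<Longrightarrow> lmod V (L1 j)" "\<And>j. j \<in> J \<Longrightarrow> lmod V (L2 j)" "lmod V L3"
    and fin: "finite J"
    and f: "\<And>j. j \<in> J \<Longrightarrow> f j \<in> intertwining_ops V (L1 j) (L2 j) L3"
    and v: "\<And>j. j \<in> J \<Longrightarrow> v j \<in> mspace (L1 j)" and w: "\<And>j. j \<in> J \<Longrightarrow> w j \<in> mspace (L2 j)"
    and u: "u \<in> vspace V"
    and zero: "\<And>k. (\<Sum>j\<in>J. f j (v j) k (w j)) = 0"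
  shows "(\<Sum>j\<in>J. f j (v j) k (mop (L2 j) u n (w j))) = 0"
proof -
  have f0: "f j 0 k (w j) = 0" "f j (v j) k 0 = 0" if "j \<in> J" for j k
    using linear_on_0[OF lmodD(1)[OF L(1)[OF that]] intertwiningD(1)[OF f[OF that] w[OF that]]]
      linear_on_0[OF lmodD(1)[OF L(2)[OF that]] intertwiningD(2)[OF f[OF that] v[OF that]]] by auto
  obtain N1 where N1: "\<And>j n. j \<in> J \<Longrightarrow> n \<ge> N1 \<Longrightarrow> mop (L1 j) u n (v j) = 0"
    using uniform_truncation[OF fin, of "\<lambda>j n. mop (L1 j) u n (v j)"] lmodD(4)[OF L(1) u v] by metis
  obtain N2 where N2: "\<And>j n. j \<in> J \<Longrightarrow> n \<ge> N2 \<Longrightarrow> mop (L2 j) u n (w j) = 0"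
    using uniform_truncation[OF fin, of "\<lambda>j n. mop (L2 j) u n (w j)"] lmodD(4)[OF L(2) u w] by metis
  \<comment> \<open>Large enough that every u_(l+i) v_j vanishes, which removes the right-hand side
    of the Jacobi identity; being a natural number, it also cuts the binomial sum off after i =
    l.\<close>
  define l where "l = nat N1"
  define g where "g k m = (\<Sum>j\<in>J. f j (v j) k (mop (L2 j) u m (w j)))" for k m
  let ?c = "\<lambda>i::nat. (-1) powi (int l - int i) * (of_int (int l) gchoose i) :: complex"
  let ?B = "\<lambda>m k i. ?c i *\<^sub>C g (k + of_nat l - of_nat i) (m + int i)"
  have c0: "?c i = 0" if "i > l" for i
    using that by (simp add: binomial_gbinomial[symmetric])
  have sum0: "(\<Sum>i\<le>l. ?B m k i) = 0" for m k
  proof -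
    have "(\<Sum>j\<in>J. jacB (f j) (mop (L2 j)) u (v j) (w j) (int l) m k i) = ?B m k i" for i
      by (simp add: jacB_def g_def cvec.scale_sum_right)
    moreover have "(\<Sum>j\<in>J. jacC (f j) (mop (L1 j)) u (v j) (w j) (int l) m k i) = 0" for i
      using N1 f0 by (intro sum.neutral) (simp add: jacC_def l_def)
    moreover have "jac3 (\<lambda>i. 0)
        (\<lambda>i. \<Sum>j\<in>J. jacB (f j) (mop (L2 j)) u (v j) (w j) (int l) m k i)
        (\<lambda>i. \<Sum>j\<in>J. jacC (f j) (mop (L1 j)) u (v j) (w j) (int l) m k i)"
      by (rule intertwining_sum_jac3[OF L f v w u zero])
    ultimately have "jac3 (\<lambda>i. 0) (?B m k) (\<lambda>i. 0)" by simp
    then have "Sum_any (?B m k) = 0" by (simp add: jac3_def)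
    moreover have "Sum_any (?B m k) = (\<Sum>i\<le>l. ?B m k i)"
      using c0 by (intro Sum_any.expand_superset) (auto simp: not_le[symmetric])
    ultimately show ?thesis by simp
  qed
  \<comment> \<open>With \<open>k - l\<close> in place of \<open>k\<close>, the term i = 0 of the
    recursion is \<open>g k m\<close> up to sign, and the terms i > 0 involve \<open>m + i\<close>,
    where the induction hypothesis applies.\<close>
  have "g k m = 0" if "m \<ge> N2 - int d" for d k m
    using that
  proof (induction d arbitrary: k m)
    case 0
    then show ?case using N2 f0 by (simp add: g_def)
  next
    case (Suc d)
    have "?B m (k - of_nat l) i = 0" if "i \<noteq> 0" for i
      using Suc.IH[of "m + int i"] Suc.prems that by simp
    then have "(\<Sum>i\<le>l. ?B m (k - of_nat l) i) = (\<Sum>i\<in>{0}. ?B m (k - of_nat l) i)"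
      by (intro sum.mono_neutral_right) auto
    then have "(\<Sum>i\<in>{0}. ?B m (k - of_nat l) i) = 0" using sum0[where m = m and k = "k - of_nat l"] by argo
    then have "?B m (k - of_nat l) 0 = 0" by simp
    then show ?case by (simp add: power_int_def)
  qed
  from this[of "nat (N2 - n)" n k] show ?thesis by (simp add: g_def)
qed

text \<open>The Jacobi identity with l = n and m = 0: the binomials of 0 reduce the right-hand side
  to its term i = 0, which is the sum in question, and the second term vanishes by
  \<open>zero2\<close>.\<close>

lemma intertwining_sum_stable1:
  assumes L: "\<And>j. j \<in> J \<Longrightarrow> lmod V (L1 j)" "\<And>j. j \<in> J \<Longrightarrow> lmod V (L2 j)" "lmod V L3"
    and f: "\<And>j. j \<in> J \<Longrightarrow> f j \<in> intertwining_ops V (L1 j) (L2 j) L3"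
    and v: "\<And>j. j \<in> J \<Longrightarrow> v j \<in> mspace (L1 j)" and w: "\<And>j. j \<in> J \<Longrightarrow> w j \<in> mspace (L2 j)"
    and u: "u \<in> vspace V"
    and zero: "\<And>k. (\<Sum>j\<in>J. f j (v j) k (w j)) = 0"
    and zero2: "\<And>k n. (\<Sum>j\<in>J. f j (v j) k (mop (L2 j) u n (w j))) = 0"
  shows "(\<Sum>j\<in>J. f j (mop (L1 j) u n (v j)) k (w j)) = 0"
proof -
  have "(\<Sum>j\<in>J. jacB (f j) (mop (L2 j)) u (v j) (w j) n 0 k i) = 0" for i
    using zero2 by (simp add: jacB_def cvec.scale_sum_right[symmetric])
  moreover have "jac3 (\<lambda>i. 0)
      (\<lambda>i. \<Sum>j\<in>J. jacB (f j) (mop (L2 j)) u (v j) (w j) n 0 k i)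
      (\<lambda>i. \<Sum>j\<in>J. jacC (f j) (mop (L1 j)) u (v j) (w j) n 0 k i)"
    by (rule intertwining_sum_jac3[OF L f v w u zero])
  moreover have "(\<Sum>j\<in>J. jacC (f j) (mop (L1 j)) u (v j) (w j) n 0 k i) =
      (if i = 0 then (\<Sum>j\<in>J. f j (mop (L1 j) u n (v j)) k (w j)) else 0)" for i
    by (cases i) (simp_all add: jacC_def)
  ultimately show ?thesis by (simp add: jac3_def)
qed

lemma sum_apply: "(\<Sum>i\<in>I. f i) x = (\<Sum>i\<in>I. f i x)"
  by (induction I rule: infinite_finite_induct) simp_all

lemma sum_apply3: "(\<Sum>i\<in>I. f i) x y z = (\<Sum>i\<in>I. f i x y z)"
  by (simp add: sum_apply)

lemma subspace_sum_kernel: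
  fixes X :: "'i \<Rightarrow> 'a::complex_vector set" and g :: "'t \<Rightarrow> 'i \<Rightarrow> 'a \<Rightarrow> 'b::complex_vector"
  assumes X: "\<And>i. i \<in> I \<Longrightarrow> cvec.subspace (X i)"
    and g: "\<And>t i. t \<in> T \<Longrightarrow> i \<in> I \<Longrightarrow> linear_on (X i) (g t i)"
  shows "cvec.subspace {x. (\<forall>i\<in>I. x i \<in> X i) \<and> (\<forall>i. i \<notin> I \<longrightarrow> x i = 0) \<and>
    (\<forall>t\<in>T. (\<Sum>i\<in>I. g t i (x i)) = 0)}" (is "cvec.subspace ?N")
proof (rule cvec.subspaceI)
  show "0 \<in> ?N"
    using cvec.subspace_0[OF X] linear_on_0[OF X g] by simp
  show "x + y \<in> ?N" if "x \<in> ?N" "y \<in> ?N" for x y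
  proof -
    have "(\<Sum>i\<in>I. g t i ((x + y) i)) = (\<Sum>i\<in>I. g t i (x i) + g t i (y i))" if t: "t \<in> T" for t
      using \<open>x \<in> ?N\<close> \<open>y \<in> ?N\<close> by (intro sum.cong) (auto intro: linear_on_add[OF g[OF t]])
    then show ?thesis using that by (auto simp: sum.distrib cvec.subspace_add[OF X])
  qed
  show "c *\<^sub>C x \<in> ?N" if "x \<in> ?N" for c x
  proof -
    have "(\<Sum>i\<in>I. g t i ((c *\<^sub>C x) i)) = (\<Sum>i\<in>I. c *\<^sub>C g t i (x i))" if t: "t \<in> T" for t
      using \<open>x \<in> ?N\<close> by (intro sum.cong) (auto simp: scaleC_fun_def intro: linear_on_scale[OF g[OF t]])
    then show ?thesis
      using that by (auto simp: cvec.scale_sum_right[symmetric] scaleC_fun_def cvec.subspace_scale[OF X])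
  qed
qed

text \<open>Injectivity of $f \otimes v \otimes w \mapsto f(v,z)w$, for tensors written in terms of
  independent \<open>ff i\<close> and \<open>vv i\<close>. The kernel is stable under the action on either module factor,
  so that \<open>diagonal_submodule\<close> first removes the \<open>w i\<close> and then the \<open>vv i\<close>.\<close>

theorem intertwining_sum_injective:
  fixes LA :: "'i \<Rightarrow> ('v::complex_vector, 'm1::complex_vector) vmod"
    and LB :: "'i \<Rightarrow> ('v, 'm2::complex_vector) vmod"
    and L3 :: "('v, 'm3::complex_vector) vmod"
  assumes V: "voa V" and fin: "finite I" and L3: "lmod V L3"
    and irrA: "\<And>i. i \<in> I \<Longrightarrow> irreducible_module V (LA i)"
    and irrB: "\<And>i. i \<in> I \<Longrightarrow> irreducible_module V (LB i)"
    and ineqA: "\<And>i j. i \<in> I \<Longrightarrow> j \<in> I \<Longrightarrow> module_iso V (LA i) (LA j) \<Longrightarrow> LA i = LA j"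
    and ineqB: "\<And>i j. i \<in> I \<Longrightarrow> j \<in> I \<Longrightarrow> module_iso V (LB i) (LB j) \<Longrightarrow> LB i = LB j"
    and ff: "\<And>i. i \<in> I \<Longrightarrow> ff i \<in> intertwining_ops V (LA i) (LB i) L3"
    and vv: "\<And>i. i \<in> I \<Longrightarrow> vv i \<in> mspace (LA i)"
    and indf: "\<And>A B. cvec.independent (ff ` {i \<in> I. LA i = A \<and> LB i = B})"
    and indv: "\<And>A. cvec.independent (vv ` {i \<in> I. LA i = A})"
    and inj: "inj_on (\<lambda>i. (LA i, LB i, ff i, vv i)) I"
    and w: "\<And>i. i \<in> I \<Longrightarrow> w i \<in> mspace (LB i)"
    and zero: "\<And>k. (\<Sum>i\<in>I. ff i (vv i) k (w i)) = 0"
    and i0: "i0 \<in> I"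
  shows "w i0 = 0"
proof (rule ccontr)
  assume w0: "w i0 \<noteq> 0"
  note lA = irreducible_lmod[OF irrA] and lB = irreducible_lmod[OF irrB]
  note dff = intertwiningD[OF ff]
  define N where "N = {x. (\<forall>i\<in>I. x i \<in> mspace (LB i)) \<and> (\<forall>i. i \<notin> I \<longrightarrow> x i = 0) \<and>
    (\<forall>k. (\<Sum>i\<in>I. ff i (vv i) k (x i)) = 0)}"
  have N: "cvec.subspace N"
    using subspace_sum_kernel[of I "\<lambda>i. mspace (LB i)" UNIV "\<lambda>k i. ff i (vv i) k",
        OF lmodD(1)[OF lB] dff(2)[OF _ vv]] by (simp add: N_def)
  have Nin: "N \<subseteq> {x. (\<forall>i\<in>I. x i \<in> mspace (LB i)) \<and> (\<forall>i. i \<notin> I \<longrightarrow> x i = 0)}"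
    by (auto simp: N_def)
  have Nst0: "(\<lambda>i. if i \<in> I then mop (LB i) u n (x i) else 0) \<in> N" if u: "u \<in> vspace V" and x: "x \<in> N" for u n x
  proof -
    have "(\<Sum>i\<in>I. ff i (vv i) k (mop (LB i) u n (x i))) = 0" for k
      using x by (intro intertwining_sum_stable2[OF lA lB L3 fin ff vv _ u]) (auto simp: N_def)
    then show ?thesis using x lmodD(3)[OF lB u] by (simp add: N_def)
  qed
  then have Nst: "\<forall>u\<in>vspace V. \<forall>n. \<forall>x\<in>N. (\<lambda>i. if i \<in> I then mop (LB i) u n (x i) else 0) \<in> N"
    by blast
  let ?w = "\<lambda>i. if i \<in> I then w i else 0"
  have wN: "?w \<in> N" using w zero by (simp add: N_def)
  have "?w \<noteq> 0" using w0 i0 by (auto simp: fun_eq_iff)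
  \<comment> \<open>The diagonal copy of \<open>LB j\<close> in \<open>N\<close> replaces the given
    vectors \<open>w i\<close> by multiples of one arbitrary vector y of that module, leaving a
    relation with coefficients \<open>c i\<close> that holds for all y.\<close>
  obtain j c where j: "j \<in> I" "c j = 1" and c: "\<And>i. c i \<noteq> 0 \<Longrightarrow> i \<in> I \<and> LB i = LB j"
    and diag: "\<And>y. y \<in> mspace (LB j) \<Longrightarrow> (\<lambda>i. c i *\<^sub>C y) \<in> N"
    using diagonal_submodule[OF V fin irrB ineqB N Nin Nst wN \<open>?w \<noteq> 0\<close>] by blast
  define B where "B = LB j"
  define I' where "I' = {i \<in> I. LB i = B}"
  have c0: "c i = 0" if "i \<in> I - I'" for i using that c[of i] by (auto simp: I'_def B_def)
  \<comment> \<open>Indices sharing module and operator are merged, and their vectors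
    \<open>vv i\<close> are combined with the coefficients \<open>c i\<close> into the single vector
    \<open>y0\<close>; the relation then has one term for each pair in \<open>K\<close>.\<close>
  define K where "K = (\<lambda>i. (LA i, ff i)) ` I'"
  have finI': "finite I'" and I'I: "I' \<subseteq> I" using fin by (auto simp: I'_def)
  have finK: "finite K" using finI' by (simp add: K_def)
  have K1: "irreducible_module V (fst p)" "snd p \<in> intertwining_ops V (fst p) B L3" if "p \<in> K" for p
    using that irrA ff by (auto simp: K_def I'_def)
  note lK = irreducible_lmod[OF K1(1)] and dK = intertwiningD[OF K1(2)]
  have lBj: "lmod V B" using lB j(1) by (simp add: B_def)
  have group: "(\<Sum>p\<in>K. \<Sum>i | i \<in> I' \<and> (LA i, ff i) = p. h i) = (\<Sum>i\<in>I'. h i)"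
    for h :: "'i \<Rightarrow> 'm3"
    using finI' finK by (intro sum.group) (auto simp: K_def)
  define y0 where "y0 p = (\<Sum>i | i \<in> I' \<and> (LA i, ff i) = p. c i *\<^sub>C vv i)" for p
  have y0mem: "y0 p \<in> mspace (fst p)" if "p \<in> K" for p
    using that vv unfolding y0_def
    by (intro cvec.subspace_sum cvec.subspace_scale lmodD(1)[OF lK]) (auto simp: I'_def)
  have y0zero: "(\<Sum>p\<in>K. snd p (y0 p) k y) = 0" if y: "y \<in> mspace B" for k y
  proof -
    have "(\<Sum>p\<in>K. snd p (y0 p) k y) = (\<Sum>p\<in>K. \<Sum>i | i \<in> I' \<and> (LA i, ff i) = p. c i *\<^sub>C ff i (vv i) k y)"
    proof (rule sum.cong)
      fix p assume p: "p \<in> K"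
      have *: "c i *\<^sub>C vv i \<in> mspace (fst p)" if "i \<in> {i. i \<in> I' \<and> (LA i, ff i) = p}" for i
        using that vv by (auto simp: I'_def intro!: cvec.subspace_scale lmodD(1)[OF lA])
      have "snd p (y0 p) k y = (\<Sum>i | i \<in> I' \<and> (LA i, ff i) = p. snd p (c i *\<^sub>C vv i) k y)"
        unfolding y0_def using linear_on_sum[OF lmodD(1)[OF lK[OF p]] dK(1)[OF p y] *] .
      also have "\<dots> = (\<Sum>i | i \<in> I' \<and> (LA i, ff i) = p. c i *\<^sub>C ff i (vv i) k y)"
      proof (rule sum.cong)
        fix i assume "i \<in> {i. i \<in> I' \<and> (LA i, ff i) = p}"
        then have "i \<in> I" "p = (LA i, ff i)" "vv i \<in> mspace (fst p)" using vv by (auto simp: I'_def)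
        then show "snd p (c i *\<^sub>C vv i) k y = c i *\<^sub>C ff i (vv i) k y"
          using linear_on_scale[OF dK(1)[OF p y, of k], of "vv i" "c i"] by simp
      qed simp
      finally show "snd p (y0 p) k y = (\<Sum>i | i \<in> I' \<and> (LA i, ff i) = p. c i *\<^sub>C ff i (vv i) k y)" .
    qed simp
    also have "\<dots> = (\<Sum>i\<in>I'. c i *\<^sub>C ff i (vv i) k y)" by (rule group)
    also have "\<dots> = (\<Sum>i\<in>I'. ff i (vv i) k (c i *\<^sub>C y))"
      using y by (intro sum.cong) (auto simp: I'_def intro!: linear_on_scale[OF dff(2)[OF _ vv], symmetric])
    also have "\<dots> = (\<Sum>i\<in>I. ff i (vv i) k (c i *\<^sub>C y))"
      using fin I'I c0 linear_on_0[OF lmodD(1)[OF lB] dff(2)[OF _ vv]]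
      by (intro sum.mono_neutral_left) simp_all
    also have "\<dots> = 0" using diag[of y] y by (simp add: N_def B_def)
    finally show ?thesis .
  qed
  define N2 where "N2 = {x. (\<forall>p\<in>K. x p \<in> mspace (fst p)) \<and> (\<forall>p. p \<notin> K \<longrightarrow> x p = 0) \<and>
    (\<forall>y\<in>mspace B. \<forall>k. (\<Sum>p\<in>K. snd p (x p) k y) = 0)}"
  have N2: "cvec.subspace N2"
    using subspace_sum_kernel[of K "\<lambda>p. mspace (fst p)" "mspace B \<times> UNIV" "\<lambda>t p x. snd p x (snd t) (fst t)",
        OF lmodD(1)[OF lK] dK(1)] by (auto simp: N2_def)
  have N2in: "N2 \<subseteq> {x. (\<forall>p\<in>K. x p \<in> mspace (fst p)) \<and> (\<forall>p. p \<notin> K \<longrightarrow> x p = 0)}"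
    by (auto simp: N2_def)
  have N2st0: "(\<lambda>p. if p \<in> K then mop (fst p) u n (x p) else 0) \<in> N2"
    if u: "u \<in> vspace V" and x: "x \<in> N2" for u n x
  proof -
    have "(\<Sum>p\<in>K. snd p (mop (fst p) u n (x p)) k y) = 0" if y: "y \<in> mspace B" for k y
      using x y lmodD(3)[OF lBj u]
      by (intro intertwining_sum_stable1[OF lK lBj L3 K1(2) _ _ u]) (auto simp: N2_def)
    then show ?thesis using x lmodD(3)[OF lK u] by (simp add: N2_def)
  qed
  then have N2st: "\<forall>u\<in>vspace V. \<forall>n. \<forall>x\<in>N2. (\<lambda>p. if p \<in> K then mop (fst p) u n (x p) else 0) \<in> N2"
    by blast
  let ?y0 = "\<lambda>p. if p \<in> K then y0 p else 0"
  have y0N2: "?y0 \<in> N2" using y0mem y0zero by (simp add: N2_def)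
  have jK: "(LA j, ff j) \<in> K" using j(1) by (auto simp: K_def I'_def B_def)
  let ?J = "{i. i \<in> I' \<and> (LA i, ff i) = (LA j, ff j)}"
  \<comment> \<open>Here the independence of the \<open>vv i\<close> is spent: the coefficient of
    \<open>vv j\<close> in this combination is \<open>c j = 1\<close>.\<close>
  have "y0 (LA j, ff j) \<noteq> 0"
  proof
    assume y0: "y0 (LA j, ff j) = 0"
    have J: "?J \<subseteq> I" "finite ?J" using I'I finI' by auto
    \<comment> \<open>Independence speaks about the image set, so distinct indices must give
      distinct vectors; in \<open>?J\<close> the two modules and the operator agree, and
      \<open>inj\<close> leaves only \<open>vv\<close> to separate indices.\<close>
    have injv: "inj_on vv ?J"
    proof (rule inj_onI)
      fix x y assume "x \<in> ?J" "y \<in> ?J" "vv x = vv y"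
      then show "x = y" using inj_onD[OF inj, of x y] by (simp add: I'_def)
    qed
    have ind: "cvec.independent (vv ` ?J)"
      by (rule cvec.independent_mono[OF indv[of "LA j"]]) (auto simp: I'_def)
    have "(\<Sum>x\<in>vv ` ?J. c (the_inv_into ?J vv x) *\<^sub>C x) = (\<Sum>i\<in>?J. c i *\<^sub>C vv i)"
      using injv by (simp add: sum.reindex the_inv_into_f_f)
    also have "\<dots> = 0" using y0 by (simp add: y0_def)
    finally have "c (the_inv_into ?J vv (vv j)) = 0"
      using cvec.independentD[OF ind, of "vv ` ?J" "\<lambda>x. c (the_inv_into ?J vv x)" "vv j"] J(2) j(1)
      by (simp add: I'_def B_def)
    moreover have "the_inv_into ?J vv (vv j) = j"
      using j(1) by (intro the_inv_into_f_f[OF injv]) (simp add: I'_def B_def)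
    ultimately show False using j(2) by simp
  qed
  then have y0nz: "?y0 \<noteq> 0" using jK by (auto simp: fun_eq_iff)
  have ineqK: "fst p = fst q" if "p \<in> K" "q \<in> K" "module_iso V (fst p) (fst q)" for p q
    using that ineqA by (auto simp: K_def I'_def)
  obtain p0 d where p0: "p0 \<in> K" "d p0 = 1" and d: "\<And>p. d p \<noteq> 0 \<Longrightarrow> p \<in> K \<and> fst p = fst p0"
    and diag2: "\<And>x. x \<in> mspace (fst p0) \<Longrightarrow> (\<lambda>p. d p *\<^sub>C x) \<in> N2"
    using diagonal_submodule[OF V finK K1(1) ineqK N2 N2in N2st y0N2 y0nz] by blast
  define P where "P = {p \<in> K. fst p = fst p0}"
  have injP: "inj_on snd P" by (auto simp: inj_on_def P_def prod_eq_iff)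
  have ind: "cvec.independent (snd ` P)"
    by (rule cvec.independent_mono[OF indf[of "fst p0" B]]) (force simp: P_def K_def I'_def)
  have d0: "d p = 0" if "p \<in> K - P" for p using that d[of p] by (auto simp: P_def)
  have PK: "P \<subseteq> K" by (auto simp: P_def)
  \<comment> \<open>The second diagonal copy makes the vector in the first slot arbitrary as well,
    so that what remains is a linear relation between the operators themselves, with coefficient 1
    at \<open>p0\<close>.\<close>
  have "(\<Sum>p\<in>P. d p *\<^sub>C snd p) = 0"
  proof (intro ext)
    fix v k y
    have "(\<Sum>p\<in>P. d p *\<^sub>C snd p v k y) = 0"
    proof (cases "v \<in> mspace (fst p0) \<and> y \<in> mspace B")
      case True
      have v: "v \<in> mspace (fst p)" if "p \<in> P" for p using that True by (simp add: P_def)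
      have "(\<Sum>p\<in>P. d p *\<^sub>C snd p v k y) = (\<Sum>p\<in>P. snd p (d p *\<^sub>C v) k y)"
        using True v PK by (intro sum.cong refl linear_on_scale[OF dK(1), symmetric]) auto
      also have "\<dots> = (\<Sum>p\<in>K. snd p (d p *\<^sub>C v) k y)"
        using finK PK d0 linear_on_0[OF lmodD(1)[OF lK] dK(1)] True
        by (intro sum.mono_neutral_left) simp_all
      also have "\<dots> = 0" using diag2[of v] True by (simp add: N2_def)
      finally show ?thesis .
    next
      case False
      have "snd p v k y = 0" if "p \<in> P" for p
        using dK(4)[of p v y k] that False by (simp add: P_def)
      then show ?thesis by simp
    qed
    then show "(\<Sum>p\<in>P. d p *\<^sub>C snd p) v k y = 0 v k y"
      by (simp add: sum_apply3 scaleC_fun_def)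
  qed
  then have "(\<Sum>g\<in>snd ` P. d (the_inv_into P snd g) *\<^sub>C g) = 0"
    using injP by (simp add: sum.reindex the_inv_into_f_f)
  then have "d (the_inv_into P snd (snd p0)) = 0"
    using cvec.independentD[OF ind, of "snd ` P" "\<lambda>g. d (the_inv_into P snd g)" "snd p0"] finK p0(1)
    by (simp add: P_def)
  moreover have "the_inv_into P snd (snd p0) = p0"
    using p0(1) by (intro the_inv_into_f_f[OF injP]) (simp add: P_def)
  ultimately show False using p0(2) by simp
qed

subsection \<open>Tensor products over the complex numbers\<close>

lemma bilinear_onD:
  assumes "bilinear_on X Y f"
  shows "x \<in> X \<Longrightarrow> linear_on Y (f x)" "y \<in> Y \<Longrightarrow> linear_on X (\<lambda>x. f x y)"
  using assms by (auto simp: bilinear_on_def)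

lemma bilinear_balanced:
  "bilinear_on X Y f \<Longrightarrow> f \<in> balanced_maps UNIV (\<lambda>x c. c *\<^sub>C x) (*\<^sub>C) X Y"
  by (simp add: balanced_maps_def bilinear_on_def linear_on_def)

lemma tens_bilinear: "bilinear_on X Y (tens S r l X Y)"
  by (auto simp: bilinear_on_def linear_on_def tens_def balanced_maps_def fun_eq_iff scaleC_fun_def)

lemma tens_mem: "x \<in> X \<Longrightarrow> y \<in> Y \<Longrightarrow> tens S r l X Y x y \<in> tensor_space S r l X Y"
  unfolding tensor_space_def by (rule cvec.span_base) blast

lemma tensor_space_subspace: "cvec.subspace (tensor_space S r l X Y)"
  by (simp add: tensor_space_def)

lemma tens_balanced:
  assumes "x \<in> X" "y \<in> Y" "s \<in> S"
  shows "tens S r l X Y (r x s) y = tens S r l X Y x (l s y)"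
  using assms by (auto simp: tens_def balanced_maps_def fun_eq_iff)

lemma linear_on_span_mem:
  assumes R: "cvec.subspace R" and g: "linear_on (cvec.span B) g" "\<And>b. b \<in> B \<Longrightarrow> g b \<in> R"
    and x: "x \<in> cvec.span B"
  shows "g x \<in> R"
proof -
  have "cvec.subspace {x \<in> cvec.span B. g x \<in> R}"
    using cvec.subspace_0[OF R] linear_on_0[OF cvec.subspace_span g(1)]
    by (intro cvec.subspaceI)
      (simp_all add: linear_on_add[OF g(1)] linear_on_scale[OF g(1)] cvec.subspace_add[OF R]
        cvec.subspace_scale[OF R] cvec.span_zero cvec.span_add cvec.span_scale)
  then have "cvec.span B \<subseteq> {x \<in> cvec.span B. g x \<in> R}"
    using g(2) by (intro cvec.span_minimal) (auto intro: cvec.span_base)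
  then show ?thesis using x by blast
qed

lemma tensor_space_mapI:
  assumes R: "cvec.subspace R" and g: "linear_on (tensor_space S r l X Y) g"
    and "\<And>x y. x \<in> X \<Longrightarrow> y \<in> Y \<Longrightarrow> g (tens S r l X Y x y) \<in> R"
    and t: "t \<in> tensor_space S r l X Y"
  shows "g t \<in> R"
  using t unfolding tensor_space_def
  by (rule linear_on_span_mem[OF R g[unfolded tensor_space_def], rotated]) (use assms(3) in blast)

text \<open>Sums of this shape form a subspace containing the pure tensors. Since \<open>w\<close>
  is defined at every index, two sums can be extended by 0 to a common index set and added.\<close>

lemma ctensor_expansion:
  assumes Y: "cvec.subspace Y" and t: "t \<in> ctensor_space (cvec.span (b ` K)) Y"
  obtains J w where "finite J" "J \<subseteq> K" "\<And>i. w i \<in> Y"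
    "t = (\<Sum>i\<in>J. ctens (cvec.span (b ` K)) Y (b i) (w i))"
proof -
  let ?X = "cvec.span (b ` K)"
  let ?t = "ctens ?X Y"
  define R where "R = {\<Sum>i\<in>J. ?t (b i) (w i) |J w. finite J \<and> J \<subseteq> K \<and> (\<forall>i. w i \<in> Y)}"
  have RI: "(\<Sum>i\<in>J. ?t (b i) (w i)) \<in> R" if "finite J" "J \<subseteq> K" "\<And>i. w i \<in> Y" for J w
    unfolding R_def using that by blast
  have lin: "linear_on Y (?t (b i))" if "i \<in> K" for i
    using that by (intro bilinear_onD(1)[OF tens_bilinear] cvec.span_base) blast
  have t0: "?t (b i) 0 = 0" if "i \<in> K" for i using linear_on_0[OF Y lin[OF that]] .
  have R: "cvec.subspace R"
  proof (rule cvec.subspaceI)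
    show "0 \<in> R" using RI[of "{}" "\<lambda>_. 0"] cvec.subspace_0[OF Y] by simp
    show "x + y \<in> R" if x: "x \<in> R" and y: "y \<in> R" for x y
    proof -
      obtain J w J' w' where J: "finite J" "J \<subseteq> K" "\<forall>i. w i \<in> Y" "x = (\<Sum>i\<in>J. ?t (b i) (w i))"
        and J': "finite J'" "J' \<subseteq> K" "\<forall>i. w' i \<in> Y" "y = (\<Sum>i\<in>J'. ?t (b i) (w' i))"
        using x y by (auto simp: R_def)
      let ?w = "\<lambda>i. if i \<in> J then w i else 0" and ?w' = "\<lambda>i. if i \<in> J' then w' i else 0"
      have wY: "?w i \<in> Y" "?w' i \<in> Y" for i using J(3) J'(3) cvec.subspace_0[OF Y] by auto
      have "x = (\<Sum>i\<in>J \<union> J'. ?t (b i) (?w i))"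
        unfolding J(4) using J(1,2) J'(1,2) t0 by (intro sum.mono_neutral_cong_left) auto
      moreover have "y = (\<Sum>i\<in>J \<union> J'. ?t (b i) (?w' i))"
        unfolding J'(4) using J(1,2) J'(1,2) t0 by (intro sum.mono_neutral_cong_left) auto
      ultimately have "x + y = (\<Sum>i\<in>J \<union> J'. ?t (b i) (?w i) + ?t (b i) (?w' i))"
        by (simp only: sum.distrib)
      also have "\<dots> = (\<Sum>i\<in>J \<union> J'. ?t (b i) (?w i + ?w' i))"
        using J(2,3) J'(2,3) wY by (intro sum.cong refl linear_on_add[OF lin, symmetric]) auto
      also have "\<dots> \<in> R"
        using J(1,2) J'(1,2) by (intro RI cvec.subspace_add[OF Y] wY) auto
      finally show ?thesis .
    qed
    show "c *\<^sub>C x \<in> R" if x: "x \<in> R" for c x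
    proof -
      obtain J w where J: "finite J" "J \<subseteq> K" "\<forall>i. w i \<in> Y" "x = (\<Sum>i\<in>J. ?t (b i) (w i))"
        using x by (auto simp: R_def)
      have "c *\<^sub>C x = (\<Sum>i\<in>J. ?t (b i) (c *\<^sub>C w i))"
        unfolding J(4) cvec.scale_sum_right
        using J(2,3) by (intro sum.cong refl linear_on_scale[OF lin, symmetric]) auto
      also have "\<dots> \<in> R" using J(1-3) by (intro RI) (auto intro: cvec.subspace_scale[OF Y])
      finally show ?thesis .
    qed
  qed
  have "?t x y \<in> R" if x: "x \<in> ?X" and y: "y \<in> Y" for x y
  proof (rule linear_on_span_mem[OF R bilinear_onD(2)[OF tens_bilinear y] _ x])
    fix z assume "z \<in> b ` K"
    then obtain i where "i \<in> K" "z = b i" by blast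
    then show "?t z y \<in> R" using RI[of "{i}" "\<lambda>_. y"] y by simp
  qed
  then have "t \<in> R" using tensor_space_mapI[OF R linear_on_id _ t] by blast
  then show ?thesis using that by (auto simp: R_def)
qed

lemma ctensor_space_span:
  assumes "X = cvec.span A" "Y = cvec.span B"
  shows "ctensor_space X Y = cvec.span ((\<lambda>(a, b). ctens X Y a b) ` (A \<times> B))" (is "?T = cvec.span ?S")
proof
  have AX: "A \<subseteq> X" "B \<subseteq> Y" using assms cvec.span_superset by auto
  have "ctens X Y a y \<in> cvec.span ?S" if a: "a \<in> A" and y: "y \<in> Y" for a y
  proof (rule linear_on_span_mem[OF cvec.subspace_span _ _ y[unfolded assms(2)]])
    show "linear_on (cvec.span B) (ctens X Y a)"
      using bilinear_onD(1)[OF tens_bilinear] a AX(1) unfolding assms(2)[symmetric] by blast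
    show "ctens X Y a b \<in> cvec.span ?S" if "b \<in> B" for b
      using a that by (intro cvec.span_base) blast
  qed
  then have 1: "\<And>a. a \<in> A \<Longrightarrow> y \<in> Y \<Longrightarrow> ctens X Y a y \<in> cvec.span ?S" for y by blast
  have "ctens X Y x y \<in> cvec.span ?S" if x: "x \<in> X" and y: "y \<in> Y" for x y
  proof (rule linear_on_span_mem[OF cvec.subspace_span _ _ x[unfolded assms(1)]])
    show "linear_on (cvec.span A) (\<lambda>x. ctens X Y x y)"
      using bilinear_onD(2)[OF tens_bilinear y] unfolding assms(1) .
  qed (rule 1[OF _ y])
  then show "?T \<subseteq> cvec.span ?S"
    unfolding tensor_space_def by (intro cvec.span_minimal) auto
  show "cvec.span ?S \<subseteq> ?T"
    using AX by (intro cvec.span_minimal tensor_space_subspace) (auto intro: tens_mem)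
qed

section \<open>Triple tensor products and evaluation of intertwining operators\<close>

abbreviation fus_comp where
  "fus_comp V L1 L2 L3 \<equiv>
     ctensor_space (ctensor_space (intertwining_ops V L1 L2 L3) (mspace L1)) (mspace L2)"

definition trilinear_on where
  "trilinear_on X Y Z g \<longleftrightarrow>
     (\<forall>y\<in>Y. \<forall>z\<in>Z. linear_on X (\<lambda>x. g x y z)) \<and>
     (\<forall>x\<in>X. \<forall>z\<in>Z. linear_on Y (\<lambda>y. g x y z)) \<and>
     (\<forall>x\<in>X. \<forall>y\<in>Y. linear_on Z (g x y))"

text \<open>The inner lift is taken separately for each vector of \<open>L2\<close>; that it depends
  linearly on this vector follows from the uniqueness of lifts.\<close>

lemma fus_lift:
  fixes g :: "('m1::complex_vector \<Rightarrow> complex \<Rightarrow> 'm2::complex_vector \<Rightarrow> 'm3::complex_vector) \<Rightarrow>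
    'm1 \<Rightarrow> 'm2 \<Rightarrow> 'c::complex_vector"
  assumes Z: "cvec.subspace (mspace L2)"
    and g: "trilinear_on (intertwining_ops V L1 L2 L3) (mspace L1) (mspace L2) g"
  shows "linear_on (fus_comp V L1 L2 L3) (fus_lift V (L1, L2, L3) g)"
    and "f \<in> intertwining_ops V L1 L2 L3 \<Longrightarrow> v \<in> mspace L1 \<Longrightarrow> w \<in> mspace L2 \<Longrightarrow>
      fus_lift V (L1, L2, L3) g (fus_tens V (L1, L2, L3) f v w) = g f v w"
proof -
  let ?X = "intertwining_ops V L1 L2 L3" and ?Y = "mspace L1" and ?Z = "mspace L2"
  let ?XY = "ctensor_space ?X ?Y"
  define h where "h t w = ctensor_lift ?X ?Y (\<lambda>f v. g f v w) t" for t w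
  have bal: "(\<lambda>f v. g f v w) \<in> balanced_maps UNIV (\<lambda>x c. c *\<^sub>C x) (*\<^sub>C) ?X ?Y" if "w \<in> ?Z" for w
    using g that by (intro bilinear_balanced) (auto simp: trilinear_on_def bilinear_on_def)
  have hlin: "linear_on ?XY (\<lambda>t. h t w)" and hval: "\<And>f v. f \<in> ?X \<Longrightarrow> v \<in> ?Y \<Longrightarrow> h (ctens ?X ?Y f v) w = g f v w"
    if "w \<in> ?Z" for w
    unfolding h_def using tensor_lift[OF bal[OF that]] by auto
  have hlin2: "linear_on ?Z (h t)" if t: "t \<in> ?XY" for t
  proof -
    have "h t (w + w') = h t w + h t w'" if w: "w \<in> ?Z" "w' \<in> ?Z" for w w'
    proof -
      have ww: "w + w' \<in> ?Z" using w by (rule cvec.subspace_add[OF Z])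
      have "h t w + h t w' = ctensor_lift ?X ?Y (\<lambda>f v. g f v (w + w')) t"
        using g w hval by (intro tensor_lift_unique[OF bal[OF ww] linear_on_add_fun[OF hlin[OF w(1)] hlin[OF w(2)]] _ t])
          (auto simp: trilinear_on_def linear_on_def)
      then show ?thesis by (simp add: h_def)
    qed
    moreover have "h t (c *\<^sub>C w) = c *\<^sub>C h t w" if w: "w \<in> ?Z" for c w
    proof -
      have cw: "c *\<^sub>C w \<in> ?Z" using w by (rule cvec.subspace_scale[OF Z])
      have "c *\<^sub>C h t w = ctensor_lift ?X ?Y (\<lambda>f v. g f v (c *\<^sub>C w)) t"
        using g w hval by (intro tensor_lift_unique[OF bal[OF cw] linear_on_scale_fun[OF hlin[OF w]] _ t])
          (auto simp: trilinear_on_def linear_on_def)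
      then show ?thesis by (simp add: h_def)
    qed
    ultimately show ?thesis by (simp add: linear_on_def)
  qed
  have "bilinear_on ?XY ?Z h" using hlin hlin2 by (simp add: bilinear_on_def)
  note lift = tensor_lift[OF bilinear_balanced[OF this]]
  have eq: "fus_lift V (L1, L2, L3) g = ctensor_lift ?XY ?Z h"
    by (simp add: fus_lift_def h_def[abs_def])
  show "linear_on (fus_comp V L1 L2 L3) (fus_lift V (L1, L2, L3) g)"
    unfolding eq by (rule lift(1))
  show "fus_lift V (L1, L2, L3) g (fus_tens V (L1, L2, L3) f v w) = g f v w"
    if "f \<in> ?X" "v \<in> ?Y" "w \<in> ?Z"
    unfolding eq by (simp add: fus_tens_def lift(2) tens_mem that hval)
qed

lemma fus_tens_mem:
  assumes "f \<in> intertwining_ops V L1 L2 L3" "v \<in> mspace L1" "w \<in> mspace L2"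
  shows "fus_tens V (L1, L2, L3) f v w \<in> fus_comp V L1 L2 L3"
  using assms by (simp add: fus_tens_def tens_mem)

lemma fus_tens_trilinear:
  "trilinear_on (intertwining_ops V L1 L2 L3) (mspace L1) (mspace L2) (fus_tens V (L1, L2, L3))"
proof -
  let ?X = "intertwining_ops V L1 L2 L3" and ?Y = "mspace L1" and ?Z = "mspace L2"
  let ?XY = "ctensor_space ?X ?Y"
  have lin: "linear_on ?XY (\<lambda>t. ctens ?XY ?Z t w)" if "w \<in> ?Z" for w
    using bilinear_onD(2)[OF tens_bilinear that] .
  have "linear_on ?X (\<lambda>f. ctens ?XY ?Z (ctens ?X ?Y f v) w)" if "v \<in> ?Y" "w \<in> ?Z" for v w
    using that by (intro linear_on_compose[OF bilinear_onD(2)[OF tens_bilinear] _ lin]) (auto intro: tens_mem)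
  moreover have "linear_on ?Y (\<lambda>v. ctens ?XY ?Z (ctens ?X ?Y f v) w)" if "f \<in> ?X" "w \<in> ?Z" for f w
    using that by (intro linear_on_compose[OF bilinear_onD(1)[OF tens_bilinear] _ lin]) (auto intro: tens_mem)
  moreover have "linear_on ?Z (ctens ?XY ?Z (ctens ?X ?Y f v))" if "f \<in> ?X" "v \<in> ?Y" for f v
    using that by (intro bilinear_onD(1)[OF tens_bilinear] tens_mem)
  ultimately show ?thesis by (simp add: trilinear_on_def fus_tens_def)
qed

text \<open>Brings a tensor into the form treated by \<open>intertwining_sum_injective\<close>:
  basis elements in the first two factors, arbitrary vectors in the third.\<close>

lemma fus_tens_expansion:
  assumes L1: "lmod V L1" and L2: "lmod V L2"
    and A: "intertwining_ops V L1 L2 L3 = cvec.span A" and B: "mspace L1 = cvec.span B"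
    and t: "t \<in> fus_comp V L1 L2 L3"
  shows "\<exists>J w. finite J \<and> J \<subseteq> A \<times> B \<and> (\<forall>p. w p \<in> mspace L2) \<and>
    t = (\<Sum>p\<in>J. fus_tens V (L1, L2, L3) (fst p) (snd p) (w p))"
proof -
  let ?X = "intertwining_ops V L1 L2 L3" and ?Y = "mspace L1" and ?Z = "mspace L2"
  let ?b = "\<lambda>(f, v). ctens ?X ?Y f v"
  note sp = ctensor_space_span[OF A B]
  obtain J w where "finite J" "J \<subseteq> A \<times> B" "\<And>p. w p \<in> ?Z"
    "t = (\<Sum>p\<in>J. ctens (cvec.span (?b ` (A \<times> B))) ?Z (?b p) (w p))"
    using ctensor_expansion[OF lmodD(1)[OF L2], of t ?b "A \<times> B"] t unfolding sp by blast
  then show ?thesis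
    by (intro exI[of _ J] exI[of _ w]) (simp add: fus_tens_def sp case_prod_beta)
qed

text \<open>The endomorphisms \<theta>1 and \<theta>2 let one definition serve twice: identities
  give plain evaluation, whose injectivity is shown below, and the transport maps give evaluation
  after the replacement of v10 and v20.\<close>

definition fus_eval ::
  "'v::complex_vector voa \<Rightarrow> ('v, 'm1::complex_vector) vmod set \<Rightarrow> ('v, 'm2::complex_vector) vmod set \<Rightarrow>
   (('v, 'm1) vmod \<Rightarrow> 'm1 \<Rightarrow> 'm1) \<Rightarrow> (('v, 'm2) vmod \<Rightarrow> 'm2 \<Rightarrow> 'm2) \<Rightarrow> complex \<Rightarrow>
   ('v, 'm1, 'm2, 'm3::complex_vector) fus \<Rightarrow> ('v, 'm3) vmod \<Rightarrow> 'm3" where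
  "fus_eval V S1 S2 \<theta>1 \<theta>2 k X L3 = (\<Sum>(L1, L2)\<in>S1 \<times> S2.
     fus_lift V (L1, L2, L3) (\<lambda>f v w. f (\<theta>1 L1 v) k (\<theta>2 L2 w)) (X (L1, L2, L3)))"

definition linear_endos :: "('v, 'm::complex_vector) vmod set \<Rightarrow> (('v, 'm) vmod \<Rightarrow> 'm \<Rightarrow> 'm) \<Rightarrow> bool" where
  "linear_endos S \<theta> \<longleftrightarrow> (\<forall>L\<in>S. linear_on (mspace L) (\<theta> L) \<and> \<theta> L ` mspace L \<subseteq> mspace L)"

lemma linear_endosD:
  assumes "linear_endos S \<theta>" "L \<in> S"
  shows "linear_on (mspace L) (\<theta> L)" "\<theta> L ` mspace L \<subseteq> mspace L" "v \<in> mspace L \<Longrightarrow> \<theta> L v \<in> mspace L"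
  using assms by (auto simp: linear_endos_def)

lemma eval_trilinear:
  assumes \<theta>1: "linear_endos S1 \<theta>1" and \<theta>2: "linear_endos S2 \<theta>2" and L: "L1 \<in> S1" "L2 \<in> S2"
  shows "trilinear_on (intertwining_ops V L1 L2 L3) (mspace L1) (mspace L2)
    (\<lambda>f v w. f (\<theta>1 L1 v) k (\<theta>2 L2 w))"
proof -
  note t1 = linear_endosD[OF \<theta>1 L(1)] and t2 = linear_endosD[OF \<theta>2 L(2)]
  have "linear_on (intertwining_ops V L1 L2 L3) (\<lambda>f. f (\<theta>1 L1 v) k (\<theta>2 L2 w))" for v w
    by (simp add: linear_on_def scaleC_fun_def)
  moreover have "linear_on (mspace L1) (\<lambda>v. f (\<theta>1 L1 v) k (\<theta>2 L2 w))"
    if f: "f \<in> intertwining_ops V L1 L2 L3" and w: "w \<in> mspace L2" for f w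
    by (rule linear_on_compose[OF t1(1,2) intertwiningD(1)[OF f t2(3)[OF w]]])
  moreover have "linear_on (mspace L2) (\<lambda>w. f (\<theta>1 L1 v) k (\<theta>2 L2 w))"
    if f: "f \<in> intertwining_ops V L1 L2 L3" and v: "v \<in> mspace L1" for f v
    by (rule linear_on_compose[OF t2(1,2) intertwiningD(2)[OF f t1(3)[OF v]]])
  ultimately show ?thesis by (simp add: trilinear_on_def)
qed

lemma fus_spaceD:
  assumes "X \<in> fus_space V F1 F2 F3"
  shows "L1 \<in> fmods F1 \<Longrightarrow> L2 \<in> fmods F2 \<Longrightarrow> L3 \<in> fmods F3 \<Longrightarrow> X (L1, L2, L3) \<in> fus_comp V L1 L2 L3"
    and "\<not> (L1 \<in> fmods F1 \<and> L2 \<in> fmods F2 \<and> L3 \<in> fmods F3) \<Longrightarrow> X (L1, L2, L3) = 0"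
proof -
  show "L1 \<in> fmods F1 \<Longrightarrow> L2 \<in> fmods F2 \<Longrightarrow> L3 \<in> fmods F3 \<Longrightarrow> X (L1, L2, L3) \<in> fus_comp V L1 L2 L3"
    using assms unfolding fus_space_def dsum_def by fastforce
  show "\<not> (L1 \<in> fmods F1 \<and> L2 \<in> fmods F2 \<and> L3 \<in> fmods F3) \<Longrightarrow> X (L1, L2, L3) = 0"
    using assms unfolding fus_space_def dsum_def by auto
qed

lemma dsum_subspace:
  assumes X: "\<And>i. i \<in> I \<Longrightarrow> cvec.subspace (X i)"
  shows "cvec.subspace (dsum I X)"
proof (rule cvec.subspaceI)
  show "0 \<in> dsum I X" using cvec.subspace_0[OF X] by (simp add: dsum_def)
  show "x + y \<in> dsum I X" if x: "x \<in> dsum I X" and y: "y \<in> dsum I X" for x y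
  proof -
    have "{i. (x + y) i \<noteq> 0} \<subseteq> {i. x i \<noteq> 0} \<union> {i. y i \<noteq> 0}" by auto
    then have "finite {i. (x + y) i \<noteq> 0}"
      by (rule finite_subset) (use x y in \<open>simp add: dsum_def\<close>)
    then show ?thesis using x y cvec.subspace_add[OF X] by (simp add: dsum_def)
  qed
  show "c *\<^sub>C x \<in> dsum I X" if x: "x \<in> dsum I X" for c x
  proof -
    have "{i. (c *\<^sub>C x) i \<noteq> 0} \<subseteq> {i. x i \<noteq> 0}" by (auto simp: scaleC_fun_def)
    then have "finite {i. (c *\<^sub>C x) i \<noteq> 0}"
      by (rule finite_subset) (use x in \<open>simp add: dsum_def\<close>)
    then show ?thesis using x cvec.subspace_scale[OF X] by (simp add: dsum_def scaleC_fun_def)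
  qed
qed

lemma fus_space_subspace: "cvec.subspace (fus_space V F1 F2 F3)"
  unfolding fus_space_def
  by (rule dsum_subspace) (simp add: case_prod_beta tensor_space_subspace)

lemma fus_gen_mem:
  assumes "L1 \<in> fmods F1" "L2 \<in> fmods F2" "L3 \<in> fmods F3" "f \<in> intertwining_ops V L1 L2 L3"
    "v \<in> mspace L1" "w \<in> mspace L2"
  shows "fus_gen V (L1, L2, L3) f v w \<in> fus_space V F1 F2 F3"
proof -
  have "fus_tens V (L1, L2, L3) f v w \<in> fus_comp V L1 L2 L3" using assms by (intro fus_tens_mem)
  moreover have "finite {i. dsum_in (L1, L2, L3) (fus_tens V (L1, L2, L3) f v w) i \<noteq> 0}"
    by (rule finite_subset[of _ "{(L1, L2, L3)}"]) (auto simp: dsum_in_def)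
  ultimately show ?thesis
    using assms cvec.subspace_0[OF tensor_space_subspace]
    by (auto simp: fus_space_def fus_gen_def dsum_def dsum_in_def)
qed

lemma fus_eval_linear:
  assumes "\<And>L. L \<in> fmods F2 \<Longrightarrow> lmod V L" "linear_endos (fmods F1) \<theta>1" "linear_endos (fmods F2) \<theta>2"
    and "L3 \<in> fmods F3"
  shows "linear_on (fus_space V F1 F2 F3) (\<lambda>X. fus_eval V (fmods F1) (fmods F2) \<theta>1 \<theta>2 k X L3)"
proof -
  have "linear_on (fus_space V F1 F2 F3) (\<lambda>X. case p of (L1, L2) \<Rightarrow>
     fus_lift V (L1, L2, L3) (\<lambda>f v w. f (\<theta>1 L1 v) k (\<theta>2 L2 w)) (X (L1, L2, L3)))"
    if p: "p \<in> fmods F1 \<times> fmods F2" for p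
  proof -
    obtain L1 L2 where [simp]: "p = (L1, L2)" and L: "L1 \<in> fmods F1" "L2 \<in> fmods F2" using p by blast
    have "linear_on (fus_comp V L1 L2 L3) (fus_lift V (L1, L2, L3) (\<lambda>f v w. f (\<theta>1 L1 v) k (\<theta>2 L2 w)))"
      using L by (intro fus_lift(1) lmodD(1)[OF assms(1)] eval_trilinear[OF assms(2,3)]) 
    from linear_on_compose[OF linear_on_coordinate[of "fus_space V F1 F2 F3" "(L1, L2, L3)"] _ this]
    show ?thesis using fus_spaceD(1) L assms(4) by fastforce
  qed
  then show ?thesis unfolding fus_eval_def by (rule linear_on_sum_fun)
qed

lemma fus_eval_gen:
  assumes "\<And>L. L \<in> fmods F2 \<Longrightarrow> lmod V L" "linear_endos (fmods F1) \<theta>1" "linear_endos (fmods F2) \<theta>2"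
    and fin: "finite (fmods F1)" "finite (fmods F2)"
    and L: "L1 \<in> fmods F1" "L2 \<in> fmods F2" and "f \<in> intertwining_ops V L1 L2 L3'"
    "v \<in> mspace L1" "w \<in> mspace L2"
  shows "fus_eval V (fmods F1) (fmods F2) \<theta>1 \<theta>2 k (fus_gen V (L1, L2, L3') f v w) L3 =
    (if L3 = L3' then f (\<theta>1 L1 v) k (\<theta>2 L2 w) else 0)"
proof -
  let ?l = "\<lambda>L1 L2. fus_lift V (L1, L2, L3) (\<lambda>f v w. f (\<theta>1 L1 v) k (\<theta>2 L2 w))"
  let ?X = "fus_gen V (L1, L2, L3') f v w"
  have lin: "linear_on (fus_comp V L1 L2 L3) (?l L1 L2)" if "L1 \<in> fmods F1" "L2 \<in> fmods F2" for L1 L2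
    using that by (intro fus_lift(1) lmodD(1)[OF assms(1)] eval_trilinear[OF assms(2,3)])
  have l0: "?l M1 M2 (?X (M1, M2, L3)) = 0"
    if "M1 \<in> fmods F1" "M2 \<in> fmods F2" "(M1, M2, L3) \<noteq> (L1, L2, L3')" for M1 M2
  proof -
    have "?X (M1, M2, L3) = 0" using that(3) by (auto simp: fus_gen_def dsum_in_def)
    then show ?thesis using linear_on_0[OF tensor_space_subspace lin[OF that(1,2)]] by simp
  qed
  have "fus_eval V (fmods F1) (fmods F2) \<theta>1 \<theta>2 k ?X L3 =
      (\<Sum>p\<in>{(L1, L2)}. case p of (M1, M2) \<Rightarrow> ?l M1 M2 (?X (M1, M2, L3)))"
    unfolding fus_eval_def using fin L l0 by (intro sum.mono_neutral_right) auto
  also have "\<dots> = ?l L1 L2 (?X (L1, L2, L3))" by simp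
  also have "\<dots> = (if L3 = L3' then f (\<theta>1 L1 v) k (\<theta>2 L2 w) else 0)"
  proof (cases "L3 = L3'")
    case True
    then show ?thesis
      using assms(1)[OF L(2)] assms(8-) L
      by (simp add: fus_gen_def dsum_in_def fus_lift(2) lmodD(1) eval_trilinear[OF assms(2,3)])
  next
    case False
    then show ?thesis using l0[OF L] by simp
  qed
  finally show ?thesis .
qed

text \<open>All components with third module \<open>L3\<close> are expanded over bases and joined
  into one finite sum, to which \<open>intertwining_sum_injective\<close> applies; it annihilates
  every coefficient vector.\<close>

theorem fus_eval_injective:
  fixes F1 :: "('v::complex_vector, 'm1::complex_vector, 'j1, 'u1) gfamily"
    and F2 :: "('v, 'm2::complex_vector, 'j2, 'u2) gfamily"
    and F3 :: "('v, 'm3::complex_vector, 'j3, 'u3) gfamily"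
  assumes V: "voa V" and fin: "finite (fmods F1)" "finite (fmods F2)"
    and irr1: "\<And>L. L \<in> fmods F1 \<Longrightarrow> irreducible_module V L"
    and irr2: "\<And>L. L \<in> fmods F2 \<Longrightarrow> irreducible_module V L"
    and ineq1: "\<And>L M. L \<in> fmods F1 \<Longrightarrow> M \<in> fmods F1 \<Longrightarrow> module_iso V L M \<Longrightarrow> L = M"
    and ineq2: "\<And>L M. L \<in> fmods F2 \<Longrightarrow> M \<in> fmods F2 \<Longrightarrow> module_iso V L M \<Longrightarrow> L = M"
    and L3: "L3 \<in> fmods F3" "lmod V L3"
    and X: "X \<in> fus_space V F1 F2 F3"
    and zero: "\<And>k. fus_eval V (fmods F1) (fmods F2) (\<lambda>_ x. x) (\<lambda>_ x. x) k X L3 = 0"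
  shows "X (L1, L2, L3) = 0"
proof (cases "L1 \<in> fmods F1 \<and> L2 \<in> fmods F2")
  case False
  then show ?thesis using fus_spaceD(2)[OF X] by blast
next
  case True
  let ?S = "fmods F1 \<times> fmods F2"
  have lm: "lmod V L" if "L \<in> fmods F1" for L using irreducible_lmod[OF irr1[OF that]] .
  have lm2: "lmod V L" if "L \<in> fmods F2" for L using irreducible_lmod[OF irr2[OF that]] .
  have end1: "linear_endos (fmods F1) (\<lambda>_ x. x)" and end2: "linear_endos (fmods F2) (\<lambda>_ x. x)"
    by (simp_all add: linear_endos_def linear_on_id)
  have "\<exists>A. cvec.independent A \<and> cvec.span A = intertwining_ops V M1 M2 L3 \<and> A \<subseteq> intertwining_ops V M1 M2 L3"
    if "M1 \<in> fmods F1" "M2 \<in> fmods F2" for M1 M2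
    using subspace_basis[OF subspace_intertwining_ops[OF lm[OF that(1)] lm2[OF that(2)] L3(2)]] by metis
  then obtain A where A: "\<And>M1 M2. M1 \<in> fmods F1 \<Longrightarrow> M2 \<in> fmods F2 \<Longrightarrow> cvec.independent (A M1 M2) \<and>
    cvec.span (A M1 M2) = intertwining_ops V M1 M2 L3 \<and> A M1 M2 \<subseteq> intertwining_ops V M1 M2 L3" by metis
  have "\<exists>B. cvec.independent B \<and> cvec.span B = mspace M \<and> B \<subseteq> mspace M" if "M \<in> fmods F1" for M
    using subspace_basis[OF lmodD(1)[OF lm[OF that]]] by metis
  then obtain B where B: "\<And>M. M \<in> fmods F1 \<Longrightarrow>
      cvec.independent (B M) \<and> cvec.span (B M) = mspace M \<and> B M \<subseteq> mspace M" by metis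
  define P where "P M1 M2 J w \<longleftrightarrow> finite J \<and> J \<subseteq> A M1 M2 \<times> B M1 \<and> (\<forall>p. w p \<in> mspace M2) \<and>
      X (M1, M2, L3) = (\<Sum>p\<in>J. fus_tens V (M1, M2, L3) (fst p) (snd p) (w p))" for M1 M2 J w
  have "\<exists>J w. P M1 M2 J w" if M: "M1 \<in> fmods F1" "M2 \<in> fmods F2" for M1 M2
  proof -
    have "intertwining_ops V M1 M2 L3 = cvec.span (A M1 M2)" "mspace M1 = cvec.span (B M1)"
      using A[OF M] B[OF M(1)] by auto
    from fus_tens_expansion[OF lm[OF M(1)] lm2[OF M(2)] this fus_spaceD(1)[OF X M L3(1)]]
    show ?thesis unfolding P_def .
  qed
  then obtain J w where "\<And>M1 M2. M1 \<in> fmods F1 \<Longrightarrow> M2 \<in> fmods F2 \<Longrightarrow> P M1 M2 (J M1 M2) (w M1 M2)"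
    by metis
  note Jw = this[unfolded P_def]
  have Jmem: "fst p \<in> A M1 M2" "snd p \<in> B M1" "w M1 M2 p \<in> mspace M2"
    "fst p \<in> intertwining_ops V M1 M2 L3" "snd p \<in> mspace M1"
    if M: "M1 \<in> fmods F1" "M2 \<in> fmods F2" and p: "p \<in> J M1 M2" for M1 M2 p
  proof -
    have "p \<in> A M1 M2 \<times> B M1" using Jw[OF M] p by blast
    then show "fst p \<in> A M1 M2" "snd p \<in> B M1" by (simp_all add: mem_Times_iff)
    then show "fst p \<in> intertwining_ops V M1 M2 L3" "snd p \<in> mspace M1"
      using A[OF M] B[OF M(1)] by blast+
    show "w M1 M2 p \<in> mspace M2" using Jw[OF M] by blast
  qed
  have Jfin: "\<forall>s\<in>?S. finite (J (fst s) (snd s))"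
  proof
    fix s assume "s \<in> ?S"
    then have "fst s \<in> fmods F1" "snd s \<in> fmods F2" by (simp_all add: mem_Times_iff)
    from Jw[OF this] show "finite (J (fst s) (snd s))" by blast
  qed
  have finS: "finite ?S" using fin by simp
  \<comment> \<open>An index is a pair of modules together with a pair (f, v) of basis elements.
    Keeping the modules in the index separates equal operators or vectors that belong to different
    modules.\<close>
  define I where "I = (SIGMA s:?S. J (fst s) (snd s))"
  define LA LB ff vv where "LA i = fst (fst i)" and "LB i = snd (fst i)" and "ff i = fst (snd i)"
    and "vv i = snd (snd i)" for i :: "(('v, 'm1) vmod \<times> ('v, 'm2) vmod) \<times> ('m1 \<Rightarrow> complex \<Rightarrow> 'm2 \<Rightarrow> 'm3) \<times> 'm1"
  note defs = LA_def LB_def ff_def vv_def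
  define ww where "ww i = w (LA i) (LB i) (snd i)" for i
  have I: "LA i \<in> fmods F1" "LB i \<in> fmods F2" "snd i \<in> J (LA i) (LB i)" if "i \<in> I" for i
    using that by (auto simp: I_def defs)
  have IAB: "ff i \<in> A (LA i) (LB i)" "vv i \<in> B (LA i)" if "i \<in> I" for i
    using Jmem(1,2)[OF I[OF that]] by (simp_all add: ff_def vv_def)
  have sumI: "(\<Sum>i\<in>I. ff i (vv i) k (ww i)) = 0" for k
  proof -
    have "(\<Sum>i\<in>I. ff i (vv i) k (ww i)) =
        (\<Sum>s\<in>?S. \<Sum>p\<in>J (fst s) (snd s). fst p (snd p) k (w (fst s) (snd s) p))"
      unfolding I_def ww_def defs
      using sum.Sigma[OF finS Jfin, of "\<lambda>s p. fst p (snd p) k (w (fst s) (snd s) p)"]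
      by (simp add: case_prod_beta)
    also have "\<dots> = (\<Sum>(M1, M2)\<in>?S. fus_lift V (M1, M2, L3) (\<lambda>f v w. f v k w) (X (M1, M2, L3)))"
    proof (intro sum.cong refl)
      fix s assume "s \<in> ?S"
      then obtain M1 M2 where [simp]: "s = (M1, M2)" and M: "M1 \<in> fmods F1" "M2 \<in> fmods F2" by blast
      let ?g = "\<lambda>f v w. f v k w"
      note tri = eval_trilinear[OF end1 end2 M, of V L3 k]
      note lift = fus_lift[OF lmodD(1)[OF lm2[OF M(2)]] tri]
      note mem = Jmem(4,5,3)[OF M]
      have Xsum: "X (M1, M2, L3) = (\<Sum>p\<in>J M1 M2. fus_tens V (M1, M2, L3) (fst p) (snd p) (w M1 M2 p))"
        using Jw[OF M] by blast
      have "fus_lift V (M1, M2, L3) ?g (X (M1, M2, L3)) =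
          (\<Sum>p\<in>J M1 M2. fus_lift V (M1, M2, L3) ?g (fus_tens V (M1, M2, L3) (fst p) (snd p) (w M1 M2 p)))"
        unfolding Xsum by (rule linear_on_sum[OF tensor_space_subspace lift(1) fus_tens_mem[OF mem]])
      also have "\<dots> = (\<Sum>p\<in>J M1 M2. fst p (snd p) k (w M1 M2 p))"
        using mem by (intro sum.cong refl) (simp add: lift(2))
      finally show "(\<Sum>p\<in>J (fst s) (snd s). fst p (snd p) k (w (fst s) (snd s) p)) =
          (case s of (M1, M2) \<Rightarrow> fus_lift V (M1, M2, L3) ?g (X (M1, M2, L3)))" by simp
    qed
    also have "\<dots> = 0" using zero[of k] by (simp add: fus_eval_def)
    finally show ?thesis .
  qed
  have ww0: "ww i = 0" if i: "i \<in> I" for i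
  proof (rule intertwining_sum_injective[of V I L3 LA LB ff vv ww])
    show "finite I" unfolding I_def using finS Jfin by blast
    show "cvec.independent (ff ` {i \<in> I. LA i = M1 \<and> LB i = M2})" for M1 M2
    proof (cases "M1 \<in> fmods F1 \<and> M2 \<in> fmods F2")
      case True
      then have "cvec.independent (A M1 M2)" using A by blast
      then show ?thesis by (rule cvec.independent_mono) (use IAB(1) in blast)
    next
      case False
      then have empty: "{i \<in> I. LA i = M1 \<and> LB i = M2} = {}" using I by blast
      show ?thesis unfolding empty image_empty by (rule cvec.independent_empty)
    qed
    show "cvec.independent (vv ` {i \<in> I. LA i = M1})" for M1
    proof (cases "M1 \<in> fmods F1")
      case True
      then have "cvec.independent (B M1)" using B by blast
      then show ?thesis by (rule cvec.independent_mono) (use IAB(2) in blast)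
    next
      case False
      then have empty: "{i \<in> I. LA i = M1} = {}" using I by blast
      show ?thesis unfolding empty image_empty by (rule cvec.independent_empty)
    qed
    show "ff i \<in> intertwining_ops V (LA i) (LB i) L3" if "i \<in> I" for i
      using A[OF I(1,2)[OF that]] IAB(1)[OF that] by blast
    show "vv i \<in> mspace (LA i)" if "i \<in> I" for i
      using B[OF I(1)[OF that]] IAB(2)[OF that] by blast
    show "ww i \<in> mspace (LB i)" if "i \<in> I" for i
      using Jmem(3)[OF I[OF that]] by (simp add: ww_def)
    show "inj_on (\<lambda>i. (LA i, LB i, ff i, vv i)) I"
      by (auto simp: inj_on_def defs prod_eq_iff)
    show "LA i = LA j" if "i \<in> I" "j \<in> I" "module_iso V (LA i) (LA j)" for i j
      using ineq1[OF I(1) I(1)] that by blast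
    show "LB i = LB j" if "i \<in> I" "j \<in> I" "module_iso V (LB i) (LB j)" for i j
      using ineq2[OF I(2) I(2)] that by blast
    show "voa V" "lmod V L3" "i \<in> I" by (fact V L3(2) i)+
    show "(\<Sum>i\<in>I. ff i (vv i) k (ww i)) = 0" for k by (rule sumI)
    show "irreducible_module V (LA i)" "irreducible_module V (LB i)" if "i \<in> I" for i
      using irr1[OF I(1)[OF that]] irr2[OF I(2)[OF that]] by auto
  qed
  have L: "L1 \<in> fmods F1" "L2 \<in> fmods F2" using True by auto
  have "X (L1, L2, L3) = (\<Sum>p\<in>J L1 L2. fus_tens V (L1, L2, L3) (fst p) (snd p) (w L1 L2 p))"
    using Jw[OF L] by blast
  also have "\<dots> = 0"
  proof (rule sum.neutral, rule ballI)
    fix p assume p: "p \<in> J L1 L2"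
    have "((L1, L2), p) \<in> I" using L p by (simp add: I_def)
    from ww0[OF this] have w0: "w L1 L2 p = 0" by (simp add: ww_def defs)
    have "linear_on (mspace L2) (fus_tens V (L1, L2, L3) (fst p) (snd p))"
      using fus_tens_trilinear[of V L1 L2 L3] Jmem(4,5)[OF L p] by (simp add: trilinear_on_def)
    then show "fus_tens V (L1, L2, L3) (fst p) (snd p) (w L1 L2 p) = 0"
      unfolding w0 by (rule linear_on_0[OF lmodD(1)[OF lm2[OF L(2)]]])
  qed
  finally show ?thesis .
qed

subsection \<open>Stable families\<close>

lemma module_iso_sym:
  assumes sub: "cvec.subspace (mspace M)"
    and closed: "\<And>u n w. u \<in> vspace V \<Longrightarrow> w \<in> mspace M \<Longrightarrow> mop M u n w \<in> mspace M"
    and iso: "module_iso V M N"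
  shows "module_iso V N M"
proof -
  obtain \<psi> where \<psi>: "linear_on (mspace M) \<psi>" "bij_betw \<psi> (mspace M) (mspace N)"
    "\<forall>u\<in>vspace V. \<forall>n. \<forall>w\<in>mspace M. \<psi> (mop M u n w) = mop N u n (\<psi> w)"
    using iso by (auto simp: module_iso_def)
  let ?i = "inv_into (mspace M) \<psi>"
  have "?i (mop N u n x) = mop M u n (?i x)" if u: "u \<in> vspace V" and x: "x \<in> mspace N" for u n x
  proof -
    have y: "?i x \<in> mspace M" "\<psi> (?i x) = x"
      using x \<psi>(2) by (auto simp: bij_betw_def inv_into_into f_inv_into_f)
    have "\<psi> (mop M u n (?i x)) = mop N u n x" using \<psi>(3) u y by simp
    then show ?thesis
      using inv_into_f_f[OF _ closed[OF u y(1)], of \<psi> n] \<psi>(2) by (simp add: bij_betw_def)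
  qed
  moreover have "linear_on (mspace N) ?i" by (rule linear_on_inv_into[OF sub \<psi>(1,2)])
  moreover have "bij_betw ?i (mspace N) (mspace M)" by (rule bij_betw_inv_into[OF \<psi>(2)])
  ultimately show ?thesis unfolding module_iso_def by blast
qed

lemma module_iso_trans:
  assumes "module_iso V M N" "module_iso V N K"
  shows "module_iso V M K"
proof -
  obtain \<psi> where \<psi>: "linear_on (mspace M) \<psi>" "bij_betw \<psi> (mspace M) (mspace N)"
    "\<forall>u\<in>vspace V. \<forall>n. \<forall>w\<in>mspace M. \<psi> (mop M u n w) = mop N u n (\<psi> w)"
    using assms(1) by (auto simp: module_iso_def)
  obtain \<chi> where \<chi>: "linear_on (mspace N) \<chi>" "bij_betw \<chi> (mspace N) (mspace K)"
    "\<forall>u\<in>vspace V. \<forall>n. \<forall>w\<in>mspace N. \<chi> (mop N u n w) = mop K u n (\<chi> w)"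
    using assms(2) by (auto simp: module_iso_def)
  have im: "\<psi> ` mspace M = mspace N" using \<psi>(2) by (simp add: bij_betw_def)
  have "linear_on (mspace M) (\<lambda>w. \<chi> (\<psi> w))"
    using im by (intro linear_on_compose[OF \<psi>(1) _ \<chi>(1)]) simp
  moreover have "bij_betw (\<lambda>w. \<chi> (\<psi> w)) (mspace M) (mspace K)"
    using bij_betw_trans[OF \<psi>(2) \<chi>(2)] by (simp add: o_def)
  moreover have "\<chi> (\<psi> (mop M u n w)) = mop K u n (\<chi> (\<psi> w))" if "u \<in> vspace V" "w \<in> mspace M" for u n w
    using \<psi>(3) \<chi>(3) that im by (metis imageI)
  ultimately show ?thesis unfolding module_iso_def by blast
qed

lemma linear_on_coefficient: "linear_on X (\<lambda>x. x q *\<^sub>C (z :: 'c::complex_vector))"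
  by (simp add: linear_on_def scaleC_add_left scaleC_scaleC scaleC_fun_def[where ?'b = complex]
      scaleC_complex_def)

locale stable_family =
  fixes V :: "'v::complex_vector voa" and G :: "('v \<Rightarrow> 'v) set"
    and F :: "('v, 'm::complex_vector, 'j, 'u::complex_vector) gfamily"
  assumes V: "voa V" and finite_G: "finite G" and subgroup_G: "subgroup G (BijGroup (vspace V))"
    and G_aut: "G \<subseteq> voa_aut V" and F: "gfamily V G F"
begin

abbreviation mul (infixl "\<bullet>" 70) where "a \<bullet> b \<equiv> gmul V a b"
abbreviation one where "one \<equiv> \<one>\<^bsub>BijGroup (vspace V)\<^esub>"
abbreviation dot where "dot L a \<equiv> mdot V (fmods F) L a"
text \<open>The target of \<open>\<phi> a L\<close>. The inverse turns the right action on
  isomorphism classes into a left action, see \<open>move_move\<close>.\<close>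

abbreviation move where "move a L \<equiv> mdot V (fmods F) L (ginv V a)"
abbreviation \<phi> where "\<phi> \<equiv> fphi F"

lemma group_Bij: "group (BijGroup (vspace V))" by (rule group_BijGroup)

lemma G_Bij: "a \<in> G \<Longrightarrow> a \<in> Bij (vspace V)" and G_carrier: "a \<in> G \<Longrightarrow> a \<in> carrier (BijGroup (vspace V))"
  using subgroup.subset[OF subgroup_G] by (auto simp: BijGroup_def)

lemma G_mul [intro, simp]: "a \<in> G \<Longrightarrow> b \<in> G \<Longrightarrow> a \<bullet> b \<in> G"
  and G_inv [intro, simp]: "a \<in> G \<Longrightarrow> ginv V a \<in> G"
  and G_one [intro, simp]: "one \<in> G"
  using subgroup.m_closed[OF subgroup_G] subgroup.m_inv_closed[OF subgroup_G]
    subgroup.one_closed[OF subgroup_G] by auto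

lemma G_apply_mem: "a \<in> G \<Longrightarrow> v \<in> vspace V \<Longrightarrow> a v \<in> vspace V"
  using G_Bij by (auto simp: Bij_def bij_betw_def)

lemma mul_apply: "a \<in> G \<Longrightarrow> b \<in> G \<Longrightarrow> v \<in> vspace V \<Longrightarrow> (a \<bullet> b) v = a (b v)"
  using G_Bij by (simp add: BijGroup_def compose_def)

lemma one_apply: "v \<in> vspace V \<Longrightarrow> one v = v"
  by (simp add: BijGroup_def)

lemma inv_mul: "a \<in> G \<Longrightarrow> ginv V a \<bullet> a = one" "a \<in> G \<Longrightarrow> a \<bullet> ginv V a = one"
  using group.l_inv[OF group_Bij] group.r_inv[OF group_Bij] G_carrier by auto

lemma mul_one: "a \<in> G \<Longrightarrow> one \<bullet> a = a" "a \<in> G \<Longrightarrow> a \<bullet> one = a"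
  using monoid.l_one[OF group.is_monoid[OF group_Bij]] monoid.r_one[OF group.is_monoid[OF group_Bij]] G_carrier
  by auto

lemma mul_assoc: "a \<in> G \<Longrightarrow> b \<in> G \<Longrightarrow> c \<in> G \<Longrightarrow> a \<bullet> b \<bullet> c = a \<bullet> (b \<bullet> c)"
  using group.is_monoid[OF group_Bij, THEN monoid.m_assoc] G_carrier by auto

lemma inv_inv: "a \<in> G \<Longrightarrow> ginv V (ginv V a) = a"
  using group.inv_inv[OF group_Bij] G_carrier by auto

lemma inv_one: "ginv V one = one"
  using monoid.inv_one[OF group.is_monoid[OF group_Bij]] .

lemma inv_apply: "a \<in> G \<Longrightarrow> v \<in> vspace V \<Longrightarrow> a (ginv V a v) = v"
  using mul_apply[of a "ginv V a" v] by (simp add: inv_mul one_apply)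

lemma finite_fmods: "finite (fmods F)"
  and irr: "L \<in> fmods F \<Longrightarrow> irreducible_module V L"
  and ineq: "L \<in> fmods F \<Longrightarrow> M \<in> fmods F \<Longrightarrow> module_iso V L M \<Longrightarrow> L = M"
  and stable: "g_stable V G (fmods F)"
  and phi_lin: "a \<in> G \<Longrightarrow> L \<in> fmods F \<Longrightarrow> linear_on (mspace L) (\<phi> a L)"
  and phi_bij: "a \<in> G \<Longrightarrow> L \<in> fmods F \<Longrightarrow> bij_betw (\<phi> a L) (mspace L) (mspace (move a L))"
  and phi_hom: "a \<in> G \<Longrightarrow> L \<in> fmods F \<Longrightarrow> v \<in> vspace V \<Longrightarrow> w \<in> mspace L \<Longrightarrow>
    \<phi> a L (mop L v n w) = mop (move a L) (a v) n (\<phi> a L w)"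
  and rep_mem: "j \<in> fidx F \<Longrightarrow> frep F j \<in> fmods F"
  using F unfolding gfamily_def by (auto split: prod.splits)

lemma rep_simple:
  "\<gamma> \<in> Gamma V G F \<Longrightarrow> simple_module (S_alg V G (frep F (fst \<gamma>))) (alg_mult V G F) (fsimp F \<gamma>)"
  using F unfolding gfamily_def by (cases \<gamma>) fastforce

lemma lm: "L \<in> fmods F \<Longrightarrow> lmod V L"
  by (rule irreducible_lmod[OF irr])

lemma phi_mem: "a \<in> G \<Longrightarrow> L \<in> fmods F \<Longrightarrow> w \<in> mspace L \<Longrightarrow> \<phi> a L w \<in> mspace (move a L)"
  using phi_bij[of a L] by (auto simp: bij_betw_def)

lemma phi_0: "a \<in> G \<Longrightarrow> L \<in> fmods F \<Longrightarrow> \<phi> a L 0 = 0"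
  using linear_on_0[OF lmodD(1)[OF lm] phi_lin] by blast

lemma phi_eq_0: "a \<in> G \<Longrightarrow> L \<in> fmods F \<Longrightarrow> w \<in> mspace L \<Longrightarrow> \<phi> a L w = 0 \<Longrightarrow> w = 0"
  using phi_bij[of a L] phi_0[of a L] cvec.subspace_0[OF lmodD(1)[OF lm[of L]]] inj_onD[of "\<phi> a L" "mspace L" w 0]
  by (simp add: bij_betw_def)

lemma dot_unique:
  assumes L: "L \<in> fmods F" and a: "a \<in> G" and M: "M \<in> fmods F" "module_iso V (mcirc L a) M"
  shows "dot L a = M"
  unfolding mdot_def
proof (rule the_equality)
  show "M \<in> fmods F \<and> module_iso V (mcirc L a) M" using M by blast
  fix N assume N: "N \<in> fmods F \<and> module_iso V (mcirc L a) N"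
  have "module_iso V N (mcirc L a)"
    using N lmodD(1,3)[OF lm[OF L]] G_apply_mem[OF a]
    by (intro module_iso_sym[of "mcirc L a"]) (auto simp: mcirc_def)
  then show "N = M" using module_iso_trans[OF _ M(2)] ineq N M(1) by blast
qed

lemma dot_mem: "L \<in> fmods F \<Longrightarrow> a \<in> G \<Longrightarrow> dot L a \<in> fmods F"
  and dot_iso: "L \<in> fmods F \<Longrightarrow> a \<in> G \<Longrightarrow> module_iso V (mcirc L a) (dot L a)"
  using stable dot_unique unfolding g_stable_def by metis+

lemma move_mem [simp, intro]: "L \<in> fmods F \<Longrightarrow> a \<in> G \<Longrightarrow> move a L \<in> fmods F"
  by (simp add: dot_mem)

text \<open>A map twisted by \<open>a\<close> is, after substituting a^-1 u for u, an isomorphism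
  from L \<circ> a^-1 to \<open>M\<close>.\<close>

lemma moveI:
  assumes L: "L \<in> fmods F" and M: "M \<in> fmods F" and a: "a \<in> G"
    and \<psi>: "linear_on (mspace L) \<psi>" "bij_betw \<psi> (mspace L) (mspace M)"
      "\<And>v n w. v \<in> vspace V \<Longrightarrow> w \<in> mspace L \<Longrightarrow> \<psi> (mop L v n w) = mop M (a v) n (\<psi> w)"
  shows "move a L = M"
proof (rule dot_unique[OF L G_inv[OF a] M])
  have "\<psi> (mop L (ginv V a u) n w) = mop M u n (\<psi> w)" if "u \<in> vspace V" "w \<in> mspace L" for u n w
    using \<psi>(3)[OF G_apply_mem[OF G_inv[OF a] that(1)] that(2)] inv_apply[OF a that(1)] by simp
  then show "module_iso V (mcirc L (ginv V a)) M"
    unfolding module_iso_def using \<psi>(1,2) by (intro exI[of _ \<psi>]) (simp add: mcirc_def)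
qed

lemma move_one: "L \<in> fmods F \<Longrightarrow> move one L = L"
  by (rule moveI[of _ _ _ "\<lambda>x. x"]) (auto simp: linear_on_id one_apply bij_betw_def inj_on_def)

lemma phi_phi_lin:
  assumes "L \<in> fmods F" "a \<in> G" "b \<in> G"
  shows "linear_on (mspace L) (\<lambda>w. \<phi> b (move a L) (\<phi> a L w))"
  using phi_mem[OF assms(2,1)] assms
  by (intro linear_on_compose[OF phi_lin _ phi_lin]) auto

lemma phi_phi_hom:
  assumes "L \<in> fmods F" "a \<in> G" "b \<in> G" "v \<in> vspace V" "w \<in> mspace L"
  shows "\<phi> b (move a L) (\<phi> a L (mop L v n w)) =
    mop (move b (move a L)) ((b \<bullet> a) v) n (\<phi> b (move a L) (\<phi> a L w))"
  using assms by (simp add: phi_hom G_apply_mem phi_mem mul_apply)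

text \<open>The composite of \<phi>(a) and \<phi>(b) is itself twisted by
  \<open>b \<bullet> a\<close>, so \<open>moveI\<close> identifies its target.\<close>

lemma move_move:
  assumes L: "L \<in> fmods F" and a: "a \<in> G" and b: "b \<in> G"
  shows "move b (move a L) = move (b \<bullet> a) L"
proof (rule moveI[symmetric, OF L _ G_mul[OF b a] phi_phi_lin[OF L a b]])
  show "bij_betw (\<lambda>w. \<phi> b (move a L) (\<phi> a L w)) (mspace L) (mspace (move b (move a L)))"
    using bij_betw_trans[OF phi_bij[OF a L] phi_bij[OF b move_mem[OF L a]]] by (simp add: o_def)
qed (use assms phi_phi_hom in auto)

text \<open>Justifies the definite description in \<open>alpha\<close>. Schur's lemma applies to the
  composite \<phi>(b) \<phi>(a) followed after the inverse of \<phi>(ba), an endomorphism of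
  \<open>move (b \<bullet> a) L\<close>; a nonzero vector fixes the scalar.\<close>

lemma alpha_unique:
  assumes L: "L \<in> fmods F" and a: "a \<in> G" and b: "b \<in> G"
  shows "\<exists>!c. \<forall>w\<in>mspace L. \<phi> b (move a L) (\<phi> a L w) = c *\<^sub>C \<phi> (b \<bullet> a) L w"
proof -
  let ?M = "move (b \<bullet> a) L"
  have ba: "b \<bullet> a \<in> G" and M: "?M \<in> fmods F" using assms by auto
  let ?p = "\<phi> (b \<bullet> a) L" and ?q = "\<lambda>w. \<phi> b (move a L) (\<phi> a L w)"
  let ?i = "inv_into (mspace L) ?p"
  note bij = phi_bij[OF ba L]
  have i: "?i x \<in> mspace L" "?p (?i x) = x" if "x \<in> mspace ?M" for x
    using that bij by (auto simp: bij_betw_def inv_into_into f_inv_into_f)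
  have ip: "?i (?p w) = w" if "w \<in> mspace L" for w
    using that bij by (auto simp: bij_betw_def)
  have ilin: "linear_on (mspace ?M) ?i" by (rule linear_on_inv_into[OF lmodD(1)[OF lm[OF L]] phi_lin[OF ba L] bij])
  have qM: "?q w \<in> mspace ?M" if "w \<in> mspace L" for w
    using phi_mem[OF b move_mem[OF L a] phi_mem[OF a L that]] move_move[OF L a b] by simp
  obtain c where c: "\<And>x. x \<in> mspace ?M \<Longrightarrow> ?q (?i x) = c *\<^sub>C x"
  proof (rule Schur_scalar[OF V irr[OF M]])
    show "linear_on (mspace ?M) (\<lambda>x. ?q (?i x))"
      using i by (intro linear_on_compose[OF ilin _ phi_phi_lin[OF L a b]]) auto
    show "(\<lambda>x. ?q (?i x)) ` mspace ?M \<subseteq> mspace ?M" using qM i by blast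
    show "?q (?i (mop ?M u n x)) = mop ?M u n (?q (?i x))" if u: "u \<in> vspace V" and x: "x \<in> mspace ?M" for u n x
    proof -
      define v where "v = ginv V (b \<bullet> a) u"
      have v: "v \<in> vspace V" "(b \<bullet> a) v = u"
        using G_apply_mem[OF G_inv[OF ba] u] inv_apply[OF ba u] by (simp_all add: v_def)
      have "mop ?M u n x = ?p (mop L v n (?i x))" using phi_hom[OF ba L v(1) i(1)[OF x]] i(2)[OF x] v(2) by simp
      then have "?i (mop ?M u n x) = mop L v n (?i x)" using ip lmodD(3)[OF lm[OF L] v(1) i(1)[OF x]] by simp
      then show ?thesis using phi_phi_hom[OF L a b v(1) i(1)[OF x]] v(2) move_move[OF L a b] by simp
    qed
  qed blast
  have "?q w = c *\<^sub>C ?p w" if "w \<in> mspace L" for w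
    using c[OF phi_mem[OF ba L that]] ip[OF that] by simp
  moreover have "d = c" if d: "\<forall>w\<in>mspace L. ?q w = d *\<^sub>C ?p w" for d
  proof -
    obtain w where w: "w \<in> mspace L" "w \<noteq> 0" using irreducible_nonzero[OF irr[OF L]] by blast
    have "d *\<^sub>C ?p w = c *\<^sub>C ?p w" using d w(1) calculation by metis
    moreover have "?p w \<noteq> 0" using phi_eq_0[OF ba L w(1)] w(2) by blast
    ultimately show ?thesis by simp
  qed
  ultimately show ?thesis by (intro ex1I[of _ c]) auto
qed

lemma alpha:
  assumes "L \<in> fmods F" "a \<in> G" "b \<in> G" "w \<in> mspace L"
  shows "\<phi> b (move a L) (\<phi> a L w) = alpha V F L b a *\<^sub>C \<phi> (b \<bullet> a) L w"
  using theI'[OF alpha_unique[OF assms(1-3)]] assms(4) unfolding alpha_def by blast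

lemma alpha_nonzero:
  assumes L: "L \<in> fmods F" and a: "a \<in> G" and b: "b \<in> G"
  shows "alpha V F L b a \<noteq> 0"
proof
  assume 0: "alpha V F L b a = 0"
  obtain w where w: "w \<in> mspace L" "w \<noteq> 0" using irreducible_nonzero[OF irr[OF L]] by blast
  have "\<phi> b (move a L) (\<phi> a L w) = 0" using alpha[OF L a b w(1)] 0 by simp
  then have "\<phi> a L w = 0" using phi_eq_0[OF b move_mem[OF L a] phi_mem[OF a L w(1)]] by blast
  then show False using phi_eq_0[OF a L w(1)] w(2) by blast
qed

lemma alphaI:
  assumes L: "L \<in> fmods F" and a: "a \<in> G" and b: "b \<in> G"
    and "\<And>w. w \<in> mspace L \<Longrightarrow> \<phi> b (move a L) (\<phi> a L w) = c *\<^sub>C \<phi> (b \<bullet> a) L w"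
  shows "alpha V F L b a = c"
  using alpha_unique[OF L a b] alpha[OF L a b] assms(4) by blast

text \<open>Both sides compare \<phi>(a) \<phi>(b) \<phi>(c) with \<phi>(abc), for the two ways of
  bracketing the composite.\<close>

lemma alpha_cocycle:
  assumes L: "L \<in> fmods F" and a: "a \<in> G" and b: "b \<in> G" and c: "c \<in> G"
  shows "alpha V F (move c L) a b * alpha V F L (a \<bullet> b) c = alpha V F L b c * alpha V F L a (b \<bullet> c)"
proof -
  obtain w where w: "w \<in> mspace L" "w \<noteq> 0" using irreducible_nonzero[OF irr[OF L]] by blast
  let ?x = "\<phi> a (move b (move c L)) (\<phi> b (move c L) (\<phi> c L w))"
  let ?y = "\<phi> (a \<bullet> b \<bullet> c) L w"
  have mem: "\<phi> (b \<bullet> c) L w \<in> mspace (move (b \<bullet> c) L)" "\<phi> c L w \<in> mspace (move c L)"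
    using assms w by (auto intro: phi_mem)
  have "?x = alpha V F (move c L) a b *\<^sub>C \<phi> (a \<bullet> b) (move c L) (\<phi> c L w)"
    using alpha[OF move_mem[OF L c] b a mem(2)] .
  also have "\<dots> = (alpha V F (move c L) a b * alpha V F L (a \<bullet> b) c) *\<^sub>C ?y"
    using alpha[OF L c G_mul[OF a b] w(1)] by (simp add: scaleC_scaleC)
  finally have 1: "?x = (alpha V F (move c L) a b * alpha V F L (a \<bullet> b) c) *\<^sub>C ?y" .
  have "?x = \<phi> a (move (b \<bullet> c) L) (alpha V F L b c *\<^sub>C \<phi> (b \<bullet> c) L w)"
    using alpha[OF L c b w(1)] move_move[OF L c b] by simp
  also have "\<dots> = alpha V F L b c *\<^sub>C \<phi> a (move (b \<bullet> c) L) (\<phi> (b \<bullet> c) L w)"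
    using linear_on_scale[OF phi_lin[OF a move_mem[OF L G_mul[OF b c]]] mem(1)] .
  also have "\<dots> = (alpha V F L b c * alpha V F L a (b \<bullet> c)) *\<^sub>C ?y"
    using alpha[OF L G_mul[OF b c] a w(1)] mul_assoc[OF a b c] by (simp add: scaleC_scaleC)
  finally have 2: "?x = (alpha V F L b c * alpha V F L a (b \<bullet> c)) *\<^sub>C ?y" .
  have "?y \<noteq> 0" using phi_eq_0[OF _ L w(1), of "a \<bullet> b \<bullet> c"] assms w(2) by blast
  then show ?thesis using 1 2 by simp
qed

text \<open>The product of the algebra tests L . a, while the maps \<phi> lead to L . a^-1; both
  forms of stability are used.\<close>

lemma stabilizer_iff:
  assumes L: "L \<in> fmods F"
  shows "a \<in> stabilizer V G L \<longleftrightarrow> a \<in> G \<and> move a L = L"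
    and "a \<in> stabilizer V G L \<longleftrightarrow> a \<in> G \<and> dot L a = L"
proof -
  show 1: "a \<in> stabilizer V G L \<longleftrightarrow> a \<in> G \<and> dot L a = L"
    using dot_unique[OF L _ L] dot_iso[OF L] unfolding stabilizer_def by fastforce
  have "dot L a = L \<longleftrightarrow> move a L = L" if a: "a \<in> G"
  proof
    assume "dot L a = L"
    then have "move (ginv V a) L = L" using inv_inv[OF a] by simp
    then show "move a L = L" using move_move[OF L G_inv[OF a] a] inv_mul(2)[OF a] move_one[OF L] by simp
  next
    assume "move a L = L"
    then have "move (ginv V a) L = L"
      using move_move[OF L a G_inv[OF a]] inv_mul(1)[OF a] move_one[OF L] by simp
    then show "dot L a = L" using inv_inv[OF a] by simp
  qed
  with 1 show "a \<in> stabilizer V G L \<longleftrightarrow> a \<in> G \<and> move a L = L" by blast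
qed

lemma one_stabilizer: "L \<in> fmods F \<Longrightarrow> one \<in> stabilizer V G L"
  by (simp add: stabilizer_iff(1) move_one)

lemma sum_gbasis:
  fixes h :: "_ \<Rightarrow> 'c::complex_vector"
  assumes "a \<in> G" "L \<in> fmods F"
  shows "(\<Sum>p\<in>G \<times> fmods F. gbasis a L p *\<^sub>C h p) = h (a, L)"
proof -
  have "(\<Sum>p\<in>G \<times> fmods F. gbasis a L p *\<^sub>C h p) = (\<Sum>p\<in>G \<times> fmods F. if p = (a, L) then h (a, L) else 0)"
    by (intro sum.cong) (auto simp: gbasis_def)
  then show ?thesis using assms finite_G finite_fmods by simp
qed

lemma alg_mult_eq:
  "alg_mult V G F x y = (\<Sum>p\<in>G \<times> fmods F. x p *\<^sub>C (\<Sum>q\<in>G \<times> fmods F. y q *\<^sub>C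
     (if dot (snd p) (fst q) = snd q then alpha V F (snd q) (fst p) (fst q) *\<^sub>C gbasis (fst p \<bullet> fst q) (snd q) else 0)))"
  unfolding alg_mult_def case_prod_beta
  by (simp add: cvec.scale_sum_right scaleC_scaleC)

lemma alg_mult_gbasis:
  assumes "a \<in> G" "L \<in> fmods F" "b \<in> G" "M \<in> fmods F"
  shows "alg_mult V G F (gbasis a L) (gbasis b M) =
    (if dot L b = M then alpha V F M a b *\<^sub>C gbasis (a \<bullet> b) M else 0)"
  unfolding alg_mult_eq sum_gbasis[OF assms(1,2)] sum_gbasis[OF assms(3,4)] by simp

lemma alg_mult_linear1: "linear_on X (\<lambda>x. alg_mult V G F x y)"
  unfolding alg_mult_eq by (intro linear_on_sum_fun linear_on_coefficient)

lemma alg_mult_linear2: "linear_on X (alg_mult V G F x)"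
  unfolding alg_mult_eq[abs_def]
  by (intro linear_on_sum_fun linear_on_scale_fun linear_on_coefficient)

lemma L_act_eq:
  "L_act V G F x w = (\<Sum>p\<in>G \<times> fmods F. x p *\<^sub>C dsum_in (move (fst p) (snd p)) (\<phi> (fst p) (snd p) (w (snd p))))"
  by (simp add: L_act_def case_prod_beta)

lemma L_act_gbasis:
  assumes "a \<in> G" "L \<in> fmods F"
  shows "L_act V G F (gbasis a L) w = dsum_in (move a L) (\<phi> a L (w L))"
  unfolding L_act_eq sum_gbasis[OF assms] by simp

lemma L_act_linear1: "linear_on X (\<lambda>x. L_act V G F x w)"
  unfolding L_act_eq by (intro linear_on_sum_fun linear_on_coefficient)

end

lemma bilinear_on_span_eq:
  assumes f: "bilinear_on (cvec.span A) (cvec.span B) f" and g: "bilinear_on (cvec.span A) (cvec.span B) g"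
    and eq: "\<And>a b. a \<in> A \<Longrightarrow> b \<in> B \<Longrightarrow> f a b = g a b"
    and x: "x \<in> cvec.span A" and y: "y \<in> cvec.span B"
  shows "f x y = g x y"
proof (rule linear_on_span_eq[OF bilinear_onD(2)[OF f y] bilinear_onD(2)[OF g y] _ x])
  fix a assume a: "a \<in> A"
  then have "a \<in> cvec.span A" by (rule cvec.span_base)
  from linear_on_span_eq[OF bilinear_onD(1)[OF f this] bilinear_onD(1)[OF g this] eq[OF a] y]
  show "f a y = g a y" .
qed

lemma dsum_in_linear: "linear_on X (dsum_in i)"
  by (auto simp: linear_on_def dsum_in_def fun_eq_iff scaleC_fun_def)

section \<open>The modules U, W and M attached to one pair in Gamma\<close>

locale stable_family_rep = stable_family V G F
  for V :: "'v::complex_vector voa" and G :: "('v \<Rightarrow> 'v) set"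
    and F :: "('v, 'm::complex_vector, 'j, 'u::complex_vector) gfamily" +
  fixes \<gamma> :: "'j \<times> (('v, 'm) galg \<Rightarrow> complex)"
  assumes \<gamma>: "\<gamma> \<in> Gamma V G F"
begin

abbreviation L0 where "L0 \<equiv> frep F (fst \<gamma>)"
abbreviation U where "U \<equiv> aspace (fsimp F \<gamma>)"
abbreviation act where "act \<equiv> aact (fsimp F \<gamma>)"
abbreviation stab where "stab \<equiv> stabilizer V G L0"
abbreviation S0 where "S0 \<equiv> S_alg V G L0"
abbreviation D0 where "D0 \<equiv> D_space G L0"
abbreviation M0 where "M0 \<equiv> M_module V G F \<gamma>"
abbreviation mult (infixl "\<star>" 70) where "x \<star> y \<equiv> alg_mult V G F x y"
abbreviation gb where "gb a \<equiv> gbasis a L0"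
abbreviation wt where "wt \<equiv> W_tens V G F \<gamma>"

lemma L0: "L0 \<in> fmods F"
  using \<gamma> rep_mem by (auto simp: Gamma_def)

lemma stabD: "a \<in> stab \<Longrightarrow> a \<in> G" "a \<in> stab \<Longrightarrow> move a L0 = L0" "a \<in> stab \<Longrightarrow> dot L0 a = L0"
  using stabilizer_iff[OF L0] by blast+

lemma S0_eq: "S0 = cvec.span (gb ` stab)"
  unfolding S_alg_def by (rule arg_cong[where f = cvec.span]) auto

lemma D0_eq: "D0 = cvec.span (gb ` G)"
  unfolding D_space_def by (rule arg_cong[where f = cvec.span]) auto

lemma gb_S0: "a \<in> stab \<Longrightarrow> gb a \<in> S0" and gb_D0: "a \<in> G \<Longrightarrow> gb a \<in> D0"
  unfolding S0_eq D0_eq by (auto intro: cvec.span_base)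

lemma U_sub: "cvec.subspace U"
  and act_bilinear: "bilinear_on S0 U act"
  and act_mem: "s \<in> S0 \<Longrightarrow> u \<in> U \<Longrightarrow> act s u \<in> U"
  and U_nonzero: "U \<noteq> {0}"
  and U_min: "cvec.subspace X \<Longrightarrow> X \<subseteq> U \<Longrightarrow> (\<forall>s\<in>S0. \<forall>u\<in>X. act s u \<in> X) \<Longrightarrow> X = {0} \<or> X = U"
  using rep_simple[OF \<gamma>] by (auto simp: simple_module_def unital_module_def)

lemma ex_U: "\<exists>u. u \<in> U \<and> u \<noteq> 0"
  using U_nonzero cvec.subspace_0[OF U_sub] by blast

lemma U_eqI:
  assumes X: "cvec.subspace X" "X \<subseteq> U" and st: "\<And>a u. a \<in> stab \<Longrightarrow> u \<in> X \<Longrightarrow> act (gb a) u \<in> X"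
    and x: "x \<in> X" "x \<noteq> 0"
  shows "X = U"
proof -
  have "act s u \<in> X" if s: "s \<in> S0" and u: "u \<in> X" for s u
  proof (rule linear_on_span_mem[OF X(1) _ _ s[unfolded S0_eq]])
    show "linear_on (cvec.span (gb ` stab)) (\<lambda>s. act s u)"
      using bilinear_onD(2)[OF act_bilinear, of u] u X(2) unfolding S0_eq by blast
  qed (use st u in blast)
  then show ?thesis using U_min[OF X] x by blast
qed

lemma L_act_gb:
  "a \<in> G \<Longrightarrow> L_act V G F (gb a) (dsum_in L0 w) = dsum_in (move a L0) (\<phi> a L0 w)"
  by (simp add: L_act_gbasis L0 dsum_in_def)

lemma L_act_stab:
  "a \<in> stab \<Longrightarrow> L_act V G F (gb a) (dsum_in L0 w) L0 = \<phi> a L0 w"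
  using L_act_gb[of a w] stabD by (simp add: dsum_in_def)

lemma M0_mspace: "mspace M0 = hom_space S0 U act (mspace L0) (\<lambda>s w. L_act V G F s (dsum_in L0 w) L0)"
  by (simp add: M_module_def Let_def)

lemma M0_mop: "mop M0 v n h = (\<lambda>u. mop L0 v n (h u))"
  by (simp add: M_module_def Let_def)

lemma M0_D:
  assumes "h \<in> mspace M0"
  shows "linear_on U h" "u \<in> U \<Longrightarrow> h u \<in> mspace L0" "u \<notin> U \<Longrightarrow> h u = 0" "h u \<in> mspace L0"
    and "a \<in> stab \<Longrightarrow> u \<in> U \<Longrightarrow> h (act (gb a) u) = \<phi> a L0 (h u)"
proof -
  have *: "linear_on U h" "h ` U \<subseteq> mspace L0" "\<forall>u. u \<notin> U \<longrightarrow> h u = 0"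
    "\<forall>s\<in>S0. \<forall>u\<in>U. h (act s u) = L_act V G F s (dsum_in L0 (h u)) L0"
    using assms unfolding M0_mspace hom_space_def by blast+
  show "linear_on U h" "u \<in> U \<Longrightarrow> h u \<in> mspace L0" "u \<notin> U \<Longrightarrow> h u = 0" using * by blast+
  show "h u \<in> mspace L0"
    using * cvec.subspace_0[OF lmodD(1)[OF lm[OF L0]]] by (cases "u \<in> U") auto
  show "h (act (gb a) u) = \<phi> a L0 (h u)" if "a \<in> stab" "u \<in> U"
    using *(4) gb_S0[OF that(1)] that L_act_stab by simp
qed

lemma M0_I:
  assumes h: "linear_on U h" "\<And>u. u \<in> U \<Longrightarrow> h u \<in> mspace L0" "\<And>u. u \<notin> U \<Longrightarrow> h u = 0"
    and eq: "\<And>a u. a \<in> stab \<Longrightarrow> u \<in> U \<Longrightarrow> h (act (gb a) u) = \<phi> a L0 (h u)"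
  shows "h \<in> mspace M0"
proof -
  have "h (act s u) = L_act V G F s (dsum_in L0 (h u)) L0" if s: "s \<in> S0" and u: "u \<in> U" for s u
  proof (rule linear_on_span_eq[of "gb ` stab"])
    show "linear_on (cvec.span (gb ` stab)) (\<lambda>s. h (act s u))"
      unfolding S0_eq[symmetric] using act_mem u
      by (intro linear_on_compose[OF bilinear_onD(2)[OF act_bilinear] _ h(1)]) auto
    show "linear_on (cvec.span (gb ` stab)) (\<lambda>s. L_act V G F s (dsum_in L0 (h u)) L0)"
      by (rule linear_on_eval[OF L_act_linear1])
    show "s \<in> cvec.span (gb ` stab)" using s unfolding S0_eq .
    fix b assume "b \<in> gb ` stab"
    then show "h (act b u) = L_act V G F b (dsum_in L0 (h u)) L0" using eq L_act_stab u by auto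
  qed
  then show ?thesis using h unfolding M0_mspace hom_space_def by blast
qed

text \<open>The kernel is a submodule of the simple module \<open>U\<close>; it cannot be all of
  \<open>U\<close>, since \<open>h\<close> vanishes off \<open>U\<close> and would be 0.\<close>

lemma M0_inj:
  assumes h: "h \<in> mspace M0" "h \<noteq> 0"
  shows "inj_on h U"
proof (rule linear_on_inj_on[OF U_sub M0_D(1)[OF h(1)]])
  fix u assume u: "u \<in> U" "h u = 0"
  show "u = 0"
  proof (rule ccontr)
    assume "u \<noteq> 0"
    have "{u \<in> U. h u = 0} = U"
    proof (rule U_eqI)
      show "cvec.subspace {u \<in> U. h u = 0}" by (rule subspace_kernel_on[OF U_sub M0_D(1)[OF h(1)]])
      show "act (gb a) x \<in> {u \<in> U. h u = 0}" if "a \<in> stab" "x \<in> {u \<in> U. h u = 0}" for a x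
        using that M0_D(5)[OF h(1)] act_mem gb_S0 phi_0[OF stabD(1) L0] by simp
    qed (use u \<open>u \<noteq> 0\<close> in auto)
    then have "h = 0" using M0_D(3)[OF h(1)] by (auto simp: fun_eq_iff)
    then show False using h(2) by blast
  qed
qed

lemma fixed_vspace: "v \<in> vspace (fixed_voa V G) \<longleftrightarrow> v \<in> vspace V \<and> (\<forall>g\<in>G. g v = v)"
  by (simp add: fixed_voa_def)

lemma fixed_phi:
  assumes "v \<in> vspace (fixed_voa V G)" "a \<in> G" "L \<in> fmods F" "w \<in> mspace L"
  shows "\<phi> a L (mop L v n w) = mop (move a L) v n (\<phi> a L w)"
proof -
  have "v \<in> vspace V" "a v = v" using assms(1,2) unfolding fixed_vspace by blast+
  then show ?thesis using phi_hom[OF assms(2,3) _ assms(4), of v n] by simp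
qed

lemma fixed_act:
  assumes v: "v \<in> vspace (fixed_voa V G)" and h: "h \<in> mspace M0" and a: "a \<in> stab" and u: "u \<in> U"
  shows "mop L0 v n (h (act (gb a) u)) = \<phi> a L0 (mop L0 v n (h u))"
  using M0_D(5)[OF h a u] fixed_phi[OF v stabD(1)[OF a] L0 M0_D(2)[OF h u]] stabD(2)[OF a] by simp

lemma M0_lmod: "lmod (fixed_voa V G) M0"
  unfolding lmod_def
proof (intro conjI ballI allI)
  note l = lm[OF L0]
  show "cvec.subspace (mspace M0)"
  proof (rule cvec.subspaceI)
    show "0 \<in> mspace M0"
      using cvec.subspace_0[OF lmodD(1)[OF l]] phi_0[OF stabD(1) L0]
      by (intro M0_I) (auto simp: linear_on_def)
    show "h + k \<in> mspace M0" if h: "h \<in> mspace M0" and k: "k \<in> mspace M0" for h k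
      using M0_D[OF h] M0_D[OF k] linear_on_add[OF phi_lin[OF stabD(1) L0]]
      by (intro M0_I) (auto intro: linear_on_plus cvec.subspace_add[OF lmodD(1)[OF l]])
    show "c *\<^sub>C h \<in> mspace M0" if h: "h \<in> mspace M0" for c h
      using M0_D[OF h] linear_on_scale[OF phi_lin[OF stabD(1) L0]]
        linear_on_scale_fun[OF M0_D(1)[OF h], of c]
      by (intro M0_I) (auto simp: scaleC_fun_def intro: cvec.subspace_scale[OF lmodD(1)[OF l]])
  qed
  fix v assume v: "v \<in> vspace (fixed_voa V G)"
  then have vV: "v \<in> vspace V" by (simp add: fixed_vspace)
  note lv = lmodD(2)[OF l vV]
  show "linear_on (mspace M0) (mop M0 v n)" for n
    using M0_D(4) linear_on_add[OF lv] linear_on_scale[OF lv]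
    by (auto simp: linear_on_def M0_mop fun_eq_iff scaleC_fun_def)
  fix h assume h: "h \<in> mspace M0"
  show "mop M0 v n h \<in> mspace M0" for n
    unfolding M0_mop
  proof (rule M0_I)
    show "linear_on U (\<lambda>u. mop L0 v n (h u))"
      using M0_D(2)[OF h] by (intro linear_on_compose[OF M0_D(1)[OF h] _ lv]) auto
    show "mop L0 v n (h u) \<in> mspace L0" for u using M0_D(4)[OF h] lmodD(3)[OF l vV] by blast
    show "mop L0 v n (h u) = 0" if "u \<notin> U" for u using M0_D(3)[OF h that] lmodD(5)[OF l vV] by simp
    show "mop L0 v n (h (act (gb a) u)) = \<phi> a L0 (mop L0 v n (h u))" if "a \<in> stab" "u \<in> U" for a u
      by (rule fixed_act[OF v h that])
  qed
  show "\<exists>N. \<forall>n\<ge>N. mop M0 v n h = 0"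
  proof -
    obtain u0 where u0: "u0 \<in> U" "u0 \<noteq> 0" using ex_U by blast
    obtain N where N: "\<forall>n\<ge>N. mop L0 v n (h u0) = 0" using lmodD(4)[OF l vV M0_D(2)[OF h u0(1)]] by blast
    \<comment> \<open>The bound \<open>N\<close> found for a single nonzero \<open>u0\<close> must
      serve every u, because \<open>mop M0 v n h\<close> is a function of u. The vectors for which
      it does form a nonzero submodule of \<open>U\<close>.\<close>
    let ?X = "{u \<in> U. \<forall>n\<ge>N. mop L0 v n (h u) = 0}"
    have lin: "linear_on U (\<lambda>u. mop L0 v n (h u))" for n
      using M0_D(2)[OF h] by (intro linear_on_compose[OF M0_D(1)[OF h] _ lv]) auto
    have "?X = U"
    proof (rule U_eqI)
      show "cvec.subspace ?X"
        using cvec.subspace_0[OF U_sub] linear_on_0[OF U_sub lin] cvec.subspace_add[OF U_sub]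
          cvec.subspace_scale[OF U_sub]
        by (intro cvec.subspaceI) (simp_all add: linear_on_add[OF lin] linear_on_scale[OF lin])
      show "act (gb a) u \<in> ?X" if "a \<in> stab" "u \<in> ?X" for a u
        using that fixed_act[OF v h that(1)] act_mem[OF gb_S0[OF that(1)]] phi_0[OF stabD(1)[OF that(1)] L0]
        by simp
      show "u0 \<in> ?X" using u0 N by simp
    qed (use u0 in auto)
    then have "mop M0 v n h = 0" if "n \<ge> N" for n
      using that M0_D(3)[OF h] lmodD(5)[OF l vV] by (auto simp: M0_mop fun_eq_iff)
    then show ?thesis by blast
  qed
qed

section \<open>The decomposition map and its components in the modules of the orbit\<close>

lemma L_act_linear2:
  "linear_on {w. \<forall>L\<in>fmods F. w L \<in> mspace L} (L_act V G F x)"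
proof -
  have "linear_on {w. \<forall>L\<in>fmods F. w L \<in> mspace L} (\<lambda>w. dsum_in (move (fst p) (snd p)) (\<phi> (fst p) (snd p) (w (snd p))))"
    if p: "p \<in> G \<times> fmods F" for p
  proof -
    have p': "fst p \<in> G" "snd p \<in> fmods F" using p by (simp_all add: mem_Times_iff)
    show ?thesis
      using p'(2) by (intro linear_on_compose[OF linear_on_compose[OF linear_on_coordinate _ phi_lin[OF p']] _ dsum_in_linear[of UNIV]])
        auto
  qed
  then show ?thesis
    unfolding L_act_eq[abs_def] by (intro linear_on_sum_fun linear_on_scale_fun)
qed

lemma dsum_in_mem: "w \<in> mspace L0 \<Longrightarrow> dsum_in L0 w \<in> {w. \<forall>L\<in>fmods F. w L \<in> mspace L}"
  using cvec.subspace_0[OF lmodD(1)[OF lm]] by (auto simp: dsum_in_def)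

text \<open>On basis elements the scalar in the product is the one that relates \<phi>(a) \<phi>(b)
  to \<phi>(ab), and \<open>h\<close> turns the action of b on \<open>U\<close> into
  \<phi>(b).\<close>

lemma decomp_balanced:
  assumes h: "h \<in> mspace M0"
  shows "(\<lambda>x u. L_act V G F x (dsum_in L0 (h u))) \<in> balanced_maps S0 (alg_mult V G F) act D0 U"
proof -
  have lin2: "linear_on U (\<lambda>u. L_act V G F x (dsum_in L0 (h u)))" for x
    using M0_D(2)[OF h] dsum_in_mem
    by (intro linear_on_compose[OF linear_on_compose[OF M0_D(1)[OF h] _ dsum_in_linear[of UNIV]] _ L_act_linear2]) auto
  have "L_act V G F (x \<star> s) (dsum_in L0 (h u)) = L_act V G F x (dsum_in L0 (h (act s u)))"
    if x: "x \<in> D0" and s: "s \<in> S0" and u: "u \<in> U" for x s u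
  proof (rule bilinear_on_span_eq[of "gb ` G" "gb ` stab" _ _ x s])
    show "bilinear_on (cvec.span (gb ` G)) (cvec.span (gb ` stab)) (\<lambda>x s. L_act V G F (x \<star> s) (dsum_in L0 (h u)))"
      unfolding bilinear_on_def
      by (auto intro!: linear_on_compose[OF alg_mult_linear1 subset_UNIV L_act_linear1]
          linear_on_compose[OF alg_mult_linear2 subset_UNIV L_act_linear1])
    show "bilinear_on (cvec.span (gb ` G)) (cvec.span (gb ` stab)) (\<lambda>x s. L_act V G F x (dsum_in L0 (h (act s u))))"
      unfolding bilinear_on_def S0_eq[symmetric]
      using act_mem u
      by (auto intro!: L_act_linear1 linear_on_compose[OF bilinear_onD(2)[OF act_bilinear u] _ lin2])
    show "L_act V G F (a \<star> b) (dsum_in L0 (h u)) = L_act V G F a (dsum_in L0 (h (act b u)))"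
      if ab: "a \<in> gb ` G" "b \<in> gb ` stab" for a b
    proof -
      obtain a' b' where [simp]: "a = gb a'" "b = gb b'" and a': "a' \<in> G" and b': "b' \<in> stab" using ab by blast
      note b'' = stabD[OF b']
      have "L_act V G F (a \<star> b) (dsum_in L0 (h u)) = alpha V F L0 a' b' *\<^sub>C dsum_in (move (a' \<bullet> b') L0) (\<phi> (a' \<bullet> b') L0 (h u))"
        using a' b'' L0 by (simp add: alg_mult_gbasis linear_on_scale[OF L_act_linear1[of UNIV]] L_act_gb)
      also have "\<dots> = dsum_in (move a' L0) (alpha V F L0 a' b' *\<^sub>C \<phi> (a' \<bullet> b') L0 (h u))"
        using move_move[OF L0 b''(1) a'] b''(2) by (simp add: linear_on_scale[OF dsum_in_linear[of UNIV]])
      also have "\<dots> = dsum_in (move a' L0) (\<phi> a' L0 (\<phi> b' L0 (h u)))"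
        using alpha[OF L0 b''(1) a' M0_D(2)[OF h u]] b''(2) by simp
      also have "\<dots> = L_act V G F a (dsum_in L0 (h (act b u)))"
        using L_act_gb[OF a'] M0_D(5)[OF h b' u] by simp
      finally show ?thesis .
    qed
    show "x \<in> cvec.span (gb ` G)" "s \<in> cvec.span (gb ` stab)" using x s by (simp_all add: S0_eq D0_eq)
  qed
  then show ?thesis
    using lin2 L_act_linear1 by (auto simp: balanced_maps_def bilinear_on_def)
qed

lemma decomp_linear: "h \<in> mspace M0 \<Longrightarrow> linear_on (W_space V G F \<gamma>) (\<lambda>w. decomp V G F \<gamma> w h)"
  unfolding decomp_def W_lift_def W_space_def by (rule tensor_lift(1)[OF decomp_balanced])

lemma decomp_wt:
  "h \<in> mspace M0 \<Longrightarrow> x \<in> D0 \<Longrightarrow> u \<in> U \<Longrightarrow> decomp V G F \<gamma> (wt x u) h = L_act V G F x (dsum_in L0 (h u))"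
  unfolding decomp_def W_lift_def W_tens_def by (rule tensor_lift(2)[OF decomp_balanced])

lemma wt_linear1: "u \<in> U \<Longrightarrow> linear_on D0 (\<lambda>x. wt x u)"
  and wt_linear2: "x \<in> D0 \<Longrightarrow> linear_on U (wt x)"
  unfolding W_tens_def by (rule bilinear_onD[OF tens_bilinear], assumption)+

lemma wt_mem: "x \<in> D0 \<Longrightarrow> u \<in> U \<Longrightarrow> wt x u \<in> W_space V G F \<gamma>"
  unfolding W_tens_def W_space_def by (rule tens_mem)

lemma W_space_mapI:
  assumes R: "cvec.subspace R" and g: "linear_on (W_space V G F \<gamma>) g"
    and gen: "\<And>a u. a \<in> G \<Longrightarrow> u \<in> U \<Longrightarrow> g (wt (gb a) u) \<in> R" and w: "w \<in> W_space V G F \<gamma>"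
  shows "g w \<in> R"
proof (rule tensor_space_mapI[OF R g[unfolded W_space_def] _ w[unfolded W_space_def]])
  fix x u assume x: "x \<in> D0" and u: "u \<in> U"
  have "g (wt x u) \<in> R"
  proof (rule linear_on_span_mem[OF R _ _ x[unfolded D0_eq]])
    show "linear_on (cvec.span (gb ` G)) (\<lambda>x. g (wt x u))"
      unfolding D0_eq[symmetric] using wt_mem[OF _ u]
      by (intro linear_on_compose[OF wt_linear1[OF u] _ g]) auto
  qed (use gen u in blast)
  then show "g (tens S0 (alg_mult V G F) act D0 U x u) \<in> R" by (simp add: W_tens_def)
qed

text \<open>Two isomorphisms \<open>\<phi> c L0\<close> and \<open>\<phi> b L0\<close> with the same target differ by an element of the
  stabilizer, which can be absorbed into \<open>U\<close> uniformly in the homomorphism \<open>g\<close>.\<close>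

lemma coset_shift:
  assumes c: "c \<in> G" and b: "b \<in> G" and eq: "move c L0 = move b L0" and u: "u \<in> U"
  obtains u' where "u' \<in> U" "\<And>g. g \<in> mspace M0 \<Longrightarrow> \<phi> c L0 (g u) = \<phi> b L0 (g u')"
proof -
  define s where "s = ginv V b \<bullet> c"
  have sG: "s \<in> G" using b c by (simp add: s_def)
  have bs: "b \<bullet> s = c"
    using b c mul_assoc[OF b G_inv[OF b] c] by (simp add: s_def inv_mul mul_one)
  have "move s L0 = move (ginv V b) (move b L0)"
    using move_move[OF L0 c G_inv[OF b]] eq by (simp add: s_def)
  also have "\<dots> = L0" using move_move[OF L0 b G_inv[OF b]] b by (simp add: inv_mul move_one L0)
  finally have s: "s \<in> stab" "move s L0 = L0" using sG stabilizer_iff(1)[OF L0] by auto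
  \<comment> \<open>Compensates the scalar in \<phi>(b) \<phi>(s) = alpha(b,s) \<phi>(c).\<close>
  define \<kappa> where "\<kappa> = inverse (alpha V F L0 b s)"
  let ?u = "\<kappa> *\<^sub>C act (gb s) u"
  have mem: "act (gb s) u \<in> U" using act_mem gb_S0 s u by blast
  have "\<phi> c L0 (g u) = \<phi> b L0 (g ?u)" if g: "g \<in> mspace M0" for g
  proof -
    have "\<phi> b L0 (g ?u) = \<kappa> *\<^sub>C \<phi> b L0 (\<phi> s L0 (g u))"
      using M0_D(2)[OF g mem] M0_D(5)[OF g s(1) u]
      by (simp add: linear_on_scale[OF M0_D(1)[OF g] mem] linear_on_scale[OF phi_lin[OF b L0]])
    also have "\<dots> = (\<kappa> * alpha V F L0 b s) *\<^sub>C \<phi> c L0 (g u)"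
      using alpha[OF L0 sG b M0_D(2)[OF g u]] s(2) bs by (simp add: scaleC_scaleC)
    also have "\<dots> = \<phi> c L0 (g u)"
      using alpha_nonzero[OF L0 sG b] by (simp add: \<kappa>_def scaleC_one)
    finally show ?thesis by simp
  qed
  moreover have "?u \<in> U" using mem by (rule cvec.subspace_scale[OF U_sub])
  ultimately show ?thesis using that by blast
qed

text \<open>One \<open>u'\<close> has to serve all \<open>h\<close> at once, which is why
  \<open>w\<close> is sent to a whole function of \<open>h\<close>. The functions arising from some
  \<open>u'\<close> form a subspace \<open>R\<close>; a generator either misses the module, giving
  0, or is brought to \<open>b\<close> by \<open>coset_shift\<close>.\<close>

lemma decomp_component:
  assumes w: "w \<in> W_space V G F \<gamma>" and b: "b \<in> G"
  shows "\<exists>u'\<in>U. \<forall>h\<in>mspace M0. decomp V G F \<gamma> w h (move b L0) = \<phi> b L0 (h u')"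
proof -
  let ?L = "move b L0"
  define R where "R = (\<lambda>u' h. if h \<in> mspace M0 then \<phi> b L0 (h u') else 0) ` U"
  have R: "cvec.subspace R"
    unfolding R_def
  proof (rule subspace_image_on[OF U_sub])
    have "linear_on U (\<lambda>u. \<phi> b L0 (h u))" if "h \<in> mspace M0" for h
      using M0_D(2)[OF that] by (intro linear_on_compose[OF M0_D(1)[OF that] _ phi_lin[OF b L0]]) auto
    then show "linear_on U (\<lambda>u' h. if h \<in> mspace M0 then \<phi> b L0 (h u') else 0)"
      by (auto simp: linear_on_def fun_eq_iff scaleC_fun_def)
  qed
  have "(\<lambda>w h. if h \<in> mspace M0 then decomp V G F \<gamma> w h ?L else 0) w \<in> R"
  proof (rule W_space_mapI[OF R _ _ w])
    show "linear_on (W_space V G F \<gamma>) (\<lambda>w h. if h \<in> mspace M0 then decomp V G F \<gamma> w h ?L else 0)"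
      using linear_on_eval[OF decomp_linear, of _ ?L] by (auto simp: linear_on_def fun_eq_iff scaleC_fun_def)
    fix a u assume a: "a \<in> G" and u: "u \<in> U"
    have val: "decomp V G F \<gamma> (wt (gb a) u) h ?L = (if move a L0 = ?L then \<phi> a L0 (h u) else 0)"
      if "h \<in> mspace M0" for h
      using decomp_wt[OF that gb_D0[OF a] u] L_act_gb[OF a] by (auto simp: dsum_in_def)
    show "(\<lambda>h. if h \<in> mspace M0 then decomp V G F \<gamma> (wt (gb a) u) h ?L else 0) \<in> R"
    proof (cases "move a L0 = ?L")
      case True
      obtain u' where "u' \<in> U" "\<And>g. g \<in> mspace M0 \<Longrightarrow> \<phi> a L0 (g u) = \<phi> b L0 (g u')"
        using coset_shift[OF a b True u] by blast
      then show ?thesis unfolding R_def using val True by (intro image_eqI[of _ _ u']) auto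
    next
      case False
      then have "(\<lambda>h. if h \<in> mspace M0 then decomp V G F \<gamma> (wt (gb a) u) h ?L else 0) = 0"
        using val by (auto simp: fun_eq_iff)
      then show ?thesis using cvec.subspace_0[OF R] by simp
    qed
  qed
  then obtain u' where "u' \<in> U" and eq: "(\<lambda>h. if h \<in> mspace M0 then decomp V G F \<gamma> w h ?L else 0) =
      (\<lambda>h. if h \<in> mspace M0 then \<phi> b L0 (h u') else 0)"
    unfolding R_def by blast
  moreover have "decomp V G F \<gamma> w h ?L = \<phi> b L0 (h u')" if "h \<in> mspace M0" for h
    using fun_cong[OF eq, of h] that by simp
  ultimately show ?thesis by blast
qed

lemma decomp_off_orbit:
  assumes w: "w \<in> W_space V G F \<gamma>" and h: "h \<in> mspace M0" and L: "\<And>b. b \<in> G \<Longrightarrow> move b L0 \<noteq> L"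
  shows "decomp V G F \<gamma> w h L = 0"
proof -
  have "decomp V G F \<gamma> w h L \<in> {0}"
  proof (rule W_space_mapI[OF _ linear_on_eval[OF decomp_linear[OF h]] _ w])
    fix a u assume a: "a \<in> G" and u: "u \<in> U"
    then show "decomp V G F \<gamma> (wt (gb a) u) h L \<in> {0}"
      using decomp_wt[OF h gb_D0[OF a] u] L_act_gb[OF a] L[OF a] by (simp add: dsum_in_def)
  qed simp
  then show ?thesis by simp
qed

subsection \<open>The action on $W$\<close>

lemma mult_gb:
  assumes "a \<in> G" "b \<in> G"
  shows "gb a \<star> gb b = (if b \<in> stab then alpha V F L0 a b *\<^sub>C gb (a \<bullet> b) else 0)"
  using assms stabilizer_iff(2)[OF L0, of b] by (simp add: alg_mult_gbasis L0)

lemma mult_D0: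
  assumes a: "a \<in> G" and y: "y \<in> D0"
  shows "gb a \<star> y \<in> D0"
proof -
  have D: "cvec.subspace D0" by (simp add: D0_eq)
  show ?thesis
  proof (rule linear_on_span_mem[OF D alg_mult_linear2 _ y[unfolded D0_eq]])
    fix z assume "z \<in> gb ` G"
    then obtain b where b: "b \<in> G" "z = gb b" by blast
    then show "gb a \<star> z \<in> D0"
      using a gb_D0[of "a \<bullet> b"] cvec.subspace_0[OF D]
      by (simp add: mult_gb cvec.subspace_scale[OF D])
  qed
qed

text \<open>For basis elements a, b, c this is the cocycle identity if b lies in the stabilizer; if
  not, b c lies outside as well and both sides vanish.\<close>

lemma mult_D0_assoc:
  assumes a: "a \<in> G" and y: "y \<in> D0" and s: "s \<in> S0"
  shows "gb a \<star> (y \<star> s) = (gb a \<star> y) \<star> s"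
proof (rule bilinear_on_span_eq[of "gb ` G" "gb ` stab" _ _ y s])
  show "bilinear_on (cvec.span (gb ` G)) (cvec.span (gb ` stab)) (\<lambda>y s. gb a \<star> (y \<star> s))"
    unfolding bilinear_on_def
    by (auto intro!: linear_on_compose[OF alg_mult_linear1 subset_UNIV alg_mult_linear2]
        linear_on_compose[OF alg_mult_linear2 subset_UNIV alg_mult_linear2])
  show "bilinear_on (cvec.span (gb ` G)) (cvec.span (gb ` stab)) (\<lambda>y s. (gb a \<star> y) \<star> s)"
    unfolding bilinear_on_def
    by (auto intro!: linear_on_compose[OF alg_mult_linear2 subset_UNIV alg_mult_linear1] alg_mult_linear2)
  show "y \<in> cvec.span (gb ` G)" "s \<in> cvec.span (gb ` stab)" using y s by (simp_all add: S0_eq D0_eq)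
  fix y s assume "y \<in> gb ` G" "s \<in> gb ` stab"
  then obtain b c where [simp]: "y = gb b" "s = gb c" and b: "b \<in> G" and c: "c \<in> stab" by blast
  note cG = stabD(1)[OF c]
  have bc: "b \<bullet> c \<in> stab \<longleftrightarrow> b \<in> stab"
    using stabilizer_iff(1)[OF L0] move_move[OF L0 cG b] stabD(2)[OF c] b cG by simp
  have l1: "gb a \<star> (k *\<^sub>C z) = k *\<^sub>C (gb a \<star> z)" for k z
    by (rule linear_on_scale[OF alg_mult_linear2[of UNIV]]) simp
  have l2: "(k *\<^sub>C z) \<star> gb c = k *\<^sub>C (z \<star> gb c)" "0 \<star> gb c = 0" for k z
    using linear_on_scale[OF alg_mult_linear1[of UNIV]] linear_on_0[OF cvec.subspace_UNIV alg_mult_linear1]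
    by auto
  have l3: "gb a \<star> 0 = 0" by (rule linear_on_0[OF cvec.subspace_UNIV alg_mult_linear2])
  show "gb a \<star> (y \<star> s) = (gb a \<star> y) \<star> s"
  proof (cases "b \<in> stab")
    case True
    then show ?thesis
      using alpha_cocycle[OF L0 a b cG] stabD(2)[OF c] c bc a b cG
      by (simp add: mult_gb l1 l2 scaleC_scaleC mul_assoc)
  next
    case False
    then show ?thesis using a b cG c bc by (simp add: mult_gb l1 l2 l3)
  qed
qed

text \<open>\<open>W_act\<close> is a lift, so its value on pure tensors is known once the map is
  balanced, and this is the associativity just shown.\<close>

lemma W_act_wt:
  assumes a: "a \<in> G" and y: "y \<in> D0" and u: "u \<in> U"
  shows "W_act V G F \<gamma> (gb a) (wt y u) = wt (gb a \<star> y) u"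
proof -
  have "wt (gb a \<star> (y \<star> s)) u = wt (gb a \<star> y) (act s u)" if "y \<in> D0" "s \<in> S0" "u \<in> U" for y s u
    using that mult_D0_assoc[OF a that(1,2)] mult_D0[OF a that(1)]
    unfolding W_tens_def by (simp add: tens_balanced)
  moreover have "linear_on D0 (\<lambda>y. wt (gb a \<star> y) u)" if "u \<in> U" for u
    using mult_D0[OF a] by (intro linear_on_compose[OF alg_mult_linear2 _ wt_linear1[OF that]]) auto
  ultimately have "(\<lambda>y u. wt (gb a \<star> y) u) \<in> balanced_maps S0 (alg_mult V G F) act D0 U"
    using wt_linear2 mult_D0[OF a] by (simp add: balanced_maps_def bilinear_on_def)
  from tensor_lift(2)[OF this y u] show ?thesis
    by (simp add: W_act_def W_lift_def W_tens_def)
qed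

text \<open>The copy 1 \<otimes> U generates W: each \<open>wt (gb a) u\<close> is reached from it
  up to the nonzero scalar alpha(a,1).\<close>

lemma W_act_one:
  assumes a: "a \<in> G" and u: "u \<in> U"
  shows "W_act V G F \<gamma> (gb a) (wt (gb one) u) = alpha V F L0 a one *\<^sub>C wt (gb a) u"
  using W_act_wt[OF a gb_D0[OF G_one] u] a linear_on_scale[OF wt_linear1[OF u] gb_D0[OF a]]
  by (simp add: mult_gb one_stabilizer[OF L0] mul_one)

text \<open>By Schur's lemma \<phi>(1) is a scalar on \<open>L0\<close>. Since \<open>a\<close>
  stabilizes \<open>L0\<close>, this same scalar appears whether \<phi>(1) is applied before or
  after \<phi>(a).\<close>

lemma alpha_one_commute:
  assumes a: "a \<in> stab"
  shows "alpha V F L0 a one = alpha V F L0 one a"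
proof -
  note aG = stabD(1)[OF a]
  obtain c where c: "\<And>w. w \<in> mspace L0 \<Longrightarrow> \<phi> one L0 w = c *\<^sub>C w"
  proof (rule Schur_scalar[OF V irr[OF L0] phi_lin[OF G_one L0]])
    show "\<phi> one L0 ` mspace L0 \<subseteq> mspace L0" using phi_mem[OF G_one L0] move_one[OF L0] by auto
    show "\<phi> one L0 (mop L0 u n w) = mop L0 u n (\<phi> one L0 w)" if "u \<in> vspace V" "w \<in> mspace L0" for u n w
      using phi_hom[OF G_one L0 that] that move_one[OF L0] by (simp add: one_apply)
  qed blast
  have "alpha V F L0 a one = c"
    using c linear_on_scale[OF phi_lin[OF aG L0]] aG
    by (intro alphaI[OF L0 G_one aG]) (simp add: move_one L0 mul_one)
  moreover have "alpha V F L0 one a = c"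
    using c phi_mem[OF aG L0] aG stabD(2)[OF a]
    by (intro alphaI[OF L0 aG G_one]) (simp add: mul_one)
  ultimately show ?thesis by simp
qed

text \<open>Makes u \<mapsto> 1 \<otimes> u equivariant under the stabilizer, so that a homomorphism
  on W restricts to one on \<open>U\<close>.\<close>

lemma wt_act_one:
  assumes a: "a \<in> stab" and u: "u \<in> U"
  shows "wt (gb one) (act (gb a) u) = W_act V G F \<gamma> (gb a) (wt (gb one) u)"
proof -
  note aG = stabD(1)[OF a]
  have "wt (gb one) (act (gb a) u) = wt (gb one \<star> gb a) u"
    unfolding W_tens_def using tens_balanced[OF gb_D0[OF G_one] u gb_S0[OF a]] by metis
  also have "\<dots> = alpha V F L0 one a *\<^sub>C wt (gb a) u"
    using linear_on_scale[OF wt_linear1[OF u] gb_D0[OF aG]] a aG by (simp add: mult_gb mul_one)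
  finally show ?thesis using W_act_one[OF aG u] alpha_one_commute[OF a] by simp
qed

end

subsection \<open>Transport along $W \otimes v \to W \otimes h$\<close>

context stable_family_rep
begin

definition in_orbit :: "('v, 'm) vmod \<Rightarrow> bool" where
  "in_orbit L \<longleftrightarrow> (\<exists>b\<in>G. move b L0 = L)"

definition coset_rep :: "('v, 'm) vmod \<Rightarrow> 'v \<Rightarrow> 'v" where
  "coset_rep L = (SOME b. b \<in> G \<and> move b L0 = L)"

text \<open>The intersection of \<open>L\<close> with $W \otimes v$ is the image of \<open>U\<close> under an injective map, of
  which \<open>coord v L\<close> is a linear left inverse defined on all of \<open>L\<close>.\<close>

definition line :: "('u \<Rightarrow> 'm) \<Rightarrow> ('v, 'm) vmod \<Rightarrow> 'm set" where
  "line v L = (if in_orbit L then (\<lambda>u. \<phi> (coset_rep L) L0 (v u)) ` U else {0})"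

definition coord :: "('u \<Rightarrow> 'm) \<Rightarrow> ('v, 'm) vmod \<Rightarrow> 'm \<Rightarrow> 'u" where
  "coord v L = (SOME P. Vector_Spaces.linear (*\<^sub>C) (*\<^sub>C) P \<and> range P \<subseteq> U \<and>
     (\<forall>u\<in>U. P (\<phi> (coset_rep L) L0 (v u)) = u))"

text \<open>Off \<open>line v L\<close> the value depends on the choice made in
  \<open>coord\<close>; compatibility with \<phi> is therefore claimed on \<open>line\<close> only
  (\<open>transport_phi\<close>), while compatibility with fixed vectors of \<open>V\<close> holds
  on all of \<open>L\<close> (\<open>transport_mop\<close>).\<close>

definition transport :: "('u \<Rightarrow> 'm) \<Rightarrow> ('u \<Rightarrow> 'm) \<Rightarrow> ('v, 'm) vmod \<Rightarrow> 'm \<Rightarrow> 'm" where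
  "transport v h L x = (if in_orbit L then \<phi> (coset_rep L) L0 (h (coord v L x)) else 0)"

lemma coset_rep: "in_orbit L \<Longrightarrow> coset_rep L \<in> G" "in_orbit L \<Longrightarrow> move (coset_rep L) L0 = L"
  using someI_ex[of "\<lambda>b. b \<in> G \<and> move b L0 = L"] unfolding in_orbit_def coset_rep_def by blast+

lemma coset_phi_linear:
  "in_orbit L \<Longrightarrow> h \<in> mspace M0 \<Longrightarrow> linear_on U (\<lambda>u. \<phi> (coset_rep L) L0 (h u))"
  using M0_D(2)[of h]
  by (intro linear_on_compose[OF M0_D(1) _ phi_lin[OF coset_rep(1) L0]]) auto

lemma coord:
  assumes v: "v \<in> mspace M0" "v \<noteq> 0" and L: "in_orbit L"
  shows "Vector_Spaces.linear (*\<^sub>C) (*\<^sub>C) (coord v L)" "coord v L x \<in> U"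
    "u \<in> U \<Longrightarrow> coord v L (\<phi> (coset_rep L) L0 (v u)) = u"
proof -
  let ?p = "\<lambda>u. \<phi> (coset_rep L) L0 (v u)"
  have "inj_on ?p U"
  proof (rule linear_on_inj_on[OF U_sub coset_phi_linear[OF L v(1)]])
    fix u assume u: "u \<in> U" "?p u = 0"
    then have "v u = 0" using phi_eq_0[OF coset_rep(1)[OF L] L0 M0_D(2)[OF v(1)]] by blast
    then show "u = 0"
      using inj_onD[OF M0_inj[OF v], of u 0] u(1) linear_on_0[OF U_sub M0_D(1)[OF v(1)]]
        cvec.subspace_0[OF U_sub] by simp
  qed
  then obtain P where "Vector_Spaces.linear (*\<^sub>C) (*\<^sub>C) P" "range P \<subseteq> U" "\<And>u. u \<in> U \<Longrightarrow> P (?p u) = u"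
    using linear_on_left_inverse[OF U_sub coset_phi_linear[OF L v(1)]] by blast
  then have "\<exists>P. Vector_Spaces.linear (*\<^sub>C) (*\<^sub>C) P \<and> range P \<subseteq> U \<and> (\<forall>u\<in>U. P (?p u) = u)" by blast
  from someI_ex[OF this, folded coord_def]
  show "Vector_Spaces.linear (*\<^sub>C) (*\<^sub>C) (coord v L)" "coord v L x \<in> U"
    "u \<in> U \<Longrightarrow> coord v L (?p u) = u" by blast+
qed

lemma line_mem:
  assumes "v \<in> mspace M0" "L \<in> fmods F" "x \<in> line v L"
  shows "x \<in> mspace L"
proof (cases "in_orbit L")
  case True
  then show ?thesis
    using assms phi_mem[OF coset_rep(1)[OF True] L0 M0_D(4)[OF assms(1)]] coset_rep(2)[OF True]
    by (auto simp: line_def)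
next
  case False
  then show ?thesis using assms cvec.subspace_0[OF lmodD(1)[OF lm]] by (simp add: line_def)
qed

lemma line_of_decomp:
  assumes v: "v \<in> mspace M0" and w: "w \<in> W_space V G F \<gamma>" and x: "decomp V G F \<gamma> w v = dsum_in L x"
  shows "x \<in> line v L"
proof -
  have x': "x = decomp V G F \<gamma> w v L" unfolding x by (simp add: dsum_in_def)
  show ?thesis
  proof (cases "in_orbit L")
    case True
    then show ?thesis
      using decomp_component[OF w coset_rep(1)[OF True]] v coset_rep(2)[OF True]
      unfolding x' line_def by auto
  next
    case False
    then show ?thesis
      using decomp_off_orbit[OF w v, of L] unfolding x' line_def in_orbit_def by auto
  qed
qed

lemma transport_linear_endos:
  assumes v: "v \<in> mspace M0" "v \<noteq> 0" and h: "h \<in> mspace M0"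
  shows "linear_endos (fmods F) (transport v h)"
  unfolding linear_endos_def
proof (intro ballI conjI)
  fix L assume L: "L \<in> fmods F"
  show "linear_on (mspace L) (transport v h L)"
  proof (cases "in_orbit L")
    case True
    have "linear_on (mspace L) (\<lambda>x. \<phi> (coset_rep L) L0 (h (coord v L x)))"
      using coord(2)[OF v True]
      by (intro linear_on_compose[OF linear_imp_linear_on[OF coord(1)[OF v True]] _ coset_phi_linear[OF True h]]) auto
    then show ?thesis using True by (simp add: transport_def[abs_def])
  next
    case False
    then show ?thesis by (simp add: transport_def[abs_def] linear_on_zero_fun)
  qed
  show "transport v h L ` mspace L \<subseteq> mspace L"
    using phi_mem[OF coset_rep(1) L0 M0_D(4)[OF h]] coset_rep(2) cvec.subspace_0[OF lmodD(1)[OF lm[OF L]]]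
    by (auto simp: transport_def)
qed

lemma transport_line:
  assumes v: "v \<in> mspace M0" "v \<noteq> 0" and L: "in_orbit L" and u: "u \<in> U"
  shows "transport v h L (\<phi> (coset_rep L) L0 (v u)) = \<phi> (coset_rep L) L0 (h u)"
  using coord(3)[OF v L u] L by (simp add: transport_def)

lemma transport_self:
  assumes v: "v \<in> mspace M0" "v \<noteq> 0" and x: "x \<in> line v L"
  shows "transport v v L x = x"
  using x transport_line[OF v] by (auto simp: line_def transport_def split: if_splits)

lemma transport_add:
  assumes "v \<in> mspace M0" "v \<noteq> 0" "h \<in> mspace M0" "h' \<in> mspace M0"
  shows "transport v (h + h') L x = transport v h L x + transport v h' L x"
  using linear_on_add[OF phi_lin[OF coset_rep(1) L0] M0_D(4)[OF assms(3)] M0_D(4)[OF assms(4)]]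
  by (simp add: transport_def)

lemma transport_scale:
  assumes "v \<in> mspace M0" "v \<noteq> 0" "h \<in> mspace M0"
  shows "transport v (c *\<^sub>C h) L x = c *\<^sub>C transport v h L x"
  using linear_on_scale[OF phi_lin[OF coset_rep(1) L0] M0_D(4)[OF assms(3)]]
  by (simp add: transport_def scaleC_fun_def)

text \<open>Fixed vectors of \<open>V\<close> commute with every \<phi>(b), and \<open>v\<close>
  alone, not \<open>h\<close>, enters the coordinates of \<open>x\<close>.\<close>

lemma transport_mop:
  assumes h: "h \<in> mspace M0" and v': "v' \<in> vspace (fixed_voa V G)" and L: "L \<in> fmods F"
  shows "transport v (mop M0 v' n h) L x = mop L v' n (transport v h L x)"
proof (cases "in_orbit L")
  case True
  then show ?thesis
    using fixed_phi[OF v' coset_rep(1)[OF True] L0 M0_D(4)[OF h]] coset_rep(2)[OF True]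
    by (simp add: transport_def M0_mop)
next
  case False
  then show ?thesis using lmodD(5)[OF lm[OF L]] v' by (simp add: transport_def fixed_vspace)
qed

text \<open>On \<open>line\<close>, the element \<phi>(a) x again has a coordinate in
  \<open>U\<close>, and \<open>coset_shift\<close> yields one coordinate that is valid for
  \<open>v\<close> and \<open>h\<close> alike.\<close>

lemma transport_phi:
  assumes v: "v \<in> mspace M0" "v \<noteq> 0" and h: "h \<in> mspace M0" and L: "L \<in> fmods F" and a: "a \<in> G"
    and x: "x \<in> line v L"
  shows "transport v h (move a L) (\<phi> a L x) = \<phi> a L (transport v h L x)"
proof (cases "in_orbit L")
  case True
  let ?b = "coset_rep L"
  note b = coset_rep[OF True]
  obtain u where u: "u \<in> U" "x = \<phi> ?b L0 (v u)" using x True by (auto simp: line_def)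
  have mv: "move (a \<bullet> ?b) L0 = move a L" using move_move[OF L0 b(1) a] b(2) by simp
  have orb: "in_orbit (move a L)" unfolding in_orbit_def using mv a b(1) by blast
  let ?c = "coset_rep (move a L)"
  note c = coset_rep[OF orb]
  obtain u' where u': "u' \<in> U" "\<And>g. g \<in> mspace M0 \<Longrightarrow> \<phi> (a \<bullet> ?b) L0 (g u) = \<phi> ?c L0 (g u')"
    using coset_shift[of "a \<bullet> ?b" ?c u] mv c a b(1) u(1) by auto
  let ?k = "alpha V F L0 a ?b"
  \<comment> \<open>Stated for all \<open>g\<close>: the case g = v finds the coordinate of
    \<phi>(a) x, the case g = h evaluates the right-hand side.\<close>
  have eq: "\<phi> a L (\<phi> ?b L0 (g u)) = \<phi> ?c L0 (g (?k *\<^sub>C u'))" if g: "g \<in> mspace M0" for g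
    using alpha[OF L0 b(1) a M0_D(2)[OF g u(1)]] b(2) u'(2)[OF g]
    by (simp add: linear_on_scale[OF M0_D(1)[OF g] u'(1)] linear_on_scale[OF phi_lin[OF c(1) L0] M0_D(4)[OF g]])
  have "transport v h (move a L) (\<phi> a L x) = \<phi> ?c L0 (h (?k *\<^sub>C u'))"
    unfolding u(2) eq[OF v(1)] using cvec.subspace_scale[OF U_sub u'(1)] by (rule transport_line[OF v orb])
  also have "\<dots> = \<phi> a L (transport v h L x)"
    unfolding u(2) transport_line[OF v True u(1)] eq[OF h] ..
  finally show ?thesis .
next
  case False
  have "\<not> in_orbit (move a L)"
  proof
    assume "in_orbit (move a L)"
    then obtain b where b: "b \<in> G" "move b L0 = move a L" unfolding in_orbit_def by blast
    have "move (ginv V a \<bullet> b) L0 = move (ginv V a) (move a L)"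
      using move_move[OF L0 b(1) G_inv[OF a]] b(2) by simp
    also have "\<dots> = L" using move_move[OF L a G_inv[OF a]] a L by (simp add: inv_mul move_one)
    finally show False using False a b(1) unfolding in_orbit_def by blast
  qed
  then show ?thesis using False phi_0[OF a L] by (simp add: transport_def)
qed

end

subsection \<open>Twisting of intertwining operators\<close>

locale three_families =
  A: stable_family V G F1 + B: stable_family V G F2 + C: stable_family V G F3
  for V :: "'v::complex_vector voa" and G :: "('v \<Rightarrow> 'v) set"
    and F1 :: "('v, 'm1::complex_vector, 'j1, 'u1::complex_vector) gfamily"
    and F2 :: "('v, 'm2::complex_vector, 'j2, 'u2::complex_vector) gfamily"
    and F3 :: "('v, 'm3::complex_vector, 'j3, 'u3::complex_vector) gfamily"
begin

abbreviation mv1 where "mv1 a L \<equiv> mdot V (fmods F1) L (ginv V a)"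
abbreviation mv2 where "mv2 a L \<equiv> mdot V (fmods F2) L (ginv V a)"
abbreviation mv3 where "mv3 a L \<equiv> mdot V (fmods F3) L (ginv V a)"
abbreviation tw where "tw \<equiv> twist_op V F1 F2 F3"

lemma tw_apply:
  assumes "a \<in> G" "L1 \<in> fmods F1" "L2 \<in> fmods F2" "x \<in> mspace L1" "y \<in> mspace L2"
  shows "tw a (L1, L2, L3) f (fphi F1 a L1 x) k (fphi F2 a L2 y) = fphi F3 a L3 (f x k y)"
  using A.phi_bij[OF assms(1,2)] B.phi_bij[OF assms(1,3)] assms A.phi_mem B.phi_mem
  by (simp add: twist_op_def bij_betw_def)

text \<open>Every axiom at \<phi>(x) and \<phi>(y) is the image under \<phi>3 of the axiom for
  \<open>f\<close> at x and y with a^-1 u in place of u. The operator L(-1) is respected because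
  automorphisms fix \<open>cnf V\<close>.\<close>

lemma tw_mem:
  assumes a: "a \<in> G" and L: "L1 \<in> fmods F1" "L2 \<in> fmods F2" "L3 \<in> fmods F3"
    and f: "f \<in> intertwining_ops V L1 L2 L3"
  shows "tw a (L1, L2, L3) f \<in> intertwining_ops V (mv1 a L1) (mv2 a L2) (mv3 a L3)"
proof -
  let ?t = "tw a (L1, L2, L3) f"
  note d = intertwiningD[OF f]
  have ex1: "\<exists>x. x \<in> mspace L1 \<and> v = fphi F1 a L1 x" if "v \<in> mspace (mv1 a L1)" for v
    using that A.phi_bij[OF a L(1)] by (auto simp: bij_betw_def)
  have ex2: "\<exists>y. y \<in> mspace L2 \<and> w = fphi F2 a L2 y" if "w \<in> mspace (mv2 a L2)" for w
    using that B.phi_bij[OF a L(2)] by (auto simp: bij_betw_def)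
  note app = tw_apply[OF a L(1,2)]
  note lin3 = C.phi_lin[OF a L(3)]
  note sub1 = lmodD(1)[OF A.lm[OF L(1)]] and sub2 = lmodD(1)[OF B.lm[OF L(2)]]
  let ?i1 = "inv_into (mspace L1) (fphi F1 a L1)" and ?i2 = "inv_into (mspace L2) (fphi F2 a L2)"
  have t: "?t v k w = fphi F3 a L3 (f (?i1 v) k (?i2 w))"
    if "v \<in> mspace (mv1 a L1)" "w \<in> mspace (mv2 a L2)" for v k w
    using that by (simp add: twist_op_def)
  have i1: "?i1 ` mspace (mv1 a L1) \<subseteq> mspace L1" and i2: "?i2 ` mspace (mv2 a L2) \<subseteq> mspace L2"
    using bij_betw_inv_into[OF A.phi_bij[OF a L(1)]] bij_betw_inv_into[OF B.phi_bij[OF a L(2)]]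
    by (simp_all add: bij_betw_def)
  note l1 = linear_on_inv_into[OF sub1 A.phi_lin[OF a L(1)] A.phi_bij[OF a L(1)]]
    and l2 = linear_on_inv_into[OF sub2 B.phi_lin[OF a L(2)] B.phi_bij[OF a L(2)]]
  have 1: "bilinear_on (mspace (mv1 a L1)) (mspace (mv2 a L2)) (\<lambda>v. ?t v k)" for k
    unfolding bilinear_on_def
  proof (intro conjI ballI)
    fix v assume v: "v \<in> mspace (mv1 a L1)"
    then have v': "?i1 v \<in> mspace L1" using i1 by blast
    have im: "(\<lambda>w. f (?i1 v) k (?i2 w)) ` mspace (mv2 a L2) \<subseteq> mspace L3" using i2 d(3)[OF v'] by blast
    have "linear_on (mspace (mv2 a L2)) (\<lambda>w. fphi F3 a L3 (f (?i1 v) k (?i2 w)))"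
      by (rule linear_on_compose[OF linear_on_compose[OF l2 i2 d(2)[OF v']] im lin3])
    then show "linear_on (mspace (mv2 a L2)) (?t v k)"
      by (rule linear_on_cong[OF lmodD(1)[OF B.lm[OF B.move_mem[OF L(2) a]]], rotated]) (rule t[OF v])
  next
    fix w assume w: "w \<in> mspace (mv2 a L2)"
    then have w': "?i2 w \<in> mspace L2" using i2 by blast
    have im: "(\<lambda>v. f (?i1 v) k (?i2 w)) ` mspace (mv1 a L1) \<subseteq> mspace L3" using i1 d(3)[OF _ w'] by blast
    have "linear_on (mspace (mv1 a L1)) (\<lambda>v. fphi F3 a L3 (f (?i1 v) k (?i2 w)))"
      by (rule linear_on_compose[OF linear_on_compose[OF l1 i1 d(1)[OF w']] im lin3])
    then show "linear_on (mspace (mv1 a L1)) (\<lambda>v. ?t v k w)"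
      by (rule linear_on_cong[OF lmodD(1)[OF A.lm[OF A.move_mem[OF L(1) a]]], rotated]) (rule t[OF _ w])
  qed
  have 2: "?t v k w \<in> mspace (mv3 a L3)" if vw: "v \<in> mspace (mv1 a L1)" "w \<in> mspace (mv2 a L2)" for v k w
  proof -
    obtain x y where xy: "x \<in> mspace L1" "v = fphi F1 a L1 x" "y \<in> mspace L2" "w = fphi F2 a L2 y"
      using ex1[OF vw(1)] ex2[OF vw(2)] by blast
    show ?thesis unfolding xy(2,4) app[OF xy(1,3)] by (rule C.phi_mem[OF a L(3) d(3)[OF xy(1,3)]])
  qed
  have 3: "?t v k w = 0" if "v \<notin> mspace (mv1 a L1) \<or> w \<notin> mspace (mv2 a L2)" for v k w
    using that by (auto simp: twist_op_def)
  have 4: "\<exists>N::int. \<forall>n\<ge>N. ?t v (k + of_int n) w = 0"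
    if vw: "v \<in> mspace (mv1 a L1)" "w \<in> mspace (mv2 a L2)" for v k w
  proof -
    obtain x y where xy: "x \<in> mspace L1" "v = fphi F1 a L1 x" "y \<in> mspace L2" "w = fphi F2 a L2 y"
      using ex1[OF vw(1)] ex2[OF vw(2)] by blast
    obtain N :: int where N: "\<forall>n\<ge>N. f x (k + of_int n) y = 0" using d(5)[OF xy(1,3)] by blast
    show ?thesis unfolding xy(2,4) app[OF xy(1,3)] 
      by (rule exI[of _ N]) (use N C.phi_0[OF a L(3)] in simp)
  qed
  have op1: "mop (mv1 a L1) u n (fphi F1 a L1 x) = fphi F1 a L1 (mop L1 (ginv V a u) n x)"
    if "u \<in> vspace V" "x \<in> mspace L1" for u n x
    using A.phi_hom[OF a L(1) A.G_apply_mem[OF A.G_inv[OF a] that(1)] that(2)] A.inv_apply[OF a that(1)] by simp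
  have op2: "mop (mv2 a L2) u n (fphi F2 a L2 x) = fphi F2 a L2 (mop L2 (ginv V a u) n x)"
    if "u \<in> vspace V" "x \<in> mspace L2" for u n x
    using B.phi_hom[OF a L(2) A.G_apply_mem[OF A.G_inv[OF a] that(1)] that(2)] A.inv_apply[OF a that(1)] by simp
  have op3: "mop (mv3 a L3) u n (fphi F3 a L3 x) = fphi F3 a L3 (mop L3 (ginv V a u) n x)"
    if "u \<in> vspace V" "x \<in> mspace L3" for u n x
    using C.phi_hom[OF a L(3) A.G_apply_mem[OF A.G_inv[OF a] that(1)] that(2)] A.inv_apply[OF a that(1)] by simp
  have cnf: "ginv V a (cnf V) = cnf V"
    using A.G_aut A.G_inv[OF a] by (auto simp: voa_aut_def)
  have 5: "?t (Lop V (mv1 a L1) (-1) v) k w = - k *\<^sub>C ?t v (k - 1) w"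
    if vw: "v \<in> mspace (mv1 a L1)" "w \<in> mspace (mv2 a L2)" for v k w
  proof -
    obtain x y where xy: "x \<in> mspace L1" "v = fphi F1 a L1 x" "y \<in> mspace L2" "w = fphi F2 a L2 y"
      using ex1[OF vw(1)] ex2[OF vw(2)] by blast
    note c = cnf_in_vspace[OF A.V]
    have Lx: "Lop V L1 (-1) x \<in> mspace L1" unfolding Lop_def by (rule lmodD(3)[OF A.lm[OF L(1)] c xy(1)])
    have Lv: "Lop V (mv1 a L1) (-1) v = fphi F1 a L1 (Lop V L1 (-1) x)"
      unfolding xy(2) Lop_def op1[OF c xy(1)] cnf ..
    show ?thesis
      unfolding Lv unfolding xy(2,4) app[OF Lx xy(3)] app[OF xy(1,3)] d(6)[OF xy(1,3)]
      by (rule linear_on_scale[OF lin3 d(3)[OF xy(1,3)]])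
  qed
  have 6: "jacobi (mop (mv3 a L3)) ?t (mop (mv2 a L2)) (mop (mv1 a L1)) u v w"
    if u: "u \<in> vspace V" and vw: "v \<in> mspace (mv1 a L1)" "w \<in> mspace (mv2 a L2)" for u v w
  proof (rule jac3_imp_jacobi)
    fix l m k
    obtain x y where xy: "x \<in> mspace L1" "v = fphi F1 a L1 x" "y \<in> mspace L2" "w = fphi F2 a L2 y"
      using ex1[OF vw(1)] ex2[OF vw(2)] by blast
    \<comment> \<open>Chosen so that the twisted vertex operators of \<open>u\<close> become those
      of \<open>u'\<close> on the original modules, as in \<open>op1\<close>, \<open>op2\<close> and
      \<open>op3\<close>.\<close>
    define u' where "u' = ginv V a u"
    have u': "u' \<in> vspace V" unfolding u'_def by (rule A.G_apply_mem[OF A.G_inv[OF a] u])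
    note m1 = lmodD(3)[OF A.lm[OF L(1)] u' xy(1)] and m2 = lmodD(3)[OF B.lm[OF L(2)] u' xy(3)]
      and m3 = lmodD(3)[OF C.lm[OF L(3)] u']
    have J: "jac3 (\<lambda>i. fphi F3 a L3 (jacA (mop L3) f u' x y l m k i)) (\<lambda>i. fphi F3 a L3 (jacB f (mop L2) u' x y l m k i))
        (\<lambda>i. fphi F3 a L3 (jacC f (mop L1) u' x y l m k i))"
      by (rule jac3_linear[OF lmodD(1)[OF C.lm[OF L(3)]] lin3 _ _ _
            intertwining_jac3[OF A.lm[OF L(1)] B.lm[OF L(2)] C.lm[OF L(3)] f u' xy(1,3)]])
        (intro jac_mem[OF C.lm[OF L(3)] u'] intertwining_total_mem[OF C.lm[OF L(3)] f])+
    have "jacA (mop (mv3 a L3)) ?t u v w l m k = (\<lambda>i. fphi F3 a L3 (jacA (mop L3) f u' x y l m k i))"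
      unfolding xy(2,4) jacA_def app[OF xy(1,3)] op3[OF u d(3)[OF xy(1,3)]] u'_def[symmetric]
      by (simp add: linear_on_scale[OF lin3 m3[OF d(3)[OF xy(1,3)]]])
    moreover have "jacB ?t (mop (mv2 a L2)) u v w l m k = (\<lambda>i. fphi F3 a L3 (jacB f (mop L2) u' x y l m k i))"
      unfolding xy(2,4) jacB_def op2[OF u xy(3)] u'_def[symmetric] app[OF xy(1) m2]
      by (simp add: linear_on_scale[OF lin3 d(3)[OF xy(1) m2]])
    moreover have "jacC ?t (mop (mv1 a L1)) u v w l m k = (\<lambda>i. fphi F3 a L3 (jacC f (mop L1) u' x y l m k i))"
      unfolding xy(2,4) jacC_def op1[OF u xy(1)] u'_def[symmetric] app[OF m1 xy(3)]
      by (simp add: linear_on_scale[OF lin3 d(3)[OF m1 xy(3)]])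
    ultimately show "jac3 (jacA (mop (mv3 a L3)) ?t u v w l m k) (jacB ?t (mop (mv2 a L2)) u v w l m k)
        (jacC ?t (mop (mv1 a L1)) u v w l m k)" using J by simp
  qed
  show ?thesis unfolding intertwining_ops_def using 1 2 3 4 5 6 by blast
qed

lemma tw_linear:
  assumes a: "a \<in> G" and L3: "L3 \<in> fmods F3"
    and L: "L1 \<in> fmods F1" "L2 \<in> fmods F2"
  shows "linear_on (intertwining_ops V L1 L2 L3) (tw a (L1, L2, L3))"
proof -
  note lin3 = C.phi_lin[OF a L3] and mem = intertwining_total_mem[OF C.lm[OF L3]]
  show ?thesis
    unfolding linear_on_def
    by (auto simp: twist_op_def fun_eq_iff scaleC_fun_def linear_on_add[OF lin3] linear_on_scale[OF lin3] mem)
qed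

lemma fus_gen_trilinear:
  "trilinear_on (intertwining_ops V L1 L2 L3) (mspace L1) (mspace L2) (fus_gen V (L1, L2, L3))"
  using fus_tens_trilinear[of V L1 L2 L3]
  by (simp add: trilinear_on_def fus_gen_def[abs_def] linear_on_def dsum_in_def fun_eq_iff scaleC_fun_def)

definition fus_moved where
  "fus_moved a = (\<lambda>(L1, L2, L3) f v w. fus_gen V (mv1 a L1, mv2 a L2, mv3 a L3)
     (tw a (L1, L2, L3) f) (fphi F1 a L1 v) (fphi F2 a L2 w))"

lemma fus_moved_trilinear:
  assumes a: "a \<in> G" and L: "L1 \<in> fmods F1" "L2 \<in> fmods F2" "L3 \<in> fmods F3"
  shows "trilinear_on (intertwining_ops V L1 L2 L3) (mspace L1) (mspace L2) (fus_moved a (L1, L2, L3))"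
proof -
  let ?g = "fus_gen V (mv1 a L1, mv2 a L2, mv3 a L3)" and ?t = "tw a (L1, L2, L3)"
  let ?I = "intertwining_ops V (mv1 a L1) (mv2 a L2) (mv3 a L3)"
  have g: "y \<in> mspace (mv1 a L1) \<Longrightarrow> z \<in> mspace (mv2 a L2) \<Longrightarrow> linear_on ?I (\<lambda>x. ?g x y z)"
    "x \<in> ?I \<Longrightarrow> z \<in> mspace (mv2 a L2) \<Longrightarrow> linear_on (mspace (mv1 a L1)) (\<lambda>y. ?g x y z)"
    "x \<in> ?I \<Longrightarrow> y \<in> mspace (mv1 a L1) \<Longrightarrow> linear_on (mspace (mv2 a L2)) (?g x y)" for x y z
    using fus_gen_trilinear[of "mv1 a L1" "mv2 a L2" "mv3 a L3"] unfolding trilinear_on_def by blast+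
  note m1 = A.phi_mem[OF a L(1)] and m2 = B.phi_mem[OF a L(2)] and m3 = tw_mem[OF a L]
  have im: "?t ` intertwining_ops V L1 L2 L3 \<subseteq> ?I" "fphi F1 a L1 ` mspace L1 \<subseteq> mspace (mv1 a L1)"
    "fphi F2 a L2 ` mspace L2 \<subseteq> mspace (mv2 a L2)"
    using m1 m2 m3 by blast+
  have "linear_on (intertwining_ops V L1 L2 L3) (\<lambda>f. ?g (?t f) (fphi F1 a L1 v) (fphi F2 a L2 w))"
    if "v \<in> mspace L1" "w \<in> mspace L2" for v w
    by (rule linear_on_compose[OF tw_linear[OF a L(3,1,2)] im(1) g(1)[OF m1[OF that(1)] m2[OF that(2)]]])
  moreover have "linear_on (mspace L1) (\<lambda>v. ?g (?t f) (fphi F1 a L1 v) (fphi F2 a L2 w))"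
    if "f \<in> intertwining_ops V L1 L2 L3" "w \<in> mspace L2" for f w
    by (rule linear_on_compose[OF A.phi_lin[OF a L(1)] im(2) g(2)[OF m3[OF that(1)] m2[OF that(2)]]])
  moreover have "linear_on (mspace L2) (\<lambda>w. ?g (?t f) (fphi F1 a L1 v) (fphi F2 a L2 w))"
    if "f \<in> intertwining_ops V L1 L2 L3" "v \<in> mspace L1" for f v
    by (rule linear_on_compose[OF B.phi_lin[OF a L(2)] im(3) g(3)[OF m3[OF that(1)] m1[OF that(2)]]])
  ultimately show ?thesis by (simp add: trilinear_on_def fus_moved_def)
qed

text \<open>The action of the basis element \<open>gbasis a M\<close>, see
  \<open>fus_act_gbasis\<close>; linearity and equivariance are checked through it.\<close>

definition fus_act1 where
  "fus_act1 a M X = (\<Sum>t\<in>fmods F1 \<times> fmods F2 \<times> fmods F3.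
     if snd (snd t) = M then fus_lift V t (fus_moved a t) (X t) else 0)"

lemma fus_act_eq:
  "fus_act V G F1 F2 F3 x X = (\<Sum>p\<in>G \<times> fmods F3. x p *\<^sub>C fus_act1 (fst p) (snd p) X)"
proof -
  have "fus_act1 a M X = (\<Sum>(L1, L2, L3)\<in>fmods F1 \<times> fmods F2 \<times> fmods F3.
        if L3 = M
        then fus_lift V (L1, L2, L3)
          (\<lambda>f v w. fus_gen V (mv1 a L1, mv2 a L2, mv3 a L3)
             (tw a (L1, L2, L3) f) (fphi F1 a L1 v) (fphi F2 a L2 w))
          (X (L1, L2, L3))
        else 0)" for a M
    unfolding fus_act1_def by (intro sum.cong refl) (simp add: fus_moved_def split: prod.split)
  then show ?thesis unfolding fus_act_def by (simp add: case_prod_beta)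
qed

lemma fus_lift_moved_linear:
  assumes a: "a \<in> G" and t: "t \<in> fmods F1 \<times> fmods F2 \<times> fmods F3"
  shows "linear_on (fus_space V F1 F2 F3) (\<lambda>X. fus_lift V t (fus_moved a t) (X t))"
proof -
  obtain L1 L2 L3 where [simp]: "t = (L1, L2, L3)" and L: "L1 \<in> fmods F1" "L2 \<in> fmods F2" "L3 \<in> fmods F3"
    using t by blast
  have im: "(\<lambda>X. X t) ` fus_space V F1 F2 F3 \<subseteq> fus_comp V L1 L2 L3"
    using fus_spaceD(1) L by fastforce
  show ?thesis
    using linear_on_compose[OF linear_on_coordinate[of _ t] im
        fus_lift(1)[OF lmodD(1)[OF B.lm[OF L(2)]] fus_moved_trilinear[OF a L]]] by simp
qed

lemma fus_act1_linear:
  assumes a: "a \<in> G"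
  shows "linear_on (fus_space V F1 F2 F3) (fus_act1 a M)"
proof -
  have "linear_on (fus_space V F1 F2 F3)
      (\<lambda>X. if snd (snd t) = M then fus_lift V t (fus_moved a t) (X t) else 0)"
    if "t \<in> fmods F1 \<times> fmods F2 \<times> fmods F3" for t
    using fus_lift_moved_linear[OF a that] by (cases "snd (snd t) = M") (simp_all add: linear_on_zero_fun)
  then show ?thesis unfolding fus_act1_def[abs_def] by (rule linear_on_sum_fun)
qed

lemma fus_act_linear: "linear_on (fus_space V F1 F2 F3) (fus_act V G F1 F2 F3 x)"
proof -
  have "linear_on (fus_space V F1 F2 F3) (\<lambda>X. x p *\<^sub>C fus_act1 (fst p) (snd p) X)"
    if p: "p \<in> G \<times> fmods F3" for p
    using p by (intro linear_on_scale_fun fus_act1_linear) (simp add: mem_Times_iff)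
  then show ?thesis unfolding fus_act_eq[abs_def] by (rule linear_on_sum_fun)
qed

lemma fus_act_gbasis:
  assumes "a \<in> G" "M \<in> fmods F3"
  shows "fus_act V G F1 F2 F3 (gbasis a M) X = fus_act1 a M X"
  unfolding fus_act_eq using C.sum_gbasis[OF assms, of "\<lambda>p. fus_act1 (fst p) (snd p) X"] by simp

lemma fus_act1_gen:
  assumes a: "a \<in> G" and L: "L1 \<in> fmods F1" "L2 \<in> fmods F2" "L3 \<in> fmods F3"
    and f: "f \<in> intertwining_ops V L1 L2 L3" and v: "v \<in> mspace L1" and w: "w \<in> mspace L2"
  shows "fus_act1 a M (fus_gen V (L1, L2, L3) f v w) =
    (if L3 = M then fus_moved a (L1, L2, L3) f v w else 0)"
proof -
  let ?T = "fmods F1 \<times> fmods F2 \<times> fmods F3" and ?X = "fus_gen V (L1, L2, L3) f v w"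
  have l0: "fus_lift V t (fus_moved a t) (?X t) = 0" if t: "t \<in> ?T" "t \<noteq> (L1, L2, L3)" for t
  proof -
    have "?X t = (0 :: (('v, 'm1, 'm2, 'm3) fus)) t" using t(2) by (simp add: fus_gen_def dsum_in_def)
    then show ?thesis
      using linear_on_0[OF fus_space_subspace fus_lift_moved_linear[OF a t(1)]] by simp
  qed
  have "fus_act1 a M ?X = (\<Sum>t\<in>{(L1, L2, L3)}. if snd (snd t) = M then fus_lift V t (fus_moved a t) (?X t) else 0)"
    unfolding fus_act1_def
    using A.finite_fmods B.finite_fmods C.finite_fmods L l0
    by (intro sum.mono_neutral_right) auto
  also have "\<dots> = (if L3 = M then fus_moved a (L1, L2, L3) f v w else 0)"
    using fus_lift(2)[OF lmodD(1)[OF B.lm[OF L(2)]] fus_moved_trilinear[OF a L] f v w]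
    by (auto simp: fus_gen_def dsum_in_def)
  finally show ?thesis .
qed

end

lemma hom_space_subspace:
  assumes X: "cvec.subspace X" and act: "\<And>s. s \<in> A \<Longrightarrow> linear_on X (actX s)"
  shows "cvec.subspace (hom_space A W actW X actX)"
proof (rule cvec.subspaceI)
  show "0 \<in> hom_space A W actW X actX"
    using cvec.subspace_0[OF X] linear_on_0[OF X act] by (auto simp: hom_space_def linear_on_def)
  show "F + H \<in> hom_space A W actW X actX"
    if F: "F \<in> hom_space A W actW X actX" and H: "H \<in> hom_space A W actW X actX" for F H
  proof -
    have m: "F w \<in> X" "H w \<in> X" if "w \<in> W" for w using F H that by (auto simp: hom_space_def)
    have "linear_on W (F + H)" using F H by (intro linear_on_plus) (auto simp: hom_space_def)
    moreover have "(F + H) ` W \<subseteq> X" using m cvec.subspace_add[OF X] by auto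
    moreover have "(F + H) (actW s w) = actX s ((F + H) w)" if "s \<in> A" "w \<in> W" for s w
      using F H that m[OF that(2)] by (simp add: hom_space_def linear_on_add[OF act[OF that(1)]])
    ultimately show ?thesis using F H by (simp add: hom_space_def)
  qed
  show "c *\<^sub>C F \<in> hom_space A W actW X actX" if F: "F \<in> hom_space A W actW X actX" for c F
  proof -
    have m: "F w \<in> X" if "w \<in> W" for w using F that by (auto simp: hom_space_def)
    have cF: "c *\<^sub>C F = (\<lambda>w. c *\<^sub>C F w)" by (simp add: scaleC_fun_def)
    have "linear_on W (c *\<^sub>C F)" unfolding cF using F by (intro linear_on_scale_fun) (auto simp: hom_space_def)
    moreover have "(c *\<^sub>C F) ` W \<subseteq> X" unfolding cF using m cvec.subspace_scale[OF X] by auto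
    moreover have "(c *\<^sub>C F) (actW s w) = actX s ((c *\<^sub>C F) w)" if "s \<in> A" "w \<in> W" for s w
      unfolding cF using F that m[OF that(2)] by (simp add: hom_space_def linear_on_scale[OF act[OF that(1)]])
    ultimately show ?thesis using F by (simp add: hom_space_def cF)
  qed
qed

section \<open>Evaluation after the replacement of the two fixed vectors\<close>

locale fusion_setting = three_families V G F1 F2 F3 +
  A: stable_family_rep V G F1 \<gamma>1 + B: stable_family_rep V G F2 \<gamma>2 + C: stable_family_rep V G F3 \<gamma>3
  for V :: "'v::complex_vector voa" and G :: "('v \<Rightarrow> 'v) set"
    and F1 :: "('v, 'm1::complex_vector, 'j1, 'u1::complex_vector) gfamily"
    and F2 :: "('v, 'm2::complex_vector, 'j2, 'u2::complex_vector) gfamily"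
    and F3 :: "('v, 'm3::complex_vector, 'j3, 'u3::complex_vector) gfamily"
    and \<gamma>1 \<gamma>2 \<gamma>3 +
  fixes v1 :: "'u1 \<Rightarrow> 'm1" and v2 :: "'u2 \<Rightarrow> 'm2"
  assumes v1: "v1 \<in> mspace (M_module V G F1 \<gamma>1)" "v1 \<noteq> 0"
    and v2: "v2 \<in> mspace (M_module V G F2 \<gamma>2)" "v2 \<noteq> 0"
begin

abbreviation M1 where "M1 \<equiv> M_module V G F1 \<gamma>1"
abbreviation M2 where "M2 \<equiv> M_module V G F2 \<gamma>2"
abbreviation M3 where "M3 \<equiv> M_module V G F3 \<gamma>3"
abbreviation U3 where "U3 \<equiv> aspace (fsimp F3 \<gamma>3)"
abbreviation K3 where "K3 \<equiv> frep F3 (fst \<gamma>3)"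
abbreviation wt3 where "wt3 \<equiv> W_tens V G F3 \<gamma>3"
abbreviation W3 where "W3 \<equiv> W_space V G F3 \<gamma>3"
abbreviation e where "e \<equiv> \<one>\<^bsub>BijGroup (vspace V)\<^esub>"
abbreviation fsub where "fsub \<equiv> fus_sub V G F1 F2 F3 \<gamma>1 \<gamma>2 v1 v2"
abbreviation fspace where "fspace \<equiv> fus_space V F1 F2 F3"
abbreviation I_act where "I_act \<equiv> fus_act V G F1 F2 F3"
abbreviation VG where "VG \<equiv> fixed_voa V G"

text \<open>Generators described by \<open>line\<close>, the form in which the transport lemmas
  apply. Their span contains \<open>fsub\<close>, and the properties of \<open>ev\<close> are proved
  on this span.\<close>

definition gens where
  "gens = {fus_gen V (L1, L2, L3) f x1 x2 |L1 L2 L3 f x1 x2.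
     L1 \<in> fmods F1 \<and> L2 \<in> fmods F2 \<and> L3 \<in> fmods F3 \<and> f \<in> intertwining_ops V L1 L2 L3 \<and>
     x1 \<in> A.line v1 L1 \<and> x2 \<in> B.line v2 L2}"

lemma gensE:
  assumes "X \<in> gens"
  obtains L1 L2 L3 f x1 x2 where "X = fus_gen V (L1, L2, L3) f x1 x2"
    "L1 \<in> fmods F1" "L2 \<in> fmods F2" "L3 \<in> fmods F3" "f \<in> intertwining_ops V L1 L2 L3"
    "x1 \<in> A.line v1 L1" "x2 \<in> B.line v2 L2" "x1 \<in> mspace L1" "x2 \<in> mspace L2"
  using assms A.line_mem[OF v1(1)] B.line_mem[OF v2(1)] unfolding gens_def by blast

lemma gens_fspace: "gens \<subseteq> fspace"
proof
  fix X assume "X \<in> gens"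
  then show "X \<in> fspace" by (rule gensE) (simp add: fus_gen_mem)
qed

lemma fsub_subspace: "cvec.subspace fsub"
  by (simp add: fus_sub_def)

lemma fsub_gens: "fsub \<subseteq> cvec.span gens"
  unfolding fus_sub_def gens_def
  by (rule cvec.span_mono) (use A.line_of_decomp[OF v1(1)] B.line_of_decomp[OF v2(1)] in blast)

lemma span_fspace: "cvec.span gens \<subseteq> fspace"
  by (rule cvec.span_minimal[OF gens_fspace fus_space_subspace])

lemma fsub_fspace: "fsub \<subseteq> fspace"
  using fsub_gens span_fspace by blast

definition ev :: "('u1 \<Rightarrow> 'm1) \<Rightarrow> ('u2 \<Rightarrow> 'm2) \<Rightarrow> complex \<Rightarrow> ('v, 'm1, 'm2, 'm3) fus \<Rightarrow> ('v, 'm3) vmod \<Rightarrow> 'm3" where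
  "ev h1 h2 k X L3 = fus_eval V (fmods F1) (fmods F2) (A.transport v1 h1) (B.transport v2 h2) k X L3"

lemma ev_linear:
  assumes "h1 \<in> mspace M1" "h2 \<in> mspace M2" "L3 \<in> fmods F3"
  shows "linear_on fspace (\<lambda>X. ev h1 h2 k X L3)" "linear_on (cvec.span gens) (\<lambda>X. ev h1 h2 k X L3)"
    "linear_on fsub (\<lambda>X. ev h1 h2 k X L3)"
proof -
  show *: "linear_on fspace (\<lambda>X. ev h1 h2 k X L3)"
    unfolding ev_def
    by (intro fus_eval_linear B.lm A.transport_linear_endos[OF v1] B.transport_linear_endos[OF v2] assms)
  show "linear_on (cvec.span gens) (\<lambda>X. ev h1 h2 k X L3)" "linear_on fsub (\<lambda>X. ev h1 h2 k X L3)"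
    using linear_on_subset[OF *] span_fspace fsub_fspace by blast+
qed

lemma ev_gen:
  assumes "h1 \<in> mspace M1" "h2 \<in> mspace M2" "L1 \<in> fmods F1" "L2 \<in> fmods F2"
    "f \<in> intertwining_ops V L1 L2 L3" "x1 \<in> mspace L1" "x2 \<in> mspace L2"
  shows "ev h1 h2 k (fus_gen V (L1, L2, L3) f x1 x2) M =
    (if M = L3 then f (A.transport v1 h1 L1 x1) k (B.transport v2 h2 L2 x2) else 0)"
  unfolding ev_def
  by (intro fus_eval_gen B.lm A.transport_linear_endos[OF v1] B.transport_linear_endos[OF v2]
      A.finite_fmods B.finite_fmods assms)

lemma ev_mem:
  assumes h: "h1 \<in> mspace M1" "h2 \<in> mspace M2" and M: "M \<in> fmods F3" and X: "X \<in> cvec.span gens"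
  shows "ev h1 h2 k X M \<in> mspace M"
proof (rule linear_on_span_mem[OF lmodD(1)[OF C.lm[OF M]] ev_linear(2)[OF h M] _ X])
  fix X assume "X \<in> gens"
  then show "ev h1 h2 k X M \<in> mspace M"
    by (rule gensE)
      (simp add: ev_gen[OF h] intertwining_total_mem[OF C.lm] cvec.subspace_0[OF lmodD(1)[OF C.lm[OF M]]])
qed

lemma ev_eqI:
  assumes "linear_on (cvec.span gens) E" "linear_on (cvec.span gens) E'"
    and "\<And>L1 L2 L3 f x1 x2. L1 \<in> fmods F1 \<Longrightarrow> L2 \<in> fmods F2 \<Longrightarrow> L3 \<in> fmods F3 \<Longrightarrow>
      f \<in> intertwining_ops V L1 L2 L3 \<Longrightarrow> x1 \<in> A.line v1 L1 \<Longrightarrow> x2 \<in> B.line v2 L2 \<Longrightarrow>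
      x1 \<in> mspace L1 \<Longrightarrow> x2 \<in> mspace L2 \<Longrightarrow>
      E (fus_gen V (L1, L2, L3) f x1 x2) = E' (fus_gen V (L1, L2, L3) f x1 x2)"
    and "X \<in> cvec.span gens"
  shows "E X = E' X"
proof (rule linear_on_span_eq[OF assms(1,2) _ assms(4)])
  fix X assume "X \<in> gens"
  then show "E X = E' X" by (rule gensE) (simp add: assms(3))
qed

lemma transport_mem:
  "h \<in> mspace M1 \<Longrightarrow> L1 \<in> fmods F1 \<Longrightarrow> x \<in> mspace L1 \<Longrightarrow> A.transport v1 h L1 x \<in> mspace L1"
  "h' \<in> mspace M2 \<Longrightarrow> L2 \<in> fmods F2 \<Longrightarrow> y \<in> mspace L2 \<Longrightarrow> B.transport v2 h' L2 y \<in> mspace L2"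
  using linear_endosD(3)[OF A.transport_linear_endos[OF v1]] linear_endosD(3)[OF B.transport_linear_endos[OF v2]]
  by blast+

text \<open>For fixed \<open>h1\<close> and \<open>h2\<close> both sides of each identity are linear
  in \<open>X\<close>, so generators suffice, and there transport is linear in the new
  vector.\<close>

lemma ev_bilinear:
  assumes M: "M \<in> fmods F3" and X: "X \<in> cvec.span gens"
  shows "bilinear_on (mspace M1) (mspace M2) (\<lambda>h1 h2. ev h1 h2 k X M)"
proof -
  note s1 = lmodD(1)[OF A.M0_lmod] and s2 = lmodD(1)[OF B.M0_lmod]
  note add1 = cvec.subspace_add[OF s1] and add2 = cvec.subspace_add[OF s2]
    and scale1 = cvec.subspace_scale[OF s1] and scale2 = cvec.subspace_scale[OF s2]
  note lin = ev_linear(2)[OF _ _ M]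
  have "ev h1 (h2 + h2') k X M = ev h1 h2 k X M + ev h1 h2' k X M"
    if h: "h1 \<in> mspace M1" "h2 \<in> mspace M2" "h2' \<in> mspace M2" for h1 h2 h2'
    by (rule ev_eqI[OF lin[OF h(1) add2[OF h(2,3)]] linear_on_add_fun[OF lin[OF h(1,2)] lin[OF h(1,3)]] _ X])
      (simp add: ev_gen h add2 B.transport_add[OF v2] linear_on_add[OF intertwiningD(2)] transport_mem)
  moreover have "ev h1 (c *\<^sub>C h2) k X M = c *\<^sub>C ev h1 h2 k X M"
    if h: "h1 \<in> mspace M1" "h2 \<in> mspace M2" for h1 h2 c
    by (rule ev_eqI[OF lin[OF h(1) scale2[OF h(2)]] linear_on_scale_fun[OF lin[OF h]] _ X])
      (simp add: ev_gen h scale2 B.transport_scale[OF v2] linear_on_scale[OF intertwiningD(2)] transport_mem)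
  moreover have "ev (h1 + h1') h2 k X M = ev h1 h2 k X M + ev h1' h2 k X M"
    if h: "h1 \<in> mspace M1" "h1' \<in> mspace M1" "h2 \<in> mspace M2" for h1 h1' h2
    by (rule ev_eqI[OF lin[OF add1[OF h(1,2)] h(3)] linear_on_add_fun[OF lin[OF h(1,3)] lin[OF h(2,3)]] _ X])
      (simp add: ev_gen h add1 A.transport_add[OF v1] linear_on_add[OF intertwiningD(1)] transport_mem)
  moreover have "ev (c *\<^sub>C h1) h2 k X M = c *\<^sub>C ev h1 h2 k X M"
    if h: "h1 \<in> mspace M1" "h2 \<in> mspace M2" for h1 h2 c
    by (rule ev_eqI[OF lin[OF scale1[OF h(1)] h(2)] linear_on_scale_fun[OF lin[OF h]] _ X])
      (simp add: ev_gen h scale1 A.transport_scale[OF v1] linear_on_scale[OF intertwiningD(1)] transport_mem)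
  ultimately show ?thesis by (simp add: bilinear_on_def linear_on_def)
qed

lemma ev_truncation:
  assumes h: "h1 \<in> mspace M1" "h2 \<in> mspace M2" and M: "M \<in> fmods F3" and X: "X \<in> cvec.span gens"
  shows "\<exists>N::int. \<forall>n\<ge>N. ev h1 h2 (k + of_int n) X M = 0"
proof -
  note lin = ev_linear(2)[OF h M]
  define R where "R = {X \<in> cvec.span gens. \<exists>N::int. \<forall>n\<ge>N. ev h1 h2 (k + of_int n) X M = 0}"
  have "cvec.subspace R"
  proof (rule cvec.subspaceI)
    show "0 \<in> R" using linear_on_0[OF cvec.subspace_span lin] by (simp add: R_def cvec.span_zero)
    show "X + Y \<in> R" if XY: "X \<in> R" "Y \<in> R" for X Y
    proof -
      obtain N N' :: int where "\<forall>n\<ge>N. ev h1 h2 (k + of_int n) X M = 0" "\<forall>n\<ge>N'. ev h1 h2 (k + of_int n) Y M = 0"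
        using XY unfolding R_def by blast
      then have "\<forall>n\<ge>max N N'. ev h1 h2 (k + of_int n) (X + Y) M = 0"
        using XY by (simp add: R_def linear_on_add[OF lin])
      then have "\<exists>N::int. \<forall>n\<ge>N. ev h1 h2 (k + of_int n) (X + Y) M = 0" by (rule exI)
      then show ?thesis using XY by (simp add: R_def cvec.span_add)
    qed
    show "c *\<^sub>C X \<in> R" if X: "X \<in> R" for c X
      using X by (auto simp: R_def cvec.span_scale linear_on_scale[OF lin])
  qed
  moreover have "gens \<subseteq> R"
  proof
    fix X assume X: "X \<in> gens"
    obtain L1 L2 L3 f x1 x2 where g: "X = fus_gen V (L1, L2, L3) f x1 x2"
      "L1 \<in> fmods F1" "L2 \<in> fmods F2" "L3 \<in> fmods F3" "f \<in> intertwining_ops V L1 L2 L3"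
      "x1 \<in> mspace L1" "x2 \<in> mspace L2" by (rule gensE[OF X])
    have "\<exists>N::int. \<forall>n\<ge>N. f (A.transport v1 h1 L1 x1) (k + of_int n) (B.transport v2 h2 L2 x2) = 0"
      using g h by (intro intertwiningD(5)[OF g(5)] transport_mem)
    then have "\<exists>N::int. \<forall>n\<ge>N. ev h1 h2 (k + of_int n) X M = 0"
      unfolding g(1) ev_gen[OF h g(2,3,5,6,7)] by auto
    then show "X \<in> R" using X by (simp add: R_def cvec.span_base)
  qed
  ultimately have "cvec.span gens \<subseteq> R" by (intro cvec.span_minimal)
  then show ?thesis using X unfolding R_def by blast
qed

text \<open>The conformal vector is fixed by \<open>G\<close>, so \<open>transport_mop\<close>
  carries L(-1) from \<open>h1\<close> to the transported vector, where the derivative property of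
  \<open>f\<close> applies.\<close>

lemma ev_derivative:
  assumes h: "h1 \<in> mspace M1" "h2 \<in> mspace M2" and M: "M \<in> fmods F3" and X: "X \<in> cvec.span gens"
  shows "ev (Lop VG M1 (-1) h1) h2 k X M = - k *\<^sub>C ev h1 h2 (k - 1) X M"
proof -
  have cnf: "cnf V \<in> vspace VG"
    using cnf_in_vspace[OF A.V] A.G_aut by (auto simp: A.fixed_vspace voa_aut_def)
  have L: "Lop VG M1 (-1) h1 = mop M1 (cnf V) 0 h1" by (simp add: Lop_def fixed_voa_def)
  have Lh: "Lop VG M1 (-1) h1 \<in> mspace M1" unfolding L by (rule lmodD(3)[OF A.M0_lmod cnf h(1)])
  show ?thesis
  proof (rule ev_eqI[OF ev_linear(2)[OF Lh h(2) M] linear_on_scale_fun[OF ev_linear(2)[OF h M]] _ X])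
    fix L1 L2 f x1 x2 and L3 :: "('v, 'm3) vmod"
    assume g: "L1 \<in> fmods F1" "L2 \<in> fmods F2" "f \<in> intertwining_ops V L1 L2 L3" "x1 \<in> mspace L1" "x2 \<in> mspace L2"
    have "A.transport v1 (Lop VG M1 (-1) h1) L1 x1 = Lop V L1 (-1) (A.transport v1 h1 L1 x1)"
      unfolding L A.transport_mop[OF h(1) cnf g(1)] by (simp add: Lop_def)
    then show "ev (Lop VG M1 (-1) h1) h2 k (fus_gen V (L1, L2, L3) f x1 x2) M =
        - k *\<^sub>C ev h1 h2 (k - 1) (fus_gen V (L1, L2, L3) f x1 x2) M"
      using intertwiningD(6)[OF g(3) transport_mem(1)[OF h(1) g(1,4)] transport_mem(2)[OF h(2) g(2,5)], of k]
      by (simp add: ev_gen[OF Lh h(2) g] ev_gen[OF h g] del: cvec.scale_minus_left)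
  qed
qed

text \<open>The \<open>X\<close> with this property form a subspace because \<open>jac3\<close>
  respects linear combinations. On a generator with target \<open>M\<close> it is the Jacobi
  identity of \<open>f\<close> at the transported vectors, \<open>v\<close> being fixed; for another
  target all terms vanish.\<close>

lemma ev_jacobi:
  assumes h: "h1 \<in> mspace M1" "h2 \<in> mspace M2" and M: "M \<in> fmods F3" and X: "X \<in> cvec.span gens"
    and v: "v \<in> vspace VG"
  defines "I \<equiv> \<lambda>X h1 k h2. ev h1 h2 k X M"
  shows "jac3 (jacA (mop M) (I X) v h1 h2 l m k) (jacB (I X) (mop M2) v h1 h2 l m k)
    (jacC (I X) (mop M1) v h1 h2 l m k)"
proof -
  let ?P = "\<lambda>X. jac3 (jacA (mop M) (I X) v h1 h2 l m k) (jacB (I X) (mop M2) v h1 h2 l m k)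
    (jacC (I X) (mop M1) v h1 h2 l m k)"
  have vV: "v \<in> vspace V" using v by (simp add: A.fixed_vspace)
  note lM = lmodD(2)[OF C.lm[OF M] vV]
  have h1': "mop M1 v n h1 \<in> mspace M1" and h2': "mop M2 v n h2 \<in> mspace M2" for n
    using lmodD(3)[OF A.M0_lmod v h(1)] lmodD(3)[OF B.M0_lmod v h(2)] .
  note lin = linear_on_add[OF ev_linear(2)[OF _ _ M]] linear_on_scale[OF ev_linear(2)[OF _ _ M]]
  note mem = ev_mem[OF h M]
  have "cvec.subspace {X \<in> cvec.span gens. ?P X}"
  proof (rule cvec.subspaceI)
    have "ev a b n 0 M = 0" if "a \<in> mspace M1" "b \<in> mspace M2" for a b n
      using linear_on_0[OF cvec.subspace_span ev_linear(2)[OF that M]] .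
    then have "jacA (mop M) (I 0) v h1 h2 l m k = (\<lambda>i. 0)" "jacB (I 0) (mop M2) v h1 h2 l m k = (\<lambda>i. 0)"
      "jacC (I 0) (mop M1) v h1 h2 l m k = (\<lambda>i. 0)"
      using h h1' h2' lmodD(5)[OF C.lm[OF M] vV] by (simp_all add: jacA_def jacB_def jacC_def I_def fun_eq_iff)
    then show "0 \<in> {X \<in> cvec.span gens. ?P X}" by (simp add: cvec.span_zero jac3_zero)
    show "X + Y \<in> {X \<in> cvec.span gens. ?P X}"
      if X: "X \<in> {X \<in> cvec.span gens. ?P X}" and Y: "Y \<in> {X \<in> cvec.span gens. ?P X}" for X Y
    proof -
      have XY: "X \<in> cvec.span gens" "Y \<in> cvec.span gens" using X Y by auto
      have "jacA (mop M) (I (X + Y)) v h1 h2 l m k =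
          (\<lambda>i. jacA (mop M) (I X) v h1 h2 l m k i + jacA (mop M) (I Y) v h1 h2 l m k i)"
        using XY h mem by (simp add: jacA_def I_def fun_eq_iff lin(1) linear_on_add[OF lM] scaleC_add_right)
      moreover have "jacB (I (X + Y)) (mop M2) v h1 h2 l m k =
          (\<lambda>i. jacB (I X) (mop M2) v h1 h2 l m k i + jacB (I Y) (mop M2) v h1 h2 l m k i)"
        using XY h h2' by (simp add: jacB_def I_def fun_eq_iff lin(1) scaleC_add_right)
      moreover have "jacC (I (X + Y)) (mop M1) v h1 h2 l m k =
          (\<lambda>i. jacC (I X) (mop M1) v h1 h2 l m k i + jacC (I Y) (mop M1) v h1 h2 l m k i)"
        using XY h h1' by (simp add: jacC_def I_def fun_eq_iff lin(1) scaleC_add_right)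
      ultimately have "?P (X + Y)" using X Y by (simp add: jac3_add)
      then show ?thesis using XY by (simp add: cvec.span_add)
    qed
    show "c *\<^sub>C X \<in> {X \<in> cvec.span gens. ?P X}" if X: "X \<in> {X \<in> cvec.span gens. ?P X}" for c X
    proof -
      have X': "X \<in> cvec.span gens" using X by auto
      have "jacA (mop M) (I (c *\<^sub>C X)) v h1 h2 l m k = (\<lambda>i. c *\<^sub>C jacA (mop M) (I X) v h1 h2 l m k i)"
        using X' h mem by (simp add: jacA_def I_def fun_eq_iff lin(2) linear_on_scale[OF lM] scaleC_scaleC mult.commute)
      moreover have "jacB (I (c *\<^sub>C X)) (mop M2) v h1 h2 l m k = (\<lambda>i. c *\<^sub>C jacB (I X) (mop M2) v h1 h2 l m k i)"
        using X' h h2' by (simp add: jacB_def I_def fun_eq_iff lin(2) scaleC_scaleC mult.commute)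
      moreover have "jacC (I (c *\<^sub>C X)) (mop M1) v h1 h2 l m k = (\<lambda>i. c *\<^sub>C jacC (I X) (mop M1) v h1 h2 l m k i)"
        using X' h h1' by (simp add: jacC_def I_def fun_eq_iff lin(2) scaleC_scaleC mult.commute)
      ultimately have "?P (c *\<^sub>C X)" using X by (simp add: jac3_scale)
      then show ?thesis using X' by (simp add: cvec.span_scale)
    qed
  qed
  moreover have "gens \<subseteq> {X \<in> cvec.span gens. ?P X}"
  proof
    fix X assume X: "X \<in> gens"
    obtain L1 L2 L3 f x1 x2 where g: "X = fus_gen V (L1, L2, L3) f x1 x2"
      "L1 \<in> fmods F1" "L2 \<in> fmods F2" "L3 \<in> fmods F3" "f \<in> intertwining_ops V L1 L2 L3"
      "x1 \<in> mspace L1" "x2 \<in> mspace L2" by (rule gensE[OF X])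
    let ?y1 = "A.transport v1 h1 L1 x1" and ?y2 = "B.transport v2 h2 L2 x2"
    have y: "?y1 \<in> mspace L1" "?y2 \<in> mspace L2" using g h by (auto intro: transport_mem)
    note eg = ev_gen[OF _ _ g(2,3,5,6,7), folded g(1)]
    have t1: "A.transport v1 (mop M1 v n h1) L1 x1 = mop L1 v n ?y1" for n
      by (rule A.transport_mop[OF h(1) v g(2)])
    have t2: "B.transport v2 (mop M2 v n h2) L2 x2 = mop L2 v n ?y2" for n
      by (rule B.transport_mop[OF h(2) v g(3)])
    have "?P X"
    proof (cases "M = L3")
      case True
      have "jacA (mop M) (I X) v h1 h2 l m k = jacA (mop L3) f v ?y1 ?y2 l m k"
        "jacB (I X) (mop M2) v h1 h2 l m k = jacB f (mop L2) v ?y1 ?y2 l m k"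
        "jacC (I X) (mop M1) v h1 h2 l m k = jacC f (mop L1) v ?y1 ?y2 l m k"
        using True by (simp_all add: fun_eq_iff jacA_def jacB_def jacC_def I_def eg h h1' h2' t1 t2)
      then show ?thesis
        using intertwining_jac3[OF A.lm[OF g(2)] B.lm[OF g(3)] C.lm[OF g(4)] g(5) vV y] by simp
    next
      case False
      have "jacA (mop M) (I X) v h1 h2 l m k = (\<lambda>i. 0)"
        "jacB (I X) (mop M2) v h1 h2 l m k = (\<lambda>i. 0)" "jacC (I X) (mop M1) v h1 h2 l m k = (\<lambda>i. 0)"
        using False lmodD(5)[OF C.lm[OF M] vV]
        by (simp_all add: fun_eq_iff jacA_def jacB_def jacC_def I_def eg h h1' h2')
      then show ?thesis by (simp add: jac3_zero)
    qed
    then show "X \<in> {X \<in> cvec.span gens. ?P X}" using X by (simp add: cvec.span_base)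
  qed
  ultimately have "cvec.span gens \<subseteq> {X \<in> cvec.span gens. ?P X}" by (intro cvec.span_minimal)
  then show ?thesis using X by blast
qed

lemma fact_linear: "linear_on (cvec.span gens) (I_act x)" "linear_on fsub (I_act x)"
  using linear_on_subset[OF fus_act_linear] span_fspace fsub_fspace by blast+

lemma moved_mem:
  assumes "a \<in> G" "L1 \<in> fmods F1" "L2 \<in> fmods F2" "L3 \<in> fmods F3" "f \<in> intertwining_ops V L1 L2 L3"
    "x1 \<in> mspace L1" "x2 \<in> mspace L2"
  shows "fus_moved a (L1, L2, L3) f x1 x2 \<in> fspace"
  using assms by (simp add: fus_moved_def fus_gen_mem A.phi_mem B.phi_mem tw_mem A.move_mem B.move_mem C.move_mem)

lemma fact_fspace:
  assumes a: "a \<in> G" and M: "M \<in> fmods F3" and X: "X \<in> cvec.span gens"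
  shows "I_act (gbasis a M) X \<in> fspace"
proof (rule linear_on_span_mem[OF fus_space_subspace fact_linear(1) _ X])
  fix X assume "X \<in> gens"
  then show "I_act (gbasis a M) X \<in> fspace"
    by (rule gensE)
      (auto simp: fus_act_gbasis[OF a M] fus_act1_gen[OF a] moved_mem[OF a] cvec.subspace_0[OF fus_space_subspace])
qed

text \<open>On a generator, transport commutes with \<phi>1 and \<phi>2 because the vectors lie on
  \<open>line\<close>, and the twisted operator then releases \<phi>3.\<close>

lemma ev_equivariant:
  assumes h: "h1 \<in> mspace M1" "h2 \<in> mspace M2" and a: "a \<in> G" and M: "M \<in> fmods F3"
    and X: "X \<in> cvec.span gens"
  shows "ev h1 h2 k (I_act (gbasis a M) X) (mv3 a M) = fphi F3 a M (ev h1 h2 k X M)"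
proof (rule ev_eqI[OF _ _ _ X])
  note aM = C.move_mem[OF M a]
  have im: "I_act (gbasis a M) ` cvec.span gens \<subseteq> fspace" using fact_fspace[OF a M] by blast
  show "linear_on (cvec.span gens) (\<lambda>X. ev h1 h2 k (I_act (gbasis a M) X) (mv3 a M))"
    by (rule linear_on_compose[OF fact_linear(1) im ev_linear(1)[OF h aM]])
  have im2: "(\<lambda>X. ev h1 h2 k X M) ` cvec.span gens \<subseteq> mspace M" using ev_mem[OF h M] by blast
  show "linear_on (cvec.span gens) (\<lambda>X. fphi F3 a M (ev h1 h2 k X M))"
    by (rule linear_on_compose[OF ev_linear(2)[OF h M] im2 C.phi_lin[OF a M]])
  fix L1 L2 L3 f x1 x2
  assume g: "L1 \<in> fmods F1" "L2 \<in> fmods F2" "L3 \<in> fmods F3" "f \<in> intertwining_ops V L1 L2 L3"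
    and line: "x1 \<in> A.line v1 L1" "x2 \<in> B.line v2 L2" and x: "x1 \<in> mspace L1" "x2 \<in> mspace L2"
  let ?X = "fus_gen V (L1, L2, L3) f x1 x2"
  have act: "I_act (gbasis a M) ?X = (if L3 = M then fus_moved a (L1, L2, L3) f x1 x2 else 0)"
    by (simp add: fus_act_gbasis[OF a M] fus_act1_gen[OF a g x])
  show "ev h1 h2 k (I_act (gbasis a M) ?X) (mv3 a M) = fphi F3 a M (ev h1 h2 k ?X M)"
  proof (cases "L3 = M")
    case True
    note y = transport_mem(1)[OF h(1) g(1) x(1)] transport_mem(2)[OF h(2) g(2) x(2)]
    have "ev h1 h2 k (fus_moved a (L1, L2, L3) f x1 x2) (mv3 a M) =
        tw a (L1, L2, L3) f (A.transport v1 h1 (mv1 a L1) (fphi F1 a L1 x1)) k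
          (B.transport v2 h2 (mv2 a L2) (fphi F2 a L2 x2))"
      unfolding fus_moved_def
      using ev_gen[OF h A.move_mem[OF g(1) a] B.move_mem[OF g(2) a] tw_mem[OF a g]
          A.phi_mem[OF a g(1) x(1)] B.phi_mem[OF a g(2) x(2)], of k "mv3 a M"] True by simp
    also have "\<dots> = fphi F3 a L3 (f (A.transport v1 h1 L1 x1) k (B.transport v2 h2 L2 x2))"
      unfolding A.transport_phi[OF v1 h(1) g(1) a line(1)] B.transport_phi[OF v2 h(2) g(2) a line(2)]
      by (rule tw_apply[OF a g(1,2) y])
    also have "\<dots> = fphi F3 a M (ev h1 h2 k ?X M)"
      unfolding ev_gen[OF h g(1,2,4) x] using True by simp
    finally show ?thesis using act True by simp
  next
    case False
    then show ?thesis
      using act linear_on_0[OF fus_space_subspace ev_linear(1)[OF h aM]] C.phi_0[OF a M]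
      by (simp add: ev_gen[OF h g(1,2,4) x])
  qed
qed

text \<open>Used with the unit of \<open>G\<close> to confine the values of a homomorphism on 1
  \<otimes> U to the components with third module \<open>K3\<close>.\<close>

lemma fact_support:
  assumes a: "a \<in> G" and M: "M \<in> fmods F3" and X: "X \<in> cvec.span gens" and L3: "L3 \<noteq> mv3 a M"
  shows "I_act (gbasis a M) X (L1, L2, L3) = 0"
proof -
  have moved_zero: "fus_moved a (K1, K2, M) f x1 x2 (L1, L2, L3) = 0" for K1 K2 f x1 x2
    using L3 by (simp add: fus_moved_def fus_gen_def dsum_in_def)
  have "I_act (gbasis a M) X (L1, L2, L3) \<in> {0}"
  proof (rule linear_on_span_mem[OF _ linear_on_eval[OF fact_linear(1)] _ X])
    fix X assume "X \<in> gens"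
    then show "I_act (gbasis a M) X (L1, L2, L3) \<in> {0}"
      by (rule gensE) (auto simp: fus_act_gbasis[OF a M] fus_act1_gen[OF a] moved_zero L3)
  qed simp
  then show ?thesis by simp
qed

text \<open>Transport from \<open>v1\<close> to \<open>v1\<close> and from \<open>v2\<close> to
  \<open>v2\<close> is the identity on \<open>line\<close>, so on the span of \<open>gens\<close>
  this is plain evaluation, and \<open>fus_eval_injective\<close> applies.\<close>

lemma ev_self_injective:
  assumes X: "X \<in> cvec.span gens" and M: "M \<in> fmods F3" and zero: "\<And>k. ev v1 v2 k X M = 0"
  shows "X (L1, L2, M) = 0"
proof (rule fus_eval_injective[OF A.V A.finite_fmods B.finite_fmods A.irr B.irr A.ineq B.ineq M C.lm[OF M]])
  have end1: "linear_endos (fmods F1) (\<lambda>_ x. x)" and end2: "linear_endos (fmods F2) (\<lambda>_ x. x)"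
    by (simp_all add: linear_endos_def linear_on_id)
  show "X \<in> fspace" using X span_fspace by blast
  show "fus_eval V (fmods F1) (fmods F2) (\<lambda>_ x. x) (\<lambda>_ x. x) k X M = 0" for k
  proof -
    have "fus_eval V (fmods F1) (fmods F2) (\<lambda>_ x. x) (\<lambda>_ x. x) k X M = ev v1 v2 k X M"
    proof (rule ev_eqI[OF linear_on_subset[OF fus_eval_linear[OF B.lm end1 end2 M] span_fspace]
          ev_linear(2)[OF v1(1) v2(1) M] _ X])
      fix L1 L2 f x1 x2 and L3 :: "('v, 'm3) vmod"
      assume g: "L1 \<in> fmods F1" "L2 \<in> fmods F2" "f \<in> intertwining_ops V L1 L2 L3"
        and line: "x1 \<in> A.line v1 L1" "x2 \<in> B.line v2 L2" and x: "x1 \<in> mspace L1" "x2 \<in> mspace L2"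
      show "fus_eval V (fmods F1) (fmods F2) (\<lambda>_ x. x) (\<lambda>_ x. x) k (fus_gen V (L1, L2, L3) f x1 x2) M =
          ev v1 v2 k (fus_gen V (L1, L2, L3) f x1 x2) M"
        using fus_eval_gen[OF B.lm end1 end2 A.finite_fmods B.finite_fmods g x, of k M]
          ev_gen[OF v1(1) v2(1) g x, of k M] A.transport_self[OF v1 line(1)] B.transport_self[OF v2 line(2)]
        by simp
    qed
    then show ?thesis using zero by simp
  qed
qed auto

subsection \<open>The injection\<close>

abbreviation H where
  "H \<equiv> hom_space (alg_space G F3) W3 (W_act V G F3 \<gamma>3) fsub I_act"

text \<open>Frobenius reciprocity in explicit form: the homomorphism is restricted to 1 \<otimes> U,
  evaluated with \<open>h1\<close> and \<open>h2\<close>, and read off in the component of the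
  representative \<open>K3\<close>. As a function of \<open>u\<close> this is a candidate element of
  \<open>M3\<close>.\<close>

definition \<Phi> :: "((('v, 'm3) galg, 'u3) tensor \<Rightarrow> ('v, 'm1, 'm2, 'm3) fus) \<Rightarrow>
    ('u1 \<Rightarrow> 'm1) \<Rightarrow> complex \<Rightarrow> ('u2 \<Rightarrow> 'm2) \<Rightarrow> 'u3 \<Rightarrow> 'm3" where
  "\<Phi> T h1 k h2 u = (if h1 \<in> mspace M1 \<and> h2 \<in> mspace M2 \<and> u \<in> U3
     then ev h1 h2 k (T (wt3 (gbasis e K3) u)) K3 else 0)"

lemma H_D:
  assumes "T \<in> H"
  shows "linear_on W3 T" "w \<in> W3 \<Longrightarrow> T w \<in> fsub" "w \<in> W3 \<Longrightarrow> T w \<in> cvec.span gens"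
    "w \<notin> W3 \<Longrightarrow> T w = 0"
    "a \<in> G \<Longrightarrow> M \<in> fmods F3 \<Longrightarrow> w \<in> W3 \<Longrightarrow> T (W_act V G F3 \<gamma>3 (gbasis a M) w) = I_act (gbasis a M) (T w)"
proof -
  have *: "linear_on W3 T" "T ` W3 \<subseteq> fsub" "\<forall>w. w \<notin> W3 \<longrightarrow> T w = 0"
    "\<forall>s\<in>alg_space G F3. \<forall>w\<in>W3. T (W_act V G F3 \<gamma>3 s w) = I_act s (T w)"
    using assms unfolding hom_space_def by blast+
  show "linear_on W3 T" "w \<in> W3 \<Longrightarrow> T w \<in> fsub" "w \<notin> W3 \<Longrightarrow> T w = 0" using * by blast+
  show "w \<in> W3 \<Longrightarrow> T w \<in> cvec.span gens" using *(2) fsub_gens by blast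
  have "gbasis a M \<in> alg_space G F3" if "a \<in> G" "M \<in> fmods F3"
    unfolding alg_space_def using that by (intro cvec.span_base) blast
  then show "a \<in> G \<Longrightarrow> M \<in> fmods F3 \<Longrightarrow> w \<in> W3 \<Longrightarrow>
      T (W_act V G F3 \<gamma>3 (gbasis a M) w) = I_act (gbasis a M) (T w)"
    using *(4) by blast
qed

lemma wt_e_mem: "u \<in> U3 \<Longrightarrow> wt3 (gbasis e K3) u \<in> W3"
  by (rule C.wt_mem[OF C.gb_D0[OF C.G_one]])

lemma \<Phi>_linear: "linear_on H \<Phi>"
  unfolding linear_on_def
proof (intro conjI ballI allI)
  fix T assume T: "T \<in> H"
  note lin = ev_linear(2)[OF _ _ C.L0]
  show "\<Phi> (c *\<^sub>C T) = c *\<^sub>C \<Phi> T" for c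
  proof (intro ext)
    fix h1 k h2 u
    have "(c *\<^sub>C T) w = c *\<^sub>C T w" for w by (simp only: scaleC_fun_def[of c T])
    moreover have "(c *\<^sub>C \<Phi> T) h1 k h2 u = c *\<^sub>C \<Phi> T h1 k h2 u" by (simp add: scaleC_fun_def)
    ultimately show "\<Phi> (c *\<^sub>C T) h1 k h2 u = (c *\<^sub>C \<Phi> T) h1 k h2 u"
      using H_D(3)[OF T wt_e_mem] by (simp add: \<Phi>_def linear_on_scale[OF lin])
  qed
  show "\<Phi> (T + T') = \<Phi> T + \<Phi> T'" if T': "T' \<in> H" for T'
  proof (intro ext)
    fix h1 k h2 u
    show "\<Phi> (T + T') h1 k h2 u = (\<Phi> T + \<Phi> T') h1 k h2 u"
      using H_D(3)[OF T wt_e_mem] H_D(3)[OF T' wt_e_mem] by (simp add: \<Phi>_def linear_on_add[OF lin])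
  qed
qed

text \<open>Equivariance under the stabilizer combines that of u \<mapsto> 1 \<otimes> u
  (\<open>wt_act_one\<close>), of \<open>T\<close>, and of evaluation
  (\<open>ev_equivariant\<close>).\<close>

lemma \<Phi>_in_M3:
  assumes T: "T \<in> H" and h: "h1 \<in> mspace M1" "h2 \<in> mspace M2"
  shows "\<Phi> T h1 k h2 \<in> mspace M3"
proof (rule C.M0_I)
  note ee = C.gb_D0[OF C.G_one]
  have "linear_on U3 (\<lambda>u. ev h1 h2 k (T (wt3 (gbasis e K3) u)) K3)"
    using wt_e_mem H_D(3)[OF T]
    by (intro linear_on_compose[OF linear_on_compose[OF C.wt_linear2[OF ee] _ H_D(1)[OF T]] _ ev_linear(2)[OF h C.L0]])
      auto
  then show "linear_on U3 (\<Phi> T h1 k h2)"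
    using h cvec.subspace_add[OF C.U_sub] cvec.subspace_scale[OF C.U_sub]
    by (simp add: linear_on_def \<Phi>_def)
  show "\<Phi> T h1 k h2 u \<in> mspace K3" if "u \<in> U3" for u
    using h that ev_mem[OF h C.L0 H_D(3)[OF T wt_e_mem[OF that]]] by (simp add: \<Phi>_def)
  show "\<Phi> T h1 k h2 u = 0" if "u \<notin> U3" for u using that by (simp add: \<Phi>_def)
  show "\<Phi> T h1 k h2 (aact (fsimp F3 \<gamma>3) (gbasis a K3) u) = fphi F3 a K3 (\<Phi> T h1 k h2 u)"
    if a: "a \<in> stabilizer V G K3" and u: "u \<in> U3" for a u
  proof -
    note aG = C.stabD(1)[OF a]
    have "T (wt3 (gbasis e K3) (aact (fsimp F3 \<gamma>3) (gbasis a K3) u)) = I_act (gbasis a K3) (T (wt3 (gbasis e K3) u))"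
      unfolding C.wt_act_one[OF a u] by (rule H_D(5)[OF T aG C.L0 wt_e_mem[OF u]])
    then show ?thesis
      using ev_equivariant[OF h aG C.L0 H_D(3)[OF T wt_e_mem[OF u]], of k] C.stabD(2)[OF a]
        C.act_mem[OF C.gb_S0[OF a] u] h u by (simp add: \<Phi>_def)
  qed
qed

text \<open>Evaluation gives a bound for each single \<open>u\<close>; as the value is a function on
  \<open>U3\<close>, a uniform bound is needed, and simplicity of \<open>U3\<close> extends the
  bound of one nonzero vector to all.\<close>

lemma \<Phi>_truncation:
  assumes T: "T \<in> H" and h: "h1 \<in> mspace M1" "h2 \<in> mspace M2"
  shows "\<exists>N::int. \<forall>n\<ge>N. \<Phi> T h1 (k + of_int n) h2 = 0"
proof -
  obtain u0 where u0: "u0 \<in> U3" "u0 \<noteq> 0" using C.ex_U by blast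
  obtain N :: int where N: "\<forall>n\<ge>N. ev h1 h2 (k + of_int n) (T (wt3 (gbasis e K3) u0)) K3 = 0"
    using ev_truncation[OF h C.L0 H_D(3)[OF T wt_e_mem[OF u0(1)]]] by blast
  note M3 = C.M0_D[OF \<Phi>_in_M3[OF T h]]
  let ?X = "{u \<in> U3. \<forall>n\<ge>N. \<Phi> T h1 (k + of_int n) h2 u = 0}"
  have "?X = U3"
  proof (rule C.U_eqI)
    show "cvec.subspace ?X"
      using cvec.subspace_0[OF C.U_sub] linear_on_0[OF C.U_sub M3(1)] cvec.subspace_add[OF C.U_sub]
        cvec.subspace_scale[OF C.U_sub]
      by (intro cvec.subspaceI) (simp_all add: linear_on_add[OF M3(1)] linear_on_scale[OF M3(1)])
    show "aact (fsimp F3 \<gamma>3) (gbasis a K3) u \<in> ?X" if "a \<in> stabilizer V G K3" "u \<in> ?X" for a u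
      using that M3(5)[OF that(1)] C.act_mem[OF C.gb_S0[OF that(1)]] C.phi_0[OF C.stabD(1)[OF that(1)] C.L0]
      by simp
    show "u0 \<in> ?X" using u0(1) N h by (simp add: \<Phi>_def)
  qed (use u0 in auto)
  then have "\<Phi> T h1 (k + of_int n) h2 u = 0" if "n \<ge> N" for n u
    using that M3(3)[of u] by (cases "u \<in> U3") blast+
  then show ?thesis by (intro exI[of _ N]) (simp add: fun_eq_iff)
qed

lemma \<Phi>_intertwining:
  assumes T: "T \<in> H"
  shows "\<Phi> T \<in> intertwining_ops VG M1 M2 M3"
proof -
  note X = H_D(3)[OF T wt_e_mem]
  have blin: "bilinear_on (mspace M1) (mspace M2) (\<lambda>h1 h2. ev h1 h2 k (T (wt3 (gbasis e K3) u)) K3)"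
    if "u \<in> U3" for k u by (rule ev_bilinear[OF C.L0 X[OF that]])
  have add1: "h \<in> mspace M1 \<Longrightarrow> h' \<in> mspace M1 \<Longrightarrow> h + h' \<in> mspace M1"
    and add2: "g \<in> mspace M2 \<Longrightarrow> g' \<in> mspace M2 \<Longrightarrow> g + g' \<in> mspace M2"
    and sc1: "h \<in> mspace M1 \<Longrightarrow> c *\<^sub>C h \<in> mspace M1" and sc2: "g \<in> mspace M2 \<Longrightarrow> c *\<^sub>C g \<in> mspace M2"
    for h h' g g' c
    using lmodD(1)[OF A.M0_lmod] lmodD(1)[OF B.M0_lmod] by (auto simp: cvec.subspace_add cvec.subspace_scale)
  have 1: "bilinear_on (mspace M1) (mspace M2) (\<lambda>h1. \<Phi> T h1 k)" for k
    using blin unfolding bilinear_on_def linear_on_def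
    by (simp add: \<Phi>_def fun_eq_iff scaleC_fun_def[where ?'a = 'u3] add1 add2 sc1 sc2)
  note 2 = \<Phi>_in_M3[OF T]
  have 3: "\<Phi> T h1 k h2 = 0" if "h1 \<notin> mspace M1 \<or> h2 \<notin> mspace M2" for h1 k h2
    using that by (auto simp: \<Phi>_def fun_eq_iff)
  note 4 = \<Phi>_truncation[OF T]
  have fixed_cnf: "cnf V \<in> vspace VG"
    using cnf_in_vspace[OF A.V] A.G_aut by (auto simp: A.fixed_vspace voa_aut_def)
  have 5: "\<Phi> T (Lop VG M1 (-1) h1) k h2 = - k *\<^sub>C \<Phi> T h1 (k - 1) h2"
    if h: "h1 \<in> mspace M1" "h2 \<in> mspace M2" for h1 k h2
  proof -
    have Lh: "Lop VG M1 (-1) h1 \<in> mspace M1"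
      using lmodD(3)[OF A.M0_lmod fixed_cnf h(1)] by (simp add: Lop_def fixed_voa_def)
    have "\<Phi> T (Lop VG M1 (-1) h1) k h2 u = - k *\<^sub>C \<Phi> T h1 (k - 1) h2 u" for u
      using h Lh ev_derivative[OF h C.L0 X, of u k] by (simp add: \<Phi>_def del: cvec.scale_minus_left)
    then show ?thesis by (simp add: fun_eq_iff scaleC_fun_def)
  qed
  have 6: "jacobi (mop M3) (\<Phi> T) (mop M2) (mop M1) v h1 h2"
    if v: "v \<in> vspace VG" and h: "h1 \<in> mspace M1" "h2 \<in> mspace M2" for v h1 h2
  proof (rule jac3_imp_jacobi, rule jac3_pointwise)
    fix l m k
    have vV: "v \<in> vspace V" using v by (simp add: A.fixed_vspace)
    have h1': "mop M1 v n h1 \<in> mspace M1" and h2': "mop M2 v n h2 \<in> mspace M2" for n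
      using lmodD(3)[OF A.M0_lmod v h(1)] lmodD(3)[OF B.M0_lmod v h(2)] .
    have z2: "\<Phi> T h1 k 0 = 0" for k
      using linear_on_0[OF lmodD(1)[OF B.M0_lmod] bilinear_onD(1)[OF 1 h(1)]] .
    have z1: "\<Phi> T 0 k h2 = 0" for k
      using linear_on_0[OF lmodD(1)[OF A.M0_lmod] bilinear_onD(2)[OF 1 h(2)]] .
    \<comment> \<open>These supports are finite uniformly in \<open>u\<close>: the bounds come from
      truncation in \<open>M1\<close> and \<open>M2\<close> and from
      \<open>\<Phi>_truncation\<close>, none of which refers to a point of
      \<open>U3\<close>.\<close>
    note jf = jac_finite[of "mop M3" v "\<Phi> T" h1 h2 "mop M2" "mop M1", OF lmodD(5)[OF C.M0_lmod v] z2 z1 4[OF h]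
        lmodD(4)[OF B.M0_lmod v h(2)] lmodD(4)[OF A.M0_lmod v h(1)]]
    show "finite {i. jacA (mop M3) (\<Phi> T) v h1 h2 l m k i \<noteq> 0}"
      "finite {i. jacB (\<Phi> T) (mop M2) v h1 h2 l m k i \<noteq> 0}"
      "finite {i. jacC (\<Phi> T) (mop M1) v h1 h2 l m k i \<noteq> 0}"
      by (rule jf)+
    fix u
    let ?I = "\<lambda>h1 k h2. ev h1 h2 k (T (wt3 (gbasis e K3) u)) K3"
    show "jac3 (\<lambda>i. jacA (mop M3) (\<Phi> T) v h1 h2 l m k i u) (\<lambda>i. jacB (\<Phi> T) (mop M2) v h1 h2 l m k i u)
        (\<lambda>i. jacC (\<Phi> T) (mop M1) v h1 h2 l m k i u)"
    proof (cases "u \<in> U3")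
      case True
      have "(\<lambda>i. jacA (mop M3) (\<Phi> T) v h1 h2 l m k i u) = jacA (mop K3) ?I v h1 h2 l m k"
        "(\<lambda>i. jacB (\<Phi> T) (mop M2) v h1 h2 l m k i u) = jacB ?I (mop M2) v h1 h2 l m k"
        "(\<lambda>i. jacC (\<Phi> T) (mop M1) v h1 h2 l m k i u) = jacC ?I (mop M1) v h1 h2 l m k"
        using True h h1' h2'
        by (simp_all add: fun_eq_iff jacA_def jacB_def jacC_def C.M0_mop scaleC_fun_def \<Phi>_def)
      then show ?thesis using ev_jacobi[OF h C.L0 X[OF True] v, of l m k] by simp
    next
      case False
      have "(\<lambda>i. jacA (mop M3) (\<Phi> T) v h1 h2 l m k i u) = (\<lambda>i. 0)"
        "(\<lambda>i. jacB (\<Phi> T) (mop M2) v h1 h2 l m k i u) = (\<lambda>i. 0)"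
        "(\<lambda>i. jacC (\<Phi> T) (mop M1) v h1 h2 l m k i u) = (\<lambda>i. 0)"
        using False lmodD(5)[OF C.lm[OF C.L0] vV]
        by (simp_all add: fun_eq_iff jacA_def jacB_def jacC_def C.M0_mop scaleC_fun_def \<Phi>_def)
      then show ?thesis by (simp add: jac3_zero)
    qed
  qed
  show ?thesis unfolding intertwining_ops_def using 1 2 3 4 5 6 by blast
qed

lemma H_subspace: "cvec.subspace H"
  by (rule hom_space_subspace[OF fsub_subspace fact_linear(2)])

text \<open>If the image is 0, evaluation at (\<open>v1\<close>, \<open>v2\<close>) shows that the
  components of \<open>T\<close> on 1 \<otimes> U with third module \<open>K3\<close> vanish. The
  remaining components are 0 by support, and 1 \<otimes> U generates W.\<close>

lemma \<Phi>_inj: "inj_on \<Phi> H"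
proof (rule linear_on_inj_on[OF H_subspace \<Phi>_linear])
  fix T assume T: "T \<in> H" and zero: "\<Phi> T = 0"
  have e0: "T (wt3 (gbasis e K3) u) = 0" if u: "u \<in> U3" for u
  proof -
    let ?w = "wt3 (gbasis e K3) u"
    note Xs = H_D(3)[OF T wt_e_mem[OF u]]
    let ?\<alpha> = "alpha V F3 K3 e e"
    have "ev v1 v2 k (T ?w) K3 = 0" for k
      using fun_cong[OF fun_cong[OF fun_cong[OF fun_cong[OF zero]]], of v1 k v2 u] v1(1) v2(1) u
      by (simp add: \<Phi>_def)
    then have comp: "T ?w (L1, L2, K3) = 0" for L1 L2 by (rule ev_self_injective[OF Xs C.L0])
    \<comment> \<open>The basis element 1 \<otimes> e(K3) acts on 1 \<otimes> U by the nonzero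
      scalar alpha(1,1), and its action on the target is supported on triples ending in
      \<open>K3\<close>.\<close>
    have "?\<alpha> *\<^sub>C T ?w = T (W_act V G F3 \<gamma>3 (gbasis e K3) ?w)"
      unfolding C.W_act_one[OF C.G_one u] by (rule linear_on_scale[OF H_D(1)[OF T] wt_e_mem[OF u], symmetric])
    also have "\<dots> = I_act (gbasis e K3) (T ?w)" by (rule H_D(5)[OF T C.G_one C.L0 wt_e_mem[OF u]])
    finally have act: "?\<alpha> *\<^sub>C T ?w = I_act (gbasis e K3) (T ?w)" .
    have "T ?w t = 0" for t
    proof -
      obtain L1 L2 L3 where t: "t = (L1, L2, L3)" by (cases t) auto
      show ?thesis
      proof (cases "L3 = K3")
        case True
        then show ?thesis using comp t by simp
      next
        case False
        then have "I_act (gbasis e K3) (T ?w) t = 0"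
          unfolding t using fact_support[OF C.G_one C.L0 Xs, of L3] C.move_one[OF C.L0] by simp
        then have "?\<alpha> *\<^sub>C T ?w t = 0" using fun_cong[OF act, of t] by (simp add: scaleC_fun_def[of ?\<alpha> "T ?w"])
        then show ?thesis using C.alpha_nonzero[OF C.L0 C.G_one C.G_one] by simp
      qed
    qed
    then show ?thesis by (simp add: fun_eq_iff)
  qed
  \<comment> \<open>Every a \<otimes> u is obtained from 1 \<otimes> u by the action of a, up to the
    nonzero scalar alpha(a,1), so the vanishing spreads to all of \<open>W3\<close>.\<close>
  have "T w = 0" if w: "w \<in> W3" for w
  proof -
    have "T w \<in> {0}"
    proof (rule C.W_space_mapI[OF _ H_D(1)[OF T] _ w])
      fix a u assume a: "a \<in> G" and u: "u \<in> U3"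
      have "alpha V F3 K3 a e *\<^sub>C T (wt3 (gbasis a K3) u) = T (W_act V G F3 \<gamma>3 (gbasis a K3) (wt3 (gbasis e K3) u))"
        unfolding C.W_act_one[OF a u]
        by (rule linear_on_scale[OF H_D(1)[OF T] C.wt_mem[OF C.gb_D0[OF a] u], symmetric])
      also have "\<dots> = I_act (gbasis a K3) 0" using H_D(5)[OF T a C.L0 wt_e_mem[OF u]] e0[OF u] by simp
      also have "\<dots> = 0" by (rule linear_on_0[OF fsub_subspace fact_linear(2)])
      finally show "T (wt3 (gbasis a K3) u) \<in> {0}" using C.alpha_nonzero[OF C.L0 C.G_one a] by simp
    qed simp
    then show ?thesis by simp
  qed
  then have "T w = 0" for w using H_D(4)[OF T] by (cases "w \<in> W3") auto
  then show "T = 0" by (intro ext) (simp only: zero_fun_apply)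
qed

end

theorem theorem2:
  fixes V :: "'v::complex_vector voa"
    and G :: "('v \<Rightarrow> 'v) set"
    and F1 :: "('v, 'm1::complex_vector, 'j1, 'u1::complex_vector) gfamily"
    and F2 :: "('v, 'm2::complex_vector, 'j2, 'u2::complex_vector) gfamily"
    and F3 :: "('v, 'm3::complex_vector, 'j3, 'u3::complex_vector) gfamily"
  assumes "simple_voa V"
    and "finite G" and "subgroup G (BijGroup (vspace V))" and "G \<subseteq> voa_aut V"
    and "gfamily V G F1" and "gfamily V G F2" and "gfamily V G F3"
    and "(j1, \<chi>1) \<in> Gamma V G F1" and "(j2, \<chi>2) \<in> Gamma V G F2" and "(j3, \<chi>3) \<in> Gamma V G F3"
    and "v10 \<in> mspace (M_module V G F1 (j1, \<chi>1))" and "v10 \<noteq> 0"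
    and "v20 \<in> mspace (M_module V G F2 (j2, \<chi>2))" and "v20 \<noteq> 0"
  shows "let
      H = hom_space (alg_space G F3)
        (W_space V G F3 (j3, \<chi>3)) (W_act V G F3 (j3, \<chi>3))
        (fus_sub V G F1 F2 F3 (j1, \<chi>1) (j2, \<chi>2) v10 v20) (fus_act V G F1 F2 F3);
      I = intertwining_ops (fixed_voa V G)
        (M_module V G F1 (j1, \<chi>1)) (M_module V G F2 (j2, \<chi>2)) (M_module V G F3 (j3, \<chi>3))
    in (\<exists>\<Phi>. linear_on H \<Phi> \<and> \<Phi> ` H \<subseteq> I \<and> inj_on \<Phi> H) \<and> (cdim H, cdim I) \<in> ordLeq"
proof -
  interpret fusion_setting V G F1 F2 F3 "(j1, \<chi>1)" "(j2, \<chi>2)" "(j3, \<chi>3)" v10 v20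
    using assms
    by (intro fusion_setting.intro three_families.intro stable_family_rep.intro stable_family.intro
        stable_family_rep_axioms.intro fusion_setting_axioms.intro) (simp_all add: simple_voa_def)
  have im: "\<Phi> ` H \<subseteq> intertwining_ops VG M1 M2 M3" using \<Phi>_intertwining by blast
  have "cvec.subspace (intertwining_ops VG M1 M2 M3)"
    by (rule subspace_intertwining_ops[OF A.M0_lmod B.M0_lmod C.M0_lmod])
  from cdim_mono[OF H_subspace this \<Phi>_linear im \<Phi>_inj] im \<Phi>_linear \<Phi>_inj
  show ?thesis unfolding Let_def by blast
qed

end
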